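(* Let $G=G_1\ast_A G_2$ be an amalgam of finite groups, and let $h_1,\ldots,h_k\in G$. Then there exists an algorithm which decides whether or not $H=\langle h_1,\ldots,h_k\rangle$ is a normal subgroup (of finite index) in $G$.
   Context: $G=G_1\ast_A G_2$ is a free product with amalgamation, where $G_1=\langle X_1\mid R_1\rangle$ and $G_2=\langle X_2\mid R_2\rangle$ are finite groups given by finite presentations with $X_1^{\pm}\cap X_2^{\pm}=\emptyset$, $A$ is a finite group generated by $Y$ with monomorphisms $\phi_i:A\to G_i$ ($i=1,2$), and $G=\langle X_1\cup X_2\mid R_1,R_2,\ \phi_1(a)=\phi_2(a)\ (a\in Y)\rangle$. The amalgam (the finite groups $G_1,G_2,A$, their presentations, the monomorphisms, and the Cayley graphs and all relative (coset) Cayley graphs of $G_1$ and $G_2$) is fixed and given to the algorithm. Elements of $G$ are input as words in the letters $X^{\pm}$, where $X=X_1\cup X_2$. *)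

theory Defs
  imports
    "HOL-Algebra.Coset"
    "HOL-Algebra.Generated_Groups"
    "HOL-Library.Nat_Bijection"
begin

section \<open>Groups given by presentations\<close>

text \<open>The letter \<open>(x, True)\<close> stands for the generator \<open>x\<close> and \<open>(x, False)\<close> for its formal inverse,
  so \<open>letters X\<close> is the symmetrised alphabet of the generating set \<open>X\<close>.\<close>

type_synonym 'x letter = "'x \<times> bool"
type_synonym 'x word = "'x letter list"

definition letters :: "'x set \<Rightarrow> 'x letter set" where
  "letters X = X \<times> UNIV"

definition words :: "'x set \<Rightarrow> 'x word set" where
  "words X = lists (letters X)"

definition word_inv :: "'x word \<Rightarrow> 'x word" where
  "word_inv w = rev (map (\<lambda>(x, b). (x, \<not> b)) w)"

text \<open>The least congruence on \<open>words X\<close> that contains free cancellation and kills the relators in \<open>R\<close>.\<close>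

inductive pres_eq :: "'x set \<Rightarrow> 'x word set \<Rightarrow> 'x word \<Rightarrow> 'x word \<Rightarrow> bool"
  for X :: "'x set" and R :: "'x word set" where
  pres_refl: "u \<in> words X \<Longrightarrow> pres_eq X R u u"
| pres_sym: "pres_eq X R u v \<Longrightarrow> pres_eq X R v u"
| pres_trans: "pres_eq X R u v \<Longrightarrow> pres_eq X R v w \<Longrightarrow> pres_eq X R u w"
| pres_append: "pres_eq X R u u' \<Longrightarrow> pres_eq X R v v' \<Longrightarrow> pres_eq X R (u @ v) (u' @ v')"
| pres_cancel: "x \<in> X \<Longrightarrow> pres_eq X R [(x, b), (x, \<not> b)] []"
| pres_relator: "r \<in> R \<Longrightarrow> r \<in> words X \<Longrightarrow> pres_eq X R r []"

definition pres_class :: "'x set \<Rightarrow> 'x word set \<Rightarrow> 'x word \<Rightarrow> 'x word set" where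
  "pres_class X R w = {v. pres_eq X R w v}"

definition presented_group :: "'x set \<Rightarrow> 'x word set \<Rightarrow> 'x word set monoid" where
  "presented_group X R =
     \<lparr>carrier = pres_class X R ` words X,
      mult = (\<lambda>U V. {w. \<exists>u\<in>U. \<exists>v\<in>V. pres_eq X R (u @ v) w}),
      one = pres_class X R []\<rparr>"

lemma words_Nil [simp]: "[] \<in> words X"
  by (simp add: words_def)

lemma words_append [simp]: "u @ v \<in> words X \<longleftrightarrow> u \<in> words X \<and> v \<in> words X"
  by (auto simp: words_def)

lemma word_inv_words: "w \<in> words X \<Longrightarrow> word_inv w \<in> words X"
  by (auto simp: words_def word_inv_def letters_def)

lemma pres_eq_words: "pres_eq X R u v \<Longrightarrow> u \<in> words X \<and> v \<in> words X"
  by (induction rule: pres_eq.induct) (auto simp: words_def letters_def)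

lemma pres_class_eq_iff:
  assumes "u \<in> words X"
  shows "pres_class X R u = pres_class X R v \<longleftrightarrow> pres_eq X R u v"
  using assms unfolding pres_class_def
  by (blast intro: pres_refl pres_sym pres_trans)

lemma pres_class_mult:
  assumes "u \<in> words X" "v \<in> words X"
  shows "pres_class X R u \<otimes>\<^bsub>presented_group X R\<^esub> pres_class X R v = pres_class X R (u @ v)"
proof -
  have "(\<exists>u'. pres_eq X R u u' \<and> (\<exists>v'. pres_eq X R v v' \<and> pres_eq X R (u' @ v') w))
      \<longleftrightarrow> pres_eq X R (u @ v) w" for w
    using assms by (meson pres_append pres_refl pres_sym pres_trans)
  then show ?thesis
    by (simp add: presented_group_def pres_class_def Bex_def)
qed

lemma pres_eq_word_inv:
  assumes "w \<in> words X"
  shows "pres_eq X R (word_inv w @ w) []"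
  using assms
proof (induction w)
  case Nil
  then show ?case by (simp add: word_inv_def pres_refl)
next
  case (Cons a w)
  obtain x b where a: "a = (x, b)" by (cases a)
  have x: "x \<in> X" and w: "w \<in> words X"
    using Cons.prems by (auto simp: a words_def letters_def)
  have "pres_eq X R ([(x, \<not> b), (x, b)] @ w) ([] @ w)"
    using pres_cancel[OF x, of R "\<not> b"] w by (intro pres_append pres_refl) simp_all
  then have "pres_eq X R (word_inv w @ ([(x, \<not> b), (x, b)] @ w)) (word_inv w @ w)"
    using word_inv_words[OF w] by (intro pres_append pres_refl) simp_all
  then have "pres_eq X R (word_inv w @ ([(x, \<not> b), (x, b)] @ w)) []"
    using Cons.IH[OF w] by (rule pres_trans)
  then show ?case by (simp add: a word_inv_def)
qed

lemma carrier_presented_group: "carrier (presented_group X R) = pres_class X R ` words X"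
  by (simp add: presented_group_def)

lemma group_presented_group: "group (presented_group X R)"
proof (rule groupI)
  fix U V assume "U \<in> carrier (presented_group X R)" "V \<in> carrier (presented_group X R)"
  then show "U \<otimes>\<^bsub>presented_group X R\<^esub> V \<in> carrier (presented_group X R)"
    by (auto simp: carrier_presented_group pres_class_mult)
next
  show "\<one>\<^bsub>presented_group X R\<^esub> \<in> carrier (presented_group X R)"
    by (simp add: presented_group_def)
next
  fix U V W assume "U \<in> carrier (presented_group X R)" "V \<in> carrier (presented_group X R)"
    "W \<in> carrier (presented_group X R)"
  then show "U \<otimes>\<^bsub>presented_group X R\<^esub> V \<otimes>\<^bsub>presented_group X R\<^esub> W =
      U \<otimes>\<^bsub>presented_group X R\<^esub> (V \<otimes>\<^bsub>presented_group X R\<^esub> W)"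
    by (auto simp: carrier_presented_group pres_class_mult)
next
  fix U assume "U \<in> carrier (presented_group X R)"
  then obtain u where u: "u \<in> words X" "U = pres_class X R u"
    by (auto simp: presented_group_def)
  have one: "\<one>\<^bsub>presented_group X R\<^esub> = pres_class X R []"
    by (simp add: presented_group_def)
  show "\<one>\<^bsub>presented_group X R\<^esub> \<otimes>\<^bsub>presented_group X R\<^esub> U = U"
    using pres_class_mult[of "[]" X u R] u by (simp add: one)
  have "pres_class X R (word_inv u) \<otimes>\<^bsub>presented_group X R\<^esub> U = \<one>\<^bsub>presented_group X R\<^esub>"
    using u pres_eq_word_inv[OF u(1), of R] word_inv_words[OF u(1)]
    by (simp add: one pres_class_mult pres_class_eq_iff)
  moreover have "pres_class X R (word_inv u) \<in> carrier (presented_group X R)"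
    using word_inv_words[OF u(1)] by (simp add: presented_group_def)
  ultimately show "\<exists>V\<in>carrier (presented_group X R).
      V \<otimes>\<^bsub>presented_group X R\<^esub> U = \<one>\<^bsub>presented_group X R\<^esub>" by blast
qed

text \<open>Relators of the amalgamated product.  The words \<open>w1 a\<close> and \<open>w2 a\<close> are chosen
  representatives of the images of \<open>a\<close> in the two factors.\<close>

definition amalgam_relators ::
  "'x word set \<Rightarrow> 'x word set \<Rightarrow> 'a set \<Rightarrow> ('a \<Rightarrow> 'x word) \<Rightarrow> ('a \<Rightarrow> 'x word) \<Rightarrow> 'x word set" where
  "amalgam_relators R1 R2 Y w1 w2 = R1 \<union> R2 \<union> (\<lambda>a. w1 a @ word_inv (w2 a)) ` Y"

definition subgroup_of_words :: "'x set \<Rightarrow> 'x word set \<Rightarrow> 'x word list \<Rightarrow> 'x word set set" where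
  "subgroup_of_words X R hs = generate (presented_group X R) (pres_class X R ` set hs)"


section \<open>Algorithms\<close>

text \<open>Algorithms are programs for Kleene's partial recursive functions; \<open>rec_eval f xs y\<close> says that
  the program \<open>f\<close> halts on the arguments \<open>xs\<close> with output \<open>y\<close>.  \<open>Prim f g\<close> recurses on, and
  \<open>Mu f\<close> searches for, the first argument.\<close>

datatype recf = Zero | Succ | Proj nat | Comp recf "recf list" | Prim recf recf | Mu recf

inductive rec_eval :: "recf \<Rightarrow> nat list \<Rightarrow> nat \<Rightarrow> bool" where
  eval_Zero: "rec_eval Zero xs 0"
| eval_Succ: "rec_eval Succ [x] (Suc x)"
| eval_Proj: "i < length xs \<Longrightarrow> rec_eval (Proj i) xs (xs ! i)"
| eval_Comp: "list_all2 (\<lambda>g y. rec_eval g xs y) gs ys \<Longrightarrow> rec_eval f ys z \<Longrightarrow>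
    rec_eval (Comp f gs) xs z"
| eval_Prim_0: "rec_eval f xs y \<Longrightarrow> rec_eval (Prim f g) (0 # xs) y"
| eval_Prim_Suc: "rec_eval (Prim f g) (n # xs) r \<Longrightarrow> rec_eval g (n # r # xs) y \<Longrightarrow>
    rec_eval (Prim f g) (Suc n # xs) y"
| eval_Mu: "rec_eval f (n # xs) 0 \<Longrightarrow> (\<And>m. m < n \<Longrightarrow> \<exists>k. rec_eval f (m # xs) (Suc k)) \<Longrightarrow>
    rec_eval (Mu f) xs n"

inductive_cases eval_ZeroE: "rec_eval Zero xs y"
inductive_cases eval_SuccE: "rec_eval Succ xs y"
inductive_cases eval_ProjE: "rec_eval (Proj i) xs y"
inductive_cases eval_CompE: "rec_eval (Comp f gs) xs y"
inductive_cases eval_Prim_0E: "rec_eval (Prim f g) (0 # xs) y"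
inductive_cases eval_Prim_SucE: "rec_eval (Prim f g) (Suc n # xs) y"
inductive_cases eval_MuE: "rec_eval (Mu f) xs y"

lemma rec_eval_deterministic: "rec_eval f xs y \<Longrightarrow> rec_eval f xs z \<Longrightarrow> y = z"
proof (induction arbitrary: z rule: rec_eval.induct)
  case (eval_Comp xs gs ys f z')
  from eval_Comp.prems obtain ys' where
    ys': "list_all2 (\<lambda>g y. rec_eval g xs y) gs ys'" "rec_eval f ys' z"
    by (blast elim: eval_CompE)
  have "ys = ys'"
    using eval_Comp.IH(1) ys'(1)
    by (auto simp: list_all2_conv_all_nth intro!: nth_equalityI)
  with ys'(2) eval_Comp.IH(2) show ?case by blast
next
  case (eval_Mu f n xs)
  from eval_Mu.prems have z: "rec_eval f (z # xs) 0"
    and less: "\<And>m. m < z \<Longrightarrow> \<exists>k. rec_eval f (m # xs) (Suc k)"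
    by (blast elim: eval_MuE)+
  have "\<not> z < n" using eval_Mu.IH(2) z by fastforce
  moreover have "\<not> n < z" using eval_Mu.IH(1) less by fastforce
  ultimately show ?case by simp
next
  case (eval_Prim_Suc f g n xs r y)
  from eval_Prim_Suc.prems obtain r' where
    "rec_eval (Prim f g) (n # xs) r'" "rec_eval g (n # r' # xs) z"
    by (blast elim: eval_Prim_SucE)
  with eval_Prim_Suc.IH show ?case by blast
qed (blast elim: eval_ZeroE eval_SuccE eval_ProjE eval_Prim_0E)+

text \<open>\<open>P\<close> is decidable on the set \<open>D\<close> of admissible inputs, an input \<open>x\<close> being presented to the
  algorithm as the number \<open>code x\<close>.\<close>

definition decidable_on :: "('i \<Rightarrow> nat) \<Rightarrow> 'i set \<Rightarrow> ('i \<Rightarrow> bool) \<Rightarrow> bool" where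
  "decidable_on code D P \<longleftrightarrow>
     (\<exists>f. \<forall>x\<in>D. rec_eval f [code x] (if P x then 1 else 0))"

text \<open>Codes of words and of tuples of words, relative to a numbering \<open>c\<close> of the generators.\<close>

definition letter_code :: "('x \<Rightarrow> nat) \<Rightarrow> 'x letter \<Rightarrow> nat" where
  "letter_code c l = prod_encode (c (fst l), of_bool (snd l))"

definition word_code :: "('x \<Rightarrow> nat) \<Rightarrow> 'x word \<Rightarrow> nat" where
  "word_code c w = list_encode (map (letter_code c) w)"

definition tuple_code :: "('x \<Rightarrow> nat) \<Rightarrow> 'x word list \<Rightarrow> nat" where
  "tuple_code c hs = list_encode (map (word_code c) hs)"

end

theory Submission
  imports Defs "HOL-Algebra.SndIsomorphismGrp"
begin

text \<open>
  The idea is to decide both questions by looking at finite permutation representations of \<open>G\<close>.  An action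
  of \<open>G\<close> is a pair of actions of the two factors that agree on \<open>A\<close>.  So new actions arise
  by keeping the action of \<open>G1\<close> and conjugating that of \<open>G2\<close> by a bijection which commutes with
  \<open>A\<close> (lemma \<open>acts_twist\<close>).  Three such twists carry the proof.

  The first provides a finite set \<open>\<Omega>\<close> with an action of \<open>G\<close> that is free for both factors
  (\<open>ex_free_model\<close>).  In \<open>G1 \<times> G2\<close> each factor translates its own coordinate; the two restrictions to
  \<open>A\<close> are free actions on the same finite set and can therefore be identified.

  The second separates an element \<open>g\<close> from a finitely generated subgroup \<open>H\<close> that does not contain
  it (\<open>separation\<close>).  One cuts a finite piece out of \<open>G/H \<times> \<Omega>\<close> in which the generators of \<open>H\<close> and
  \<open>g\<close> can be read from the base set \<open>{H} \<times> \<Omega>\<close>, and completes it to a finite set with an action of \<open>G\<close>.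
  The generators of \<open>H\<close> preserve the base set and \<open>g\<close> does not.  The completion succeeds because
  all actions of the factors involved are free, so that only numbers of orbits have to be balanced; and its size
  is bounded linearly in the lengths of the given words.  Hence \<open>g\<close> belongs to \<open>H\<close> if and only if, in every action
  on a set of one explicitly known size, \<open>g\<close> preserves whatever marked subset the generators
  preserve (\<open>mem_subgroup_iff\<close>).  These are finitely many actions, so membership is decidable, and
  with it normality, which is membership of finitely many conjugates.

  The third shows that a finitely generated normal subgroup \<open>H\<close> of infinite index in an infinite \<open>G\<close> acts
  faithfully on \<open>\<Omega>\<close> (\<open>normal_infinite_index_trivial\<close>).  The coset space \<open>G/H \<times> \<Omega>\<close> is joined
  to \<open>G\<close> itself by an interchange outside everything the generators can see.  The elements of \<open>H\<close> that act
  trivially on \<open>\<Omega>\<close> keep fixing the base points and, being a normal subgroup, the whole orbit; but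
  this now contains a point of \<open>G\<close> where a given element acts by translation.
  Consequently the finite normal subgroups of \<open>G\<close> have bounded order and there is a largest one, \<open>D\<close>.  A
  finitely generated normal \<open>H\<close> has finite index if and only if it is not contained in \<open>D\<close>, which is again a question
  of membership.  If \<open>G\<close> is finite, every index is finite.

  As programs, the tests are bounded quantifications over the numbers whose digits tabulate an action on
  an initial segment of the natural numbers, so they are primitive recursive.
\<close>

section \<open>Words acting on sets\<close>

definition run :: "('x letter \<Rightarrow> 'e \<Rightarrow> 'e) \<Rightarrow> 'x word \<Rightarrow> 'e \<Rightarrow> 'e" where
  "run T w e = foldl (\<lambda>e l. T l e) e w"

lemma run_Nil [simp]: "run T [] e = e"
  and run_Cons [simp]: "run T (l # w) e = run T w (T l e)"
  and run_append [simp]: "run T (u @ v) e = run T v (run T u e)"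
  by (simp_all add: run_def)

text \<open>A group given by \<open>X\<close> and \<open>R\<close> acts on \<open>E\<close> from the right; only the maps of the letters are given.
  An action is thus finite data once \<open>E\<close> is finite, and it can be altered letter by letter.\<close>

definition acts :: "'x set \<Rightarrow> 'x word set \<Rightarrow> ('x letter \<Rightarrow> 'e \<Rightarrow> 'e) \<Rightarrow> 'e set \<Rightarrow> bool" where
  "acts X R T E \<longleftrightarrow>
     (\<forall>l\<in>letters X. \<forall>e\<in>E. T l e \<in> E) \<and>
     (\<forall>x\<in>X. \<forall>b. \<forall>e\<in>E. T (x, \<not> b) (T (x, b) e) = e) \<and>
     (\<forall>r\<in>R \<inter> words X. \<forall>e\<in>E. run T r e = e)"

text \<open>Point stabilisers are trivial in the presented group, so each orbit is a copy of that group.\<close>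

definition acts_freely :: "'x set \<Rightarrow> 'x word set \<Rightarrow> ('x letter \<Rightarrow> 'e \<Rightarrow> 'e) \<Rightarrow> 'e set \<Rightarrow> bool" where
  "acts_freely X R T E \<longleftrightarrow> acts X R T E \<and>
     (\<forall>e\<in>E. \<forall>u\<in>words X. run T u e = e \<longrightarrow> pres_eq X R u [])"

lemma words_Cons [simp]: "l # w \<in> words X \<longleftrightarrow> l \<in> letters X \<and> w \<in> words X"
  by (auto simp: words_def)

lemma words_mono: "X \<subseteq> Y \<Longrightarrow> words X \<subseteq> words Y"
  by (auto simp: words_def letters_def lists_eq_set)

lemma words_take: "w \<in> words X \<Longrightarrow> take n w \<in> words X"
  by (auto simp: words_def lists_eq_set dest: in_set_takeD)

lemma word_inv_word_inv [simp]: "word_inv (word_inv w) = w"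
  by (induction w) (auto simp: word_inv_def)

lemma pres_eq_word_inv_right: "w \<in> words X \<Longrightarrow> pres_eq X R (w @ word_inv w) []"
  using pres_eq_word_inv[of "word_inv w" X R] by (simp add: word_inv_words)

lemma pres_eq_mono:
  assumes "pres_eq X R u v" "X \<subseteq> X'" "\<And>r. r \<in> R \<Longrightarrow> r \<in> words X \<Longrightarrow> pres_eq X' R' r []"
  shows "pres_eq X' R' u v"
  using assms(1)
proof induction
  case (pres_refl u)
  then show ?case using words_mono[OF assms(2)] by (blast intro: pres_eq.pres_refl)
next
  case (pres_sym u v)
  show ?case by (rule pres_eq.pres_sym) fact
next
  case (pres_trans u v w)
  show ?case by (rule pres_eq.pres_trans) fact+
next
  case (pres_append u u' v v')
  show ?case by (rule pres_eq.pres_append) fact+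
next
  case (pres_cancel x b)
  then show ?case using assms(2) by (blast intro: pres_eq.pres_cancel)
next
  case (pres_relator r)
  then show ?case by (rule assms(3))
qed

lemma run_closed:
  assumes "acts X R T E" "w \<in> words X" "e \<in> E"
  shows "run T w e \<in> E"
  using assms(2,3) by (induction w arbitrary: e) (use assms(1) in \<open>auto simp: acts_def\<close>)

lemma run_pres_eq:
  assumes T: "acts X R T E" and "pres_eq X R u v" "e \<in> E"
  shows "run T u e = run T v e"
  using assms(2,3)
proof (induction arbitrary: e rule: pres_eq.induct)
  case (pres_append u u' v v')
  then show ?case using run_closed[OF T] pres_eq_words by fastforce
qed (use T in \<open>auto simp: acts_def\<close>)

lemma run_word_inv:
  assumes "acts X R T E" "w \<in> words X" "e \<in> E"
  shows "run T (word_inv w) (run T w e) = e" "run T w (run T (word_inv w) e) = e"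
  using run_pres_eq[OF assms(1) pres_eq_word_inv[OF assms(2)] assms(3)]
    run_pres_eq[OF assms(1) pres_eq_word_inv_right[OF assms(2)] assms(3)] by simp_all

lemma run_inj:
  assumes "acts X R T E" "w \<in> words X" "e \<in> E" "e' \<in> E" "run T w e = run T w e'"
  shows "e = e'"
  using run_word_inv(1)[OF assms(1,2,3)] run_word_inv(1)[OF assms(1,2,4)] assms(5) by metis

lemma acts_subset:
  assumes "acts X R T E" "Z \<subseteq> E" "\<And>u z. u \<in> words X \<Longrightarrow> z \<in> Z \<Longrightarrow> run T u z \<in> Z"
  shows "acts X R T Z"
  using assms(1,2) assms(3)[of "[l]" for l] by (auto simp: acts_def subset_iff)

lemma acts_freely_eqD:
  assumes "acts_freely X R T E" "u \<in> words X" "v \<in> words X" "e \<in> E" "run T u e = run T v e"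
  shows "pres_eq X R u v"
proof -
  have T: "acts X R T E" using assms(1) by (simp add: acts_freely_def)
  have "run T (u @ word_inv v) e = e"
    using assms(5) run_word_inv(1)[OF T assms(3,4)] by simp
  then have 1: "pres_eq X R (u @ word_inv v) []"
    using assms word_inv_words unfolding acts_freely_def by (metis words_append)
  have "pres_eq X R ((u @ word_inv v) @ v) ([] @ v)"
    by (intro pres_append 1 pres_refl assms)
  moreover have "pres_eq X R (u @ (word_inv v @ v)) (u @ [])"
    by (intro pres_append pres_eq_word_inv pres_refl assms)
  ultimately show ?thesis by (simp add: pres_sym) (meson pres_sym pres_trans)
qed

subsection \<open>The presented group\<close>

lemma one_presented_group: "\<one>\<^bsub>presented_group X R\<^esub> = pres_class X R []"
  by (simp add: presented_group_def)

lemma inv_pres_class: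
  assumes "w \<in> words X"
  shows "inv\<^bsub>presented_group X R\<^esub> (pres_class X R w) = pres_class X R (word_inv w)"
proof (rule group.inv_equality[OF group_presented_group])
  show "pres_class X R (word_inv w) \<otimes>\<^bsub>presented_group X R\<^esub> pres_class X R w = \<one>\<^bsub>presented_group X R\<^esub>"
    using assms by (simp add: pres_class_mult word_inv_words one_presented_group
        pres_class_eq_iff pres_eq_word_inv)
qed (use assms word_inv_words[OF assms] in \<open>auto simp: carrier_presented_group\<close>)

lemma pres_class_in_carrier: "w \<in> words X \<Longrightarrow> pres_class X R w \<in> carrier (presented_group X R)"
  by (simp add: carrier_presented_group)

lemma in_carrier_pres_class:
  assumes "g \<in> carrier (presented_group X R)"
  obtains w where "w \<in> words X" "g = pres_class X R w"
  using assms by (auto simp: carrier_presented_group)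

lemma mem_pres_class: "w \<in> words X \<Longrightarrow> w \<in> pres_class X R w"
  by (simp add: pres_class_def pres_refl)

lemma pres_class_memD:
  assumes "g \<in> carrier (presented_group X R)" "w \<in> g"
  shows "w \<in> words X" "g = pres_class X R w"
proof -
  obtain u where u: "u \<in> words X" "g = pres_class X R u"
    using assms(1) by (rule in_carrier_pres_class)
  with assms(2) have "pres_eq X R u w" by (simp add: pres_class_def)
  then show "w \<in> words X" "g = pres_class X R w"
    using pres_eq_words u pres_class_eq_iff by blast+
qed

text \<open>Elements of a presented group are classes of words, so an element acts through any of its words.\<close>

definition pick :: "'x word set \<Rightarrow> 'x word" where
  "pick g = (SOME w. w \<in> g)"

lemma pick:
  assumes "g \<in> carrier (presented_group X R)"
  shows "pick g \<in> words X" "pres_class X R (pick g) = g"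
proof -
  have "pick g \<in> g"
    using assms mem_pres_class unfolding pick_def by (metis in_carrier_pres_class someI)
  then show "pick g \<in> words X" "pres_class X R (pick g) = g"
    using pres_class_memD[OF assms] by auto
qed

lemma pick_pres_eq: "w \<in> words X \<Longrightarrow> pres_eq X R (pick (pres_class X R w)) w"
  using pick[OF pres_class_in_carrier] by (metis pres_class_eq_iff)

section \<open>Free actions of finite groups\<close>

definition free_action :: "('a, 'm) monoid_scheme \<Rightarrow> ('a \<Rightarrow> 'e \<Rightarrow> 'e) \<Rightarrow> 'e set \<Rightarrow> bool" where
  "free_action A \<alpha> U \<longleftrightarrow>
     (\<forall>a\<in>carrier A. \<forall>u\<in>U. \<alpha> a u \<in> U) \<and>
     (\<forall>a\<in>carrier A. \<forall>b\<in>carrier A. \<forall>u\<in>U. \<alpha> (a \<otimes>\<^bsub>A\<^esub> b) u = \<alpha> b (\<alpha> a u)) \<and>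
     (\<forall>a\<in>carrier A. \<forall>u\<in>U. \<alpha> a u = u \<longleftrightarrow> a = \<one>\<^bsub>A\<^esub>)"

lemma free_actionD:
  assumes "free_action A \<alpha> U" "a \<in> carrier A" "u \<in> U"
  shows "\<alpha> a u \<in> U" "\<alpha> a u = u \<longleftrightarrow> a = \<one>\<^bsub>A\<^esub>"
    and "b \<in> carrier A \<Longrightarrow> \<alpha> (a \<otimes>\<^bsub>A\<^esub> b) u = \<alpha> b (\<alpha> a u)"
  using assms by (auto simp: free_action_def)

lemma free_action_inv:
  assumes "group A" "free_action A \<alpha> U" "a \<in> carrier A" "u \<in> U"
  shows "\<alpha> (inv\<^bsub>A\<^esub> a) (\<alpha> a u) = u"
proof -
  interpret group A by fact
  have "\<alpha> (inv\<^bsub>A\<^esub> a) (\<alpha> a u) = \<alpha> (a \<otimes>\<^bsub>A\<^esub> inv\<^bsub>A\<^esub> a) u"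
    using free_actionD(3)[OF assms(2-4) inv_closed[OF assms(3)]] by simp
  also have "\<dots> = \<alpha> \<one>\<^bsub>A\<^esub> u" using assms(3) by simp
  also have "\<dots> = u" using free_actionD(2)[OF assms(2) _ assms(4)] by simp
  finally show ?thesis .
qed

lemma free_action_inj:
  assumes "group A" "free_action A \<alpha> U" "u \<in> U" "a \<in> carrier A" "b \<in> carrier A" "\<alpha> a u = \<alpha> b u"
  shows "a = b"
proof -
  interpret group A by fact
  have "\<alpha> (a \<otimes>\<^bsub>A\<^esub> inv\<^bsub>A\<^esub> b) u = \<alpha> (inv\<^bsub>A\<^esub> b) (\<alpha> b u)"
    unfolding assms(6)[symmetric] by (rule free_actionD(3)[OF assms(2,4,3) inv_closed[OF assms(5)]])
  also have "\<dots> = u" by (rule free_action_inv[OF assms(1,2,5,3)])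
  finally have "a \<otimes>\<^bsub>A\<^esub> inv\<^bsub>A\<^esub> b = \<one>\<^bsub>A\<^esub>"
    using free_actionD(2)[OF assms(2) _ assms(3), of "a \<otimes>\<^bsub>A\<^esub> inv\<^bsub>A\<^esub> b"] assms(4,5) by simp
  then show ?thesis using assms(4,5) by (metis inv_closed inv_equality inv_inv)
qed

lemma free_action_orbit:
  assumes "group A" "free_action A \<alpha> U" "u \<in> U"
  defines "O1 \<equiv> (\<lambda>a. \<alpha> a u) ` carrier A"
  shows "O1 \<subseteq> U" "card O1 = card (carrier A)" "free_action A \<alpha> (U - O1)" "u \<in> O1"
proof -
  interpret group A by fact
  show O1: "O1 \<subseteq> U" using assms by (auto simp: free_action_def)
  have "inj_on (\<lambda>a. \<alpha> a u) (carrier A)"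
    using free_action_inj[OF assms(1-3)] by (auto intro: inj_onI)
  then show "card O1 = card (carrier A)" by (simp add: O1_def card_image)
  have "\<alpha> a z \<notin> O1" if z: "z \<in> U - O1" and a: "a \<in> carrier A" for z a
  proof
    assume "\<alpha> a z \<in> O1"
    then obtain b where b: "b \<in> carrier A" "\<alpha> a z = \<alpha> b u" by (auto simp: O1_def)
    have "z = \<alpha> (inv\<^bsub>A\<^esub> a) (\<alpha> b u)"
      using free_action_inv[OF assms(1,2) a, of z] b z by simp
    also have "\<dots> = \<alpha> (b \<otimes>\<^bsub>A\<^esub> inv\<^bsub>A\<^esub> a) u"
      using free_actionD(3)[OF assms(2) b(1) assms(3) inv_closed[OF a]] by simp
    finally show False using z a b by (auto simp: O1_def)
  qed
  then show "free_action A \<alpha> (U - O1)" using assms(2) by (auto simp: free_action_def)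
  have "\<alpha> \<one>\<^bsub>A\<^esub> u = u" using free_actionD(2)[OF assms(2) _ assms(3)] by simp
  then show "u \<in> O1" unfolding O1_def by (metis image_eqI one_closed)
qed

text \<open>Both sets are disjoint unions of the same number of copies of \<open>A\<close>: match one orbit with one
  orbit and recurse on the complements.\<close>

lemma free_action_equivariant_bij:
  assumes A: "group A" "finite (carrier A)"
    and "free_action A \<alpha> U" "free_action A \<beta> V" "finite U" "finite V" "card U = card V"
  shows "\<exists>\<theta>. bij_betw \<theta> U V \<and> (\<forall>a\<in>carrier A. \<forall>u\<in>U. \<theta> (\<alpha> a u) = \<beta> a (\<theta> u))"
  using assms(3-)
proof (induction "card U" arbitrary: U V rule: less_induct)
  case (less U V)
  interpret group A by fact
  show ?case
  proof (cases "U = {}")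
    case True
    then show ?thesis using less.prems by (auto simp: bij_betw_def)
  next
    case False
    then have "V \<noteq> {}" using less.prems by auto
    then obtain u v where uv: "u \<in> U" "v \<in> V" using False by auto
    let ?O1 = "(\<lambda>a. \<alpha> a u) ` carrier A" and ?O2 = "(\<lambda>a. \<beta> a v) ` carrier A"
    note o1 = free_action_orbit[OF A(1) less.prems(1) uv(1)]
    note o2 = free_action_orbit[OF A(1) less.prems(2) uv(2)]
    have "card (U - ?O1) < card U"
      using o1(4) uv less.prems(3) by (intro psubset_card_mono) auto
    moreover have "card (U - ?O1) = card (V - ?O2)"
      using o1 o2 less.prems(3-5) by (simp add: card_Diff_subset A(2))
    ultimately obtain \<theta> where \<theta>: "bij_betw \<theta> (U - ?O1) (V - ?O2)"
      "\<forall>a\<in>carrier A. \<forall>u\<in>U - ?O1. \<theta> (\<alpha> a u) = \<beta> a (\<theta> u)"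
      using less.hyps[of "U - ?O1" "V - ?O2"] o1 o2 less.prems(3,4) by auto
    define f where "f = (\<lambda>a. \<alpha> a u)"
    have f: "bij_betw f (carrier A) ?O1"
      using free_action_inj[OF A(1) less.prems(1) uv(1)]
      by (auto simp: bij_betw_def f_def intro: inj_onI)
    define \<theta>1 where "\<theta>1 = (\<lambda>a. \<beta> a v) \<circ> inv_into (carrier A) f"
    have b1: "bij_betw \<theta>1 ?O1 ?O2"
      unfolding \<theta>1_def
      by (rule bij_betw_trans[OF bij_betw_inv_into[OF f]])
        (use free_action_inj[OF A(1) less.prems(2) uv(2)] in \<open>auto simp: bij_betw_def intro: inj_onI\<close>)
    have \<theta>1: "\<theta>1 (\<alpha> a u) = \<beta> a v" if "a \<in> carrier A" for a
      using inv_into_f_f[OF bij_betw_imp_inj_on[OF f] that] by (simp add: \<theta>1_def f_def)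
    define \<theta>' where "\<theta>' = (\<lambda>z. if z \<in> ?O1 then \<theta>1 z else \<theta> z)"
    have "bij_betw \<theta>' (?O1 \<union> (U - ?O1)) (?O2 \<union> (V - ?O2))"
    proof (rule bij_betw_combine)
      show "bij_betw \<theta>' ?O1 ?O2"
        using b1 by (subst bij_betw_cong[where g = \<theta>1]) (auto simp: \<theta>'_def)
      show "bij_betw \<theta>' (U - ?O1) (V - ?O2)"
        using \<theta>(1) by (subst bij_betw_cong[where g = \<theta>]) (auto simp: \<theta>'_def)
    qed auto
    moreover have "?O1 \<union> (U - ?O1) = U" "?O2 \<union> (V - ?O2) = V" using o1(1) o2(1) by auto
    moreover have "\<theta>' (\<alpha> a z) = \<beta> a (\<theta>' z)" if a: "a \<in> carrier A" and z: "z \<in> U" for a z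
    proof (cases "z \<in> ?O1")
      case True
      then obtain b where b: "b \<in> carrier A" "z = \<alpha> b u" by auto
      have "\<alpha> a z = \<alpha> (b \<otimes>\<^bsub>A\<^esub> a) u" "\<beta> a (\<beta> b v) = \<beta> (b \<otimes>\<^bsub>A\<^esub> a) v"
        using a b uv less.prems(1,2) by (auto simp: free_action_def)
      then show ?thesis using a b True by (simp add: \<theta>'_def \<theta>1)
    next
      case False
      then have "\<alpha> a z \<notin> ?O1" using o1(3) a z by (auto simp: free_action_def)
      then show ?thesis using False \<theta>(2) a z by (simp add: \<theta>'_def)
    qed
    ultimately show ?thesis by auto
  qed
qed

lemma free_action_hom:
  assumes A: "group A" and \<phi>: "\<phi> \<in> hom A (presented_group X R)" "inj_on \<phi> (carrier A)"
    and T: "acts_freely X R T E"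
  shows "free_action A (\<lambda>a. run T (pick (\<phi> a))) E"
proof -
  interpret A: group A by fact
  have T': "acts X R T E" using T by (simp add: acts_freely_def)
  have car: "\<phi> a \<in> carrier (presented_group X R)" if "a \<in> carrier A" for a
    using \<phi>(1) that by (auto simp: hom_def)
  note p = pick[OF car]
  have one: "\<phi> \<one>\<^bsub>A\<^esub> = pres_class X R []"
    using hom_one[OF \<phi>(1) A group_presented_group] by (simp add: one_presented_group)
  show ?thesis
    unfolding free_action_def
  proof (intro conjI ballI)
    fix a e assume a: "a \<in> carrier A" and e: "e \<in> E"
    show "run T (pick (\<phi> a)) e \<in> E" using run_closed[OF T' p(1)[OF a] e] .
    have "a = \<one>\<^bsub>A\<^esub>" if "run T (pick (\<phi> a)) e = e"
    proof -
      have "pres_eq X R (pick (\<phi> a)) []" using that T e p(1)[OF a] by (auto simp: acts_freely_def)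
      then have "\<phi> a = \<phi> \<one>\<^bsub>A\<^esub>"
        using p[OF a] one by (metis pres_class_eq_iff)
      then show ?thesis using \<phi>(2) a by (simp add: inj_on_eq_iff)
    qed
    moreover have "run T (pick (\<phi> \<one>\<^bsub>A\<^esub>)) e = e"
      using run_pres_eq[OF T' pick_pres_eq[of "[]"] e] by (simp add: one)
    ultimately show "run T (pick (\<phi> a)) e = e \<longleftrightarrow> a = \<one>\<^bsub>A\<^esub>" by auto
  next
    fix a b e assume ab: "a \<in> carrier A" "b \<in> carrier A" and e: "e \<in> E"
    have "\<phi> (a \<otimes>\<^bsub>A\<^esub> b) = pres_class X R (pick (\<phi> a) @ pick (\<phi> b))"
      using \<phi>(1) ab p pres_class_mult[of "pick (\<phi> a)" X "pick (\<phi> b)" R] by (simp add: hom_def)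
    then have "pres_eq X R (pick (\<phi> (a \<otimes>\<^bsub>A\<^esub> b))) (pick (\<phi> a) @ pick (\<phi> b))"
      using p ab by (simp add: pick_pres_eq)
    from run_pres_eq[OF T' this e]
    show "run T (pick (\<phi> (a \<otimes>\<^bsub>A\<^esub> b))) e = run T (pick (\<phi> b)) (run T (pick (\<phi> a)) e)" by simp
  qed
qed

subsection \<open>Finite invariant subsets of prescribed size\<close>

definition orbit :: "'x set \<Rightarrow> ('x letter \<Rightarrow> 'e \<Rightarrow> 'e) \<Rightarrow> 'e \<Rightarrow> 'e set" where
  "orbit X T e = (\<lambda>u. run T u e) ` words X"

lemma card_orbit:
  assumes T: "acts_freely X R T E" and e: "e \<in> E"
  shows "card (orbit X T e) = card (carrier (presented_group X R))"
proof -
  have T': "acts X R T E" using T by (simp add: acts_freely_def)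
  have "bij_betw (\<lambda>g. run T (pick g) e) (carrier (presented_group X R)) (orbit X T e)"
    unfolding bij_betw_def
  proof (intro conjI)
    show "inj_on (\<lambda>g. run T (pick g) e) (carrier (presented_group X R))"
    proof (rule inj_onI)
      fix g h assume gh: "g \<in> carrier (presented_group X R)" "h \<in> carrier (presented_group X R)"
        "run T (pick g) e = run T (pick h) e"
      then have "pres_eq X R (pick g) (pick h)"
        using acts_freely_eqD[OF T _ _ e] pick(1) by blast
      then show "g = h" using pick[OF gh(1)] pick[OF gh(2)] by (metis pres_class_eq_iff)
    qed
  next
    have "z \<in> (\<lambda>g. run T (pick g) e) ` carrier (presented_group X R)" if "z \<in> orbit X T e" for z
    proof -
      from that obtain u where u: "u \<in> words X" "z = run T u e" by (auto simp: orbit_def)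
      then have "z = run T (pick (pres_class X R u)) e"
        using run_pres_eq[OF T' pick_pres_eq[OF u(1)] e] by simp
      then show ?thesis
        using pres_class_in_carrier[OF u(1)] by blast
    qed
    then show "(\<lambda>g. run T (pick g) e) ` carrier (presented_group X R) = orbit X T e"
      by (auto simp: orbit_def dest: pick(1))
  qed
  then show ?thesis by (simp add: bij_betw_same_card)
qed

text \<open>The orbits of the points of \<open>P\<close> number at most \<open>m\<close> and all orbits have the same size, so adding
  further orbits, of which there are infinitely many, reaches the size \<open>m\<close> times the group order exactly.
  Being able to prescribe the size is what lets two such sets, one for each factor, be matched.\<close>

lemma ex_finite_invariant_superset:
  assumes T: "acts_freely X R T E" and fin: "finite (carrier (presented_group X R))"
    and E: "infinite E" and P: "P \<subseteq> E" "finite P" "card P \<le> m"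
  shows "\<exists>Z. P \<subseteq> Z \<and> Z \<subseteq> E \<and> finite Z \<and> card Z = m * card (carrier (presented_group X R)) \<and>
    (\<forall>u\<in>words X. \<forall>z\<in>Z. run T u z \<in> Z)"
proof -
  have T': "acts X R T E" using T by (simp add: acts_freely_def)
  let ?q = "card (carrier (presented_group X R))"
  have q: "?q \<noteq> 0" using fin pres_class_in_carrier[OF words_Nil, of X R] by auto
  have fino: "finite (orbit X T e)" if "e \<in> E" for e
    by (rule card_ge_0_finite) (use card_orbit[OF T that] q in simp)
  have mem: "e \<in> orbit X T e" for e unfolding orbit_def by (rule image_eqI[of _ _ "[]"]) auto
  have eq: "orbit X T z = orbit X T e" if e: "e \<in> E" and z: "z \<in> orbit X T e" for z e
  proof -
    obtain u where u: "u \<in> words X" "z = run T u e" using z by (auto simp: orbit_def)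
    show ?thesis
    proof (intro equalityI subsetI)
      fix y assume "y \<in> orbit X T z"
      then obtain v where "v \<in> words X" "y = run T (u @ v) e" using u by (auto simp: orbit_def)
      then show "y \<in> orbit X T e" using u by (auto simp: orbit_def simp del: run_append)
    next
      fix y assume "y \<in> orbit X T e"
      then obtain v where v: "v \<in> words X" "y = run T v e" by (auto simp: orbit_def)
      then have "y = run T (word_inv u @ v) z"
        using run_word_inv(1)[OF T' u(1) e] u by simp
      then show "y \<in> orbit X T z" using v word_inv_words[OF u(1)] by (auto simp: orbit_def simp del: run_append)
    qed
  qed
  let ?Os = "orbit X T ` E"
  have sub: "orbit X T e \<subseteq> E" if "e \<in> E" for e
    using run_closed[OF T' _ that] by (auto simp: orbit_def)
  have "infinite ?Os"
  proof
    assume "finite ?Os"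
    then have "finite (\<Union>?Os)" using fino by auto
    moreover have "E \<subseteq> \<Union>?Os" using mem by auto
    ultimately show False using E finite_subset by blast
  qed
  moreover have "finite (orbit X T ` P)" "card (orbit X T ` P) \<le> m"
    using P card_image_le[of P "orbit X T"] by auto
  ultimately obtain Q where Q: "orbit X T ` P \<subseteq> Q" "Q \<subseteq> ?Os" "finite Q" "card Q = m"
  proof -
    let ?k = "m - card (orbit X T ` P)"
    have "infinite (?Os - orbit X T ` P)"
      using \<open>infinite ?Os\<close> \<open>finite (orbit X T ` P)\<close> by simp
    then obtain B where B: "B \<subseteq> ?Os - orbit X T ` P" "finite B" "card B = ?k"
      using infinite_arbitrarily_large[of _ "?k"] by metis
    show thesis
    proof (rule that[of "orbit X T ` P \<union> B"])
      show "card (orbit X T ` P \<union> B) = m"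
        using B \<open>card (orbit X T ` P) \<le> m\<close> \<open>finite (orbit X T ` P)\<close>
        by (subst card_Un_disjoint) auto
    qed (use B P in auto)
  qed
  have dis: "pairwise disjnt Q"
    unfolding pairwise_def disjnt_def
  proof (intro ballI impI)
    fix O1 O2 assume "O1 \<in> Q" "O2 \<in> Q" and ne: "O1 \<noteq> O2"
    then obtain e f where ef: "e \<in> E" "f \<in> E" "O1 = orbit X T e" "O2 = orbit X T f"
      using Q(2) by (metis imageE subsetD)
    then show "O1 \<inter> O2 = {}" using eq ne by blast
  qed
  have "card (\<Union>Q) = sum card Q"
    by (rule card_Union_disjoint) (use Q(2) fino in \<open>auto simp: dis\<close>)
  also have "\<dots> = sum (\<lambda>_. ?q) Q"
    by (rule sum.cong) (use Q card_orbit[OF T] in auto)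
  also have "\<dots> = m * ?q" using Q by simp
  finally have "card (\<Union>Q) = m * ?q" .
  moreover have "P \<subseteq> \<Union>Q" using Q(1) mem by auto
  moreover have "\<Union>Q \<subseteq> E" using Q(2) sub by auto
  moreover have "finite (\<Union>Q)"
    by (rule finite_Union[OF Q(3)]) (metis Q(2) fino imageE subsetD)
  moreover have "run T u z \<in> \<Union>Q" if u: "u \<in> words X" and z: "z \<in> \<Union>Q" for u z
  proof -
    obtain e where e: "e \<in> E" "z \<in> orbit X T e" "orbit X T e \<in> Q" using z Q(2) by auto
    then have "run T u z \<in> orbit X T e"
      using eq[OF e(1,2)] u by (auto simp: orbit_def)
    then show ?thesis using e by blast
  qed
  ultimately show ?thesis by (intro exI[of _ "\<Union>Q"]) blast
qed

subsection \<open>Relabelling a finite set\<close>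

text \<open>The marked subset becomes an initial segment, so that an action with a marked subset is later
  described by an action on numbers and a single number.\<close>

lemma acts_relabel:
  assumes T: "acts X R T Z" and Z: "finite Z" and B: "B \<subseteq> Z"
  shows "\<exists>T' f. acts X R T' {..<card Z} \<and> bij_betw f Z {..<card Z} \<and> f ` B = {..<card B} \<and>
    (\<forall>u\<in>words X. \<forall>z\<in>Z. run T' u (f z) = f (run T u z))"
proof -
  have finB: "finite B" using B Z finite_subset by auto
  have le: "card B \<le> card Z" using card_mono[OF Z B] .
  obtain f1 where f1: "bij_betw f1 B {..<card B}"
    using ex_bij_betw_finite_nat[OF finB] atLeast0LessThan by auto
  have "card (Z - B) = card {card B..<card Z}" using B finB by (simp add: card_Diff_subset)
  then obtain f2 where f2: "bij_betw f2 (Z - B) {card B..<card Z}"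
    using finite_same_card_bij[of "Z - B" "{card B..<card Z}"] Z by auto
  define f where "f = (\<lambda>z. if z \<in> B then f1 z else f2 z)"
  have fB: "bij_betw f B {..<card B}"
    using f1 by (subst bij_betw_cong[where g = f1]) (auto simp: f_def)
  have "bij_betw f (B \<union> (Z - B)) ({..<card B} \<union> {card B..<card Z})"
    by (rule bij_betw_combine[OF fB])
      (use f2 bij_betw_cong[of "Z - B" f f2] in \<open>auto simp: f_def\<close>)
  moreover have "B \<union> (Z - B) = Z" "{..<card B} \<union> {card B..<card Z} = {..<card Z}"
    using B le by auto
  ultimately have f: "bij_betw f Z {..<card Z}" by simp
  define T' where "T' = (\<lambda>l i. f (T l (inv_into Z f i)))"
  have inv: "inv_into Z f (f z) = z" if "z \<in> Z" for z
    using bij_betw_inv_into_left[OF f that] .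
  have run: "run T' u (f z) = f (run T u z)" if "u \<in> words X" "z \<in> Z" for u z
    using that
  proof (induction u arbitrary: z)
    case (Cons l u)
    then have "T l z \<in> Z" using T by (auto simp: acts_def)
    then show ?case using Cons by (simp add: T'_def inv)
  qed simp
  have "acts X R T' (f ` Z)"
    using T run inv unfolding acts_def T'_def by (auto simp: letters_def)
  then show ?thesis
    using f fB run by (intro exI[of _ T'] exI[of _ f]) (auto simp: bij_betw_def)
qed

section \<open>Actions of the amalgamated product\<close>

locale amalgam =
  fixes X1 X2 :: "'x set" and R1 R2 :: "'x word set"
    and A :: "('a, 'm) monoid_scheme" and Y :: "'a set"
    and \<phi>1 \<phi>2 :: "'a \<Rightarrow> 'x word set" and w1 w2 :: "'a \<Rightarrow> 'x word"
  assumes R1: "R1 \<subseteq> words X1" and fin1: "finite (carrier (presented_group X1 R1))"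
    and R2: "R2 \<subseteq> words X2" and fin2: "finite (carrier (presented_group X2 R2))"
    and disj: "X1 \<inter> X2 = {}"
    and A: "group A" "finite (carrier A)" and Y: "Y \<subseteq> carrier A" "generate A Y = carrier A"
    and \<phi>1: "\<phi>1 \<in> hom A (presented_group X1 R1)" "inj_on \<phi>1 (carrier A)"
    and \<phi>2: "\<phi>2 \<in> hom A (presented_group X2 R2)" "inj_on \<phi>2 (carrier A)"
    and w1: "\<And>a. a \<in> Y \<Longrightarrow> w1 a \<in> \<phi>1 a" and w2: "\<And>a. a \<in> Y \<Longrightarrow> w2 a \<in> \<phi>2 a"
begin

abbreviation "X \<equiv> X1 \<union> X2"
abbreviation "R \<equiv> amalgam_relators R1 R2 Y w1 w2"
abbreviation "G1 \<equiv> presented_group X1 R1"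
abbreviation "G2 \<equiv> presented_group X2 R2"
abbreviation "G \<equiv> presented_group X R"
abbreviation "cls \<equiv> pres_class X R"
abbreviation "rep1 a \<equiv> pick (\<phi>1 a)"
abbreviation "rep2 a \<equiv> pick (\<phi>2 a)"

lemma words1: "u \<in> words X1 \<Longrightarrow> u \<in> words X" and words2: "u \<in> words X2 \<Longrightarrow> u \<in> words X"
  using words_mono[of X1 X] words_mono[of X2 X] by auto

lemma letters_Un: "letters X = letters X1 \<union> letters X2"
  by (auto simp: letters_def)

lemma \<phi>1_in: "a \<in> carrier A \<Longrightarrow> \<phi>1 a \<in> carrier G1" and \<phi>2_in: "a \<in> carrier A \<Longrightarrow> \<phi>2 a \<in> carrier G2"
  using \<phi>1(1) \<phi>2(1) by (auto simp: hom_def)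

lemma w1_word: "a \<in> Y \<Longrightarrow> w1 a \<in> words X1" and w2_word: "a \<in> Y \<Longrightarrow> w2 a \<in> words X2"
  using pres_class_memD(1)[OF \<phi>1_in w1] pres_class_memD(1)[OF \<phi>2_in w2] Y(1) by auto

lemma w1_class: "a \<in> Y \<Longrightarrow> \<phi>1 a = pres_class X1 R1 (w1 a)"
  and w2_class: "a \<in> Y \<Longrightarrow> \<phi>2 a = pres_class X2 R2 (w2 a)"
  using pres_class_memD(2)[OF \<phi>1_in w1] pres_class_memD(2)[OF \<phi>2_in w2] Y(1) by auto

lemma rep1: "a \<in> carrier A \<Longrightarrow> rep1 a \<in> words X1" and rep2: "a \<in> carrier A \<Longrightarrow> rep2 a \<in> words X2"
  using pick(1)[OF \<phi>1_in] pick(1)[OF \<phi>2_in] by auto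

lemma pres_eq1: "pres_eq X1 R1 u v \<Longrightarrow> pres_eq X R u v"
  by (erule pres_eq_mono) (auto simp: amalgam_relators_def intro!: pres_relator words1)

lemma pres_eq2: "pres_eq X2 R2 u v \<Longrightarrow> pres_eq X R u v"
  by (erule pres_eq_mono) (auto simp: amalgam_relators_def intro!: pres_relator words2)

lemma acts_factors:
  assumes "acts X R T E"
  shows "acts X1 R1 T E" "acts X2 R2 T E"
  using assms R1 R2 words1 words2 by (auto simp: acts_def letters_Un amalgam_relators_def)

text \<open>Both sides define homomorphisms from \<open>A\<close> to the amalgamated product; the relators identify them
  on the generators \<open>Y\<close>.\<close>

lemma rep1_eq_rep2:
  assumes "a \<in> carrier A"
  shows "pres_eq X R (rep1 a) (rep2 a)"
proof -
  define f1 where "f1 = (\<lambda>g. cls (pick g)) \<circ> \<phi>1"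
  define f2 where "f2 = (\<lambda>g. cls (pick g)) \<circ> \<phi>2"
  interpret A: group A by (fact A)
  interpret G: group G by (rule group_presented_group)
  have hom1: "(\<lambda>g. cls (pick g)) \<in> hom G1 G"
  proof (rule homI)
    fix g h assume gh: "g \<in> carrier G1" "h \<in> carrier G1"
    note p = pick[OF gh(1)] pick[OF gh(2)]
    have "g \<otimes>\<^bsub>G1\<^esub> h = pres_class X1 R1 (pick g @ pick h)"
      using pres_class_mult[of "pick g" X1 "pick h" R1] p by simp
    then have "pres_eq X R (pick (g \<otimes>\<^bsub>G1\<^esub> h)) (pick g @ pick h)"
      using pick_pres_eq[of "pick g @ pick h" X1 R1] p by (auto intro: pres_eq1)
    then show "cls (pick (g \<otimes>\<^bsub>G1\<^esub> h)) = cls (pick g) \<otimes>\<^bsub>G\<^esub> cls (pick h)"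
      using p words1 pres_eq_words by (metis pres_class_mult pres_class_eq_iff)
  qed (use pick(1) words1 in \<open>blast intro: pres_class_in_carrier\<close>)
  have hom2: "(\<lambda>g. cls (pick g)) \<in> hom G2 G"
  proof (rule homI)
    fix g h assume gh: "g \<in> carrier G2" "h \<in> carrier G2"
    note p = pick[OF gh(1)] pick[OF gh(2)]
    have "g \<otimes>\<^bsub>G2\<^esub> h = pres_class X2 R2 (pick g @ pick h)"
      using pres_class_mult[of "pick g" X2 "pick h" R2] p by simp
    then have "pres_eq X R (pick (g \<otimes>\<^bsub>G2\<^esub> h)) (pick g @ pick h)"
      using pick_pres_eq[of "pick g @ pick h" X2 R2] p by (auto intro: pres_eq2)
    then show "cls (pick (g \<otimes>\<^bsub>G2\<^esub> h)) = cls (pick g) \<otimes>\<^bsub>G\<^esub> cls (pick h)"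
      using p words2 pres_eq_words by (metis pres_class_mult pres_class_eq_iff)
  qed (use pick(1) words2 in \<open>blast intro: pres_class_in_carrier\<close>)
  have f1: "f1 \<in> hom A G" and f2: "f2 \<in> hom A G"
    unfolding f1_def f2_def using hom_compose[OF \<phi>1(1) hom1] hom_compose[OF \<phi>2(1) hom2] by auto
  have base: "f1 y = f2 y" if y: "y \<in> Y" for y
  proof -
    have "pres_eq X R (rep1 y) (w1 y)" "pres_eq X R (rep2 y) (w2 y)"
      using pick_pres_eq[OF w1_word[OF y], of R1] pick_pres_eq[OF w2_word[OF y], of R2]
        w1_class[OF y] w2_class[OF y] by (auto intro: pres_eq1 pres_eq2)
    moreover have "pres_eq X R (w1 y) (w2 y)"
    proof -
      have w: "w1 y \<in> words X" "w2 y \<in> words X" using w1_word w2_word words1 words2 y by auto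
      have "pres_eq X R (w1 y @ word_inv (w2 y)) []"
        using w y word_inv_words by (intro pres_relator) (auto simp: amalgam_relators_def)
      then have "pres_eq X R ((w1 y @ word_inv (w2 y)) @ w2 y) ([] @ w2 y)"
        using w by (intro pres_append pres_refl)
      moreover have "pres_eq X R (w1 y @ (word_inv (w2 y) @ w2 y)) (w1 y @ [])"
        using w by (intro pres_append pres_eq_word_inv pres_refl)
      ultimately show ?thesis by simp (meson pres_sym pres_trans)
    qed
    ultimately have "pres_eq X R (rep1 y) (rep2 y)" by (meson pres_sym pres_trans)
    then show ?thesis using pres_eq_words pres_class_eq_iff unfolding f1_def f2_def o_def by blast
  qed
  have "a \<in> generate A Y" using assms Y by simp
  then have "f1 a = f2 a"
  proof induction
    case one
    then show ?case using hom_one[OF f1 A(1) G.is_group] hom_one[OF f2 A(1) G.is_group] by simp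
  next
    case (incl h)
    then show ?case by (rule base)
  next
    case (inv h)
    then have h: "h \<in> carrier A" using Y by auto
    have "f1 (inv\<^bsub>A\<^esub> h) = inv\<^bsub>G\<^esub> (f1 h)" "f2 (inv\<^bsub>A\<^esub> h) = inv\<^bsub>G\<^esub> (f2 h)"
      using group_hom.hom_inv[of A G _ h] f1 f2 h A(1) G.is_group
      by (simp_all add: group_hom_def group_hom_axioms_def)
    then show ?case using base[OF inv] by simp
  next
    case (eng h1 h2)
    then have "h1 \<in> carrier A" "h2 \<in> carrier A" using Y by auto
    then show ?case using eng f1 f2 by (auto simp: hom_def)
  qed
  then show ?thesis
    using words1[OF rep1[OF assms]] by (simp add: f1_def f2_def pres_class_eq_iff)
qed

text \<open>The first factor acts as in \<open>T1\<close>, the second as in \<open>T2\<close> transported along \<open>\<theta>\<close>.\<close>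

definition twist :: "('x letter \<Rightarrow> 'e \<Rightarrow> 'e) \<Rightarrow> ('x letter \<Rightarrow> 'f \<Rightarrow> 'f) \<Rightarrow> 'e set \<Rightarrow> ('e \<Rightarrow> 'f) \<Rightarrow>
    'x letter \<Rightarrow> 'e \<Rightarrow> 'e" where
  "twist T1 T2 Z \<theta> l e = (if fst l \<in> X1 then T1 l e else inv_into Z \<theta> (T2 l (\<theta> e)))"

lemma twist1:
  assumes "u \<in> words X1"
  shows "run (twist T1 T2 Z \<theta>) u z = run T1 u z"
  using assms by (induction u arbitrary: z) (auto simp: twist_def letters_def)

lemma twist2:
  assumes T2: "acts X2 R2 T2 Z2" and \<theta>: "bij_betw \<theta> Z1 Z2" and "u \<in> words X2" "z \<in> Z1"
  shows "\<theta> (run (twist T1 T2 Z1 \<theta>) u z) = run T2 u (\<theta> z)"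
  using assms(3,4)
proof (induction u arbitrary: z)
  case (Cons l u)
  then have l: "l \<in> letters X2" by simp
  then have "T2 l (\<theta> z) \<in> Z2"
    using T2 bij_betwE[OF \<theta>] Cons.prems by (auto simp: acts_def)
  then have "inv_into Z1 \<theta> (T2 l (\<theta> z)) \<in> Z1" "\<theta> (inv_into Z1 \<theta> (T2 l (\<theta> z))) = T2 l (\<theta> z)"
    using \<theta> by (auto simp: bij_betw_def inv_into_into f_inv_into_f)
  moreover have "fst l \<notin> X1" using l disj by (auto simp: letters_def)
  ultimately show ?case using Cons by (simp add: twist_def)
qed simp

text \<open>This is the universal property of the amalgamated product: actions of the two factors that agree on
  \<open>A\<close> form an action of the whole.  Agreement on \<open>A\<close> is the equivariance of \<open>\<theta>\<close>.\<close>

lemma acts_twist: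
  assumes T1: "acts X1 R1 T1 Z1" and T2: "acts X2 R2 T2 Z2" and \<theta>: "bij_betw \<theta> Z1 Z2"
    and eqv: "\<And>a z. a \<in> carrier A \<Longrightarrow> z \<in> Z1 \<Longrightarrow> \<theta> (run T1 (rep1 a) z) = run T2 (rep2 a) (\<theta> z)"
  shows "acts X R (twist T1 T2 Z1 \<theta>) Z1"
proof -
  let ?T = "twist T1 T2 Z1 \<theta>"
  note t1 = twist1[of _ T1 T2 Z1 \<theta>] and t2 = twist2[OF T2 \<theta>, of _ _ T1]
  have \<theta>in: "\<theta> z \<in> Z2" if "z \<in> Z1" for z using \<theta> that bij_betwE by blast
  have inj: "y = z" if "y \<in> Z1" "z \<in> Z1" "\<theta> y = \<theta> z" for y z
    using \<theta> that by (auto simp: bij_betw_def inj_on_eq_iff)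
  have cl: "?T l z \<in> Z1" if "l \<in> letters X" "z \<in> Z1" for l z
  proof (cases "fst l \<in> X1")
    case True
    then show ?thesis using T1 that by (auto simp: acts_def twist_def letters_def)
  next
    case False
    then have "T2 l (\<theta> z) \<in> Z2" using T2 that \<theta>in by (auto simp: acts_def letters_def)
    then show ?thesis using False \<theta> by (auto simp: twist_def bij_betw_def inv_into_into)
  qed
  have cl': "run ?T u z \<in> Z1" if "u \<in> words X" "z \<in> Z1" for u z
    using that by (induction u arbitrary: z) (auto intro: cl)
  have canc1: "?T (x, \<not> b) (?T (x, b) z) = z" if "x \<in> X1" "z \<in> Z1" for x b z
    using t1[of "[(x, b), (x, \<not> b)]" z] T1 that by (auto simp: acts_def letters_def)
  have canc2: "?T (x, \<not> b) (?T (x, b) z) = z" if "x \<in> X2" "z \<in> Z1" for x b z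
  proof (rule inj)
    show "\<theta> (?T (x, \<not> b) (?T (x, b) z)) = \<theta> z"
      using t2[of "[(x, b), (x, \<not> b)]" z] T2 that \<theta>in by (auto simp: acts_def letters_def)
  qed (use that in \<open>auto intro!: cl simp: letters_def\<close>)
  have rel1: "run ?T r z = z" if "r \<in> R1" "z \<in> Z1" for r z
    using t1[of r z] T1 that R1 by (auto simp: acts_def)
  have rel2: "run ?T r z = z" if "r \<in> R2" "z \<in> Z1" for r z
  proof (rule inj)
    show "\<theta> (run ?T r z) = \<theta> z" using t2[of r z] T2 that R2 \<theta>in by (auto simp: acts_def)
  qed (use that R2 words2 in \<open>auto intro!: cl'\<close>)
  have rel3: "run ?T (w1 a @ word_inv (w2 a)) z = z" if a: "a \<in> Y" and z: "z \<in> Z1" for a z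
  proof -
    note w = w1_word[OF a] w2_word[OF a]
    have aA: "a \<in> carrier A" using a Y by auto
    have z': "run T1 (w1 a) z \<in> Z1" using run_closed[OF T1 w(1) z] .
    have z'': "run ?T (w2 a) z \<in> Z1" using cl' words2[OF w(2)] z by blast
    have "\<theta> (run T1 (w1 a) z) = \<theta> (run T1 (rep1 a) z)"
      using run_pres_eq[OF T1 pick_pres_eq[OF w(1)] z] w1_class[OF a] by simp
    also have "\<dots> = run T2 (rep2 a) (\<theta> z)" by (rule eqv[OF aA z])
    also have "\<dots> = run T2 (w2 a) (\<theta> z)"
      using run_pres_eq[OF T2 pick_pres_eq[OF w(2)] \<theta>in[OF z]] w2_class[OF a] by simp
    also have "\<dots> = \<theta> (run ?T (w2 a) z)" by (rule t2[OF w(2) z, symmetric])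
    finally have e: "run T1 (w1 a) z = run ?T (w2 a) z" by (rule inj[OF z' z''])
    show ?thesis
    proof (rule inj)
      show "\<theta> (run ?T (w1 a @ word_inv (w2 a)) z) = \<theta> z"
        using t1[OF w(1)] t2[OF word_inv_words[OF w(2)] z''] t2[OF w(2) z]
          run_word_inv(1)[OF T2 w(2) \<theta>in[OF z]] by (simp add: e)
    qed (use w words1 words2 word_inv_words[OF w(2)] z in \<open>auto intro!: cl' simp del: run_append\<close>)
  qed
  show ?thesis
    unfolding acts_def using cl canc1 canc2 rel1 rel2 rel3 by (auto simp: amalgam_relators_def simp del: run_append)
qed

lemma acts_freely_twist:
  assumes T1: "acts_freely X1 R1 T1 Z1" and T2: "acts_freely X2 R2 T2 Z2" and \<theta>: "bij_betw \<theta> Z1 Z2"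
    and eqv: "\<And>a z. a \<in> carrier A \<Longrightarrow> z \<in> Z1 \<Longrightarrow> \<theta> (run T1 (rep1 a) z) = run T2 (rep2 a) (\<theta> z)"
  shows "acts_freely X1 R1 (twist T1 T2 Z1 \<theta>) Z1" "acts_freely X2 R2 (twist T1 T2 Z1 \<theta>) Z1"
proof -
  have T: "acts X1 R1 T1 Z1" "acts X2 R2 T2 Z2" using T1 T2 by (auto simp: acts_freely_def)
  note tw = acts_factors[OF acts_twist[OF T \<theta> eqv]]
  show "acts_freely X1 R1 (twist T1 T2 Z1 \<theta>) Z1"
    using T1 tw by (simp add: acts_freely_def twist1)
  have "pres_eq X2 R2 u []"
    if "z \<in> Z1" "u \<in> words X2" "run (twist T1 T2 Z1 \<theta>) u z = z" for u z
  proof -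
    have "run T2 u (\<theta> z) = \<theta> z" using twist2[OF T(2) \<theta> that(2,1), of T1] that(3) by simp
    moreover have "\<theta> z \<in> Z2" using \<theta> that(1) bij_betwE by blast
    ultimately show ?thesis using T2 that(2) by (auto simp: acts_freely_def)
  qed
  then show "acts_freely X2 R2 (twist T1 T2 Z1 \<theta>) Z1"
    using tw by (simp add: acts_freely_def)
qed

end

section \<open>Actions by translation\<close>

definition translate :: "'x set \<Rightarrow> 'x word set \<Rightarrow> 'x letter \<Rightarrow> 'x word set \<Rightarrow> 'x word set" where
  "translate X R l g = g \<otimes>\<^bsub>presented_group X R\<^esub> pres_class X R [l]"

definition translate_coset :: "'x set \<Rightarrow> 'x word set \<Rightarrow> 'x letter \<Rightarrow> 'x word set set \<Rightarrow> 'x word set set" where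
  "translate_coset X R l K = K #>\<^bsub>presented_group X R\<^esub> pres_class X R [l]"

lemma run_translate:
  assumes "u \<in> words X" "g \<in> carrier (presented_group X R)"
  shows "run (translate X R) u g = g \<otimes>\<^bsub>presented_group X R\<^esub> pres_class X R u"
proof -
  interpret G: group "presented_group X R" by (rule group_presented_group)
  show ?thesis
    using assms
  proof (induction u arbitrary: g)
    case Nil
    then show ?case by (simp flip: one_presented_group)
  next
    case (Cons l u)
    then have "pres_class X R (l # u) = pres_class X R [l] \<otimes>\<^bsub>presented_group X R\<^esub> pres_class X R u"
      using pres_class_mult[of "[l]" X u R] by simp
    with Cons show ?case by (simp add: translate_def G.m_assoc pres_class_in_carrier)
  qed
qed

lemma acts_freely_translate: "acts_freely X R (translate X R) (carrier (presented_group X R))"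
proof -
  interpret G: group "presented_group X R" by (rule group_presented_group)
  have eq: "run (translate X R) u g = g"
    if "u \<in> words X" "pres_eq X R u []" "g \<in> carrier (presented_group X R)" for u g
  proof -
    have "pres_class X R u = \<one>\<^bsub>presented_group X R\<^esub>"
      using that(2) pres_class_eq_iff[OF that(1)] by (simp add: one_presented_group)
    then show ?thesis using that by (simp add: run_translate)
  qed
  have "acts X R (translate X R) (carrier (presented_group X R))"
    unfolding acts_def
  proof (intro conjI ballI allI)
    fix x b g assume "x \<in> X" "g \<in> carrier (presented_group X R)"
    then show "translate X R (x, \<not> b) (translate X R (x, b) g) = g"
      using eq[of "[(x, b), (x, \<not> b)]" g] by (simp add: letters_def pres_cancel)
  next
    fix r g assume "r \<in> R \<inter> words X" "g \<in> carrier (presented_group X R)"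
    then show "run (translate X R) r g = g" using eq[of r g] by (simp add: pres_relator)
  next
    fix l g assume "l \<in> letters X" "g \<in> carrier (presented_group X R)"
    then show "translate X R l g \<in> carrier (presented_group X R)"
      by (simp add: translate_def pres_class_in_carrier)
  qed
  moreover have "pres_eq X R u []"
    if "g \<in> carrier (presented_group X R)" "u \<in> words X" "run (translate X R) u g = g" for u g
  proof -
    have "pres_class X R u = \<one>\<^bsub>presented_group X R\<^esub>"
      using that run_translate[of u X g R] G.l_cancel_one' pres_class_in_carrier by metis
    then show ?thesis using that by (simp add: one_presented_group pres_class_eq_iff)
  qed
  ultimately show ?thesis by (simp add: acts_freely_def)
qed

lemma run_translate_coset:
  assumes "u \<in> words X" "K \<subseteq> carrier (presented_group X R)"
  shows "run (translate_coset X R) u K = K #>\<^bsub>presented_group X R\<^esub> pres_class X R u"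
proof -
  interpret G: group "presented_group X R" by (rule group_presented_group)
  show ?thesis
    using assms
  proof (induction u arbitrary: K)
    case Nil
    then show ?case by (simp flip: one_presented_group)
  next
    case (Cons l u)
    then have "pres_class X R (l # u) = pres_class X R [l] \<otimes>\<^bsub>presented_group X R\<^esub> pres_class X R u"
      using pres_class_mult[of "[l]" X u R] by simp
    moreover have "K #>\<^bsub>presented_group X R\<^esub> pres_class X R [l] \<subseteq> carrier (presented_group X R)"
      using Cons by (intro G.r_coset_subset_G pres_class_in_carrier) auto
    ultimately show ?case using Cons by (simp add: translate_coset_def G.coset_mult_assoc pres_class_in_carrier)
  qed
qed

lemma acts_translate_coset:
  assumes "subgroup H (presented_group X R)"
  shows "acts X R (translate_coset X R) (rcosets\<^bsub>presented_group X R\<^esub> H)"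
proof -
  interpret G: group "presented_group X R" by (rule group_presented_group)
  interpret H: subgroup H "presented_group X R" by fact
  have sub: "K \<subseteq> carrier (presented_group X R)" if "K \<in> rcosets\<^bsub>presented_group X R\<^esub> H" for K
    using that assms by (auto simp: RCOSETS_def r_coset_def)
  have eq: "run (translate_coset X R) u K = K"
    if "u \<in> words X" "pres_eq X R u []" "K \<in> rcosets\<^bsub>presented_group X R\<^esub> H" for u K
  proof -
    have "pres_class X R u = \<one>\<^bsub>presented_group X R\<^esub>"
      using that(2) pres_class_eq_iff[OF that(1)] by (simp add: one_presented_group)
    then show ?thesis using that sub by (simp add: run_translate_coset)
  qed
  show "acts X R (translate_coset X R) (rcosets\<^bsub>presented_group X R\<^esub> H)"
    unfolding acts_def
  proof (intro conjI ballI allI)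
    fix x b g assume "x \<in> X" "g \<in> rcosets\<^bsub>presented_group X R\<^esub> H"
    then show "translate_coset X R (x, \<not> b) (translate_coset X R (x, b) g) = g"
      using eq[of "[(x, b), (x, \<not> b)]" g] by (simp add: letters_def pres_cancel)
  next
    fix r g assume "r \<in> R \<inter> words X" "g \<in> rcosets\<^bsub>presented_group X R\<^esub> H"
    then show "run (translate_coset X R) r g = g" using eq[of r g] by (simp add: pres_relator)
  next
    fix l K assume l: "l \<in> letters X" and K: "K \<in> rcosets\<^bsub>presented_group X R\<^esub> H"
    then obtain g where g: "g \<in> carrier (presented_group X R)" "K = H #>\<^bsub>presented_group X R\<^esub> g"
      by (auto simp: RCOSETS_def)
    then have "translate_coset X R l K = H #>\<^bsub>presented_group X R\<^esub> (g \<otimes>\<^bsub>presented_group X R\<^esub> pres_class X R [l])"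
      using l by (simp add: translate_coset_def G.coset_mult_assoc H.subset pres_class_in_carrier)
    then show "translate_coset X R l K \<in> rcosets\<^bsub>presented_group X R\<^esub> H"
      using g l by (auto simp: RCOSETS_def pres_class_in_carrier)
  qed
qed

section \<open>A finite free model\<close>

context amalgam
begin

text \<open>Let each factor translate its own coordinate.  The two resulting actions of \<open>A\<close> are free on the same
  finite set, hence isomorphic, and a twist by an isomorphism makes them agree.\<close>

lemma ex_free_model:
  "\<exists>T. acts X R T (carrier G1 \<times> carrier G2) \<and> acts_freely X1 R1 T (carrier G1 \<times> carrier G2) \<and>
    acts_freely X2 R2 T (carrier G1 \<times> carrier G2)"
proof -
  let ?\<Omega> = "carrier G1 \<times> carrier G2"
  define T1 where "T1 = (\<lambda>l (g, h :: 'x word set). (translate X1 R1 l g, h))"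
  define T2 where "T2 = (\<lambda>l (g :: 'x word set, h). (g, translate X2 R2 l h))"
  have run1: "run T1 u p = (run (translate X1 R1) u (fst p), snd p)" for u p
    by (induction u arbitrary: p) (auto simp: T1_def)
  have run2: "run T2 u p = (fst p, run (translate X2 R2) u (snd p))" for u p
    by (induction u arbitrary: p) (auto simp: T2_def)
  have free1: "acts_freely X1 R1 T1 ?\<Omega>"
    using acts_freely_translate[of X1 R1] unfolding acts_freely_def acts_def
    by (auto simp: run1) (auto simp: T1_def)
  have free2: "acts_freely X2 R2 T2 ?\<Omega>"
    using acts_freely_translate[of X2 R2] unfolding acts_freely_def acts_def
    by (auto simp: run2) (auto simp: T2_def)
  have fin: "finite ?\<Omega>" using fin1 fin2 by simp
  obtain \<theta> where \<theta>: "bij_betw \<theta> ?\<Omega> ?\<Omega>"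
    "\<forall>a\<in>carrier A. \<forall>z\<in>?\<Omega>. \<theta> (run T1 (rep1 a) z) = run T2 (rep2 a) (\<theta> z)"
    using free_action_equivariant_bij[OF A free_action_hom[OF A(1) \<phi>1 free1]
        free_action_hom[OF A(1) \<phi>2 free2] fin fin] by auto
  have T: "acts X1 R1 T1 ?\<Omega>" "acts X2 R2 T2 ?\<Omega>" using free1 free2 by (auto simp: acts_freely_def)
  show ?thesis
    using acts_twist[OF T \<theta>(1)] acts_freely_twist[OF free1 free2 \<theta>(1)] \<theta>(2) by blast
qed

end

section \<open>Separating an element from a finitely generated subgroup\<close>

definition prefixes_of :: "'b list list \<Rightarrow> 'b list set" where
  "prefixes_of us = (\<Union>u\<in>set us. (\<lambda>i. take i u) ` {..length u})"

lemma finite_prefixes_of: "finite (prefixes_of us)"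
  by (simp add: prefixes_of_def)

text \<open>The bound is linear in the total length, which keeps the size of the separating action computable.\<close>

lemma card_prefixes_of: "card (prefixes_of us) \<le> (\<Sum>u\<leftarrow>us. Suc (length u))"
proof (induction us)
  case (Cons u us)
  have "prefixes_of (u # us) = (\<lambda>i. take i u) ` {..length u} \<union> prefixes_of us"
    by (simp add: prefixes_of_def)
  then have "card (prefixes_of (u # us)) \<le> card ((\<lambda>i. take i u) ` {..length u}) + card (prefixes_of us)"
    using card_Un_le by metis
  also have "card ((\<lambda>i. take i u) ` {..length u}) \<le> Suc (length u)"
    using card_image_le[of "{..length u}" "\<lambda>i. take i u"] by simp
  finally show ?case using Cons by simp
qed (simp add: prefixes_of_def)

lemma take_in_prefixes_of:
  assumes "u \<in> set us"
  shows "take i u \<in> prefixes_of us"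
proof -
  have "take i u = take (min i (length u)) u" by (simp add: min_def)
  moreover have "min i (length u) \<in> {..length u}" by simp
  ultimately show ?thesis using assms unfolding prefixes_of_def by blast
qed

lemma prefixes_of_words: "us \<in> lists (words X) \<Longrightarrow> prefixes_of us \<subseteq> words X"
  by (auto simp: prefixes_of_def intro: words_take)

lemma free_action_subset:
  assumes "free_action A \<alpha> U" "Z \<subseteq> U" "\<And>a z. a \<in> carrier A \<Longrightarrow> z \<in> Z \<Longrightarrow> \<alpha> a z \<in> Z"
  shows "free_action A \<alpha> Z"
  using assms by (auto simp: free_action_def subset_iff)

lemma free_action_Diff:
  assumes A: "group A" and U: "free_action A \<alpha> U"
    and P: "\<And>a z. a \<in> carrier A \<Longrightarrow> z \<in> P \<Longrightarrow> \<alpha> a z \<in> P"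
  shows "free_action A \<alpha> (U - P)"
proof (rule free_action_subset[OF U])
  fix a z assume a: "a \<in> carrier A" and z: "z \<in> U - P"
  have "\<alpha> (inv\<^bsub>A\<^esub> a) (\<alpha> a z) = z" using free_action_inv[OF A U a] z by simp
  then have "\<alpha> a z \<notin> P" using P[of "inv\<^bsub>A\<^esub> a" "\<alpha> a z"] z group.inv_closed[OF A a] by auto
  then show "\<alpha> a z \<in> U - P" using free_actionD(1)[OF U a] z by simp
qed auto

lemma subgroup_of_words:
  assumes "cs \<in> lists (words X)"
  shows "subgroup (subgroup_of_words X R cs) (presented_group X R)"
  unfolding subgroup_of_words_def
  using assms by (intro group.generate_is_subgroup group_presented_group) (auto intro: pres_class_in_carrier)

lemma subgroup_of_words_incl: "u \<in> set cs \<Longrightarrow> pres_class X R u \<in> subgroup_of_words X R cs"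
  by (auto simp: subgroup_of_words_def intro: generate.incl)

text \<open>Such a model is the substitute for a normal subgroup of finite index meeting the conjugates of the
  factors trivially: multiplying any set with \<open>\<Omega>\<close> makes both factors act freely.\<close>

locale free_model = amalgam X1 X2 R1 R2 A Y \<phi>1 \<phi>2 w1 w2
  for X1 X2 :: "'x set" and R1 R2 :: "'x word set"
    and A :: "('a, 'm) monoid_scheme" and Y :: "'a set"
    and \<phi>1 \<phi>2 :: "'a \<Rightarrow> 'x word set" and w1 w2 :: "'a \<Rightarrow> 'x word" +
  fixes S :: "'x letter \<Rightarrow> 'o \<Rightarrow> 'o" and \<Omega> :: "'o set"
  assumes S: "acts X R S \<Omega>" and S1: "acts_freely X1 R1 S \<Omega>" and S2: "acts_freely X2 R2 S \<Omega>"
    and \<Omega>: "finite \<Omega>" "\<Omega> \<noteq> {}"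
begin

text \<open>Let \<open>H\<close> be the subgroup generated by \<open>cs\<close>.  The factors act freely on the infinite set
  \<open>G/H \<times> \<Omega> \<times> \<nat>\<close>.  A finite \<open>A\<close>-invariant piece \<open>P\<close> of it contains everything that is visited
  when the words in \<open>cs\<close> and \<open>w\<close> are read from the base set \<open>{H} \<times> \<Omega> \<times> {0}\<close>.  Completing \<open>P\<close> to a finite
  set \<open>Z1\<close> invariant under the first factor and to an equally large \<open>Z2\<close> invariant under the second, and
  matching the two by an \<open>A\<close>-equivariant bijection that is the identity on \<open>P\<close>, gives an action on \<open>Z1\<close> for which
  these words act on the base set as before: \<open>cs\<close> preserves it and \<open>w\<close> does not.  Its size can be
  prescribed, above a bound that depends on the words through their lengths only.\<close>

lemma separation:
  assumes cs: "cs \<in> lists (words X)" and w: "w \<in> words X" and nin: "cls w \<notin> subgroup_of_words X R cs"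
    and m: "(\<Sum>u\<leftarrow>w # cs. Suc (length u)) * (card (carrier A) * card \<Omega>) \<le> m"
  shows "\<exists>T. acts X R T {..<m * (card (carrier G1) * card (carrier G2))} \<and>
    (\<forall>u\<in>set cs. \<forall>i<card \<Omega>. run T u i < card \<Omega>) \<and> (\<exists>i<card \<Omega>. \<not> run T w i < card \<Omega>)"
proof -
  interpret G: group G by (rule group_presented_group)
  interpret A: group A by (fact A)
  define H where "H = subgroup_of_words X R cs"
  have H: "subgroup H G" unfolding H_def by (rule subgroup_of_words[OF cs])
  note Hsub = subgroup.subset[OF H]
  \<comment> \<open>The third coordinate, on which the group acts trivially, only supplies infinitely many orbits.\<close>
  define E where "E = (rcosets\<^bsub>G\<^esub> H) \<times> \<Omega> \<times> (UNIV :: nat set)"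
  define T where "T = (\<lambda>l (K, y, j :: nat). (translate_coset X R l K, S l y, j))"
  have runT: "run T u (K, y, j) = (run (translate_coset X R) u K, run S u y, j)" for u K y j
    by (induction u arbitrary: K y) (auto simp: T_def)
  have T: "acts X R T E"
    using acts_translate_coset[OF H] S unfolding acts_def E_def
    by (auto simp: runT) (auto simp: T_def)
  have free: "acts_freely X1 R1 T E" "acts_freely X2 R2 T E"
    using acts_factors[OF T] S1 S2 by (auto simp: acts_freely_def E_def runT)
  have HE: "H \<in> rcosets\<^bsub>G\<^esub> H" using subgroup.subgroup_in_rcosets[OF H G.is_group] .
  have inf: "infinite E"
  proof
    assume "finite E"
    moreover obtain y where "y \<in> \<Omega>" using \<Omega> by auto
    then have "(\<lambda>j. (H, y, j)) ` UNIV \<subseteq> E" using HE by (auto simp: E_def)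
    ultimately have "finite ((\<lambda>j :: nat. (H, y, j)) ` UNIV)" using finite_subset by blast
    then show False using finite_imageD[of "\<lambda>j :: nat. (H, y, j)" UNIV] by (auto simp: inj_on_def)
  qed
  have cos: "run T u (H, y, j) = (H #>\<^bsub>G\<^esub> cls u, run S u y, j)" if "u \<in> words X" for u y j
    using runT run_translate_coset[OF that Hsub] by simp
  note rep = words1[OF rep1]
  define V where "V = prefixes_of (w # cs)"
  have V: "finite V" "V \<subseteq> words X"
    using finite_prefixes_of prefixes_of_words[of "w # cs" X] cs w by (auto simp: V_def)
  \<comment> \<open>Prefixes are followed by elements of \<open>A\<close> to make the piece \<open>A\<close>-invariant.\<close>
  define P0 where "P0 = (\<lambda>(u, a). H #>\<^bsub>G\<^esub> cls (u @ rep1 a)) ` (V \<times> carrier A)"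
  define P where "P = P0 \<times> \<Omega> \<times> {0 :: nat}"
  have P0E: "P0 \<subseteq> rcosets\<^bsub>G\<^esub> H"
  proof
    fix K assume "K \<in> P0"
    then obtain u a where u: "u \<in> V" "a \<in> carrier A" "K = H #>\<^bsub>G\<^esub> cls (u @ rep1 a)"
      by (auto simp: P0_def)
    then have "u @ rep1 a \<in> words X" using V rep by auto
    then show "K \<in> rcosets\<^bsub>G\<^esub> H"
      using pres_class_in_carrier u(3) unfolding RCOSETS_def by blast
  qed
  have PE: "P \<subseteq> E" using P0E by (auto simp: P_def E_def)
  have finP0: "finite P0" using V A by (simp add: P0_def)
  then have finP: "finite P" using \<Omega> by (simp add: P_def)
  have "card P0 \<le> card V * card (carrier A)"
    unfolding P0_def using card_image_le[of "V \<times> carrier A"] V A(2)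
    by (metis card_cartesian_product finite_cartesian_product)
  also have "\<dots> \<le> (\<Sum>u\<leftarrow>w # cs. Suc (length u)) * card (carrier A)"
    unfolding V_def by (intro mult_le_mono1 card_prefixes_of)
  finally have "card P \<le> (\<Sum>u\<leftarrow>w # cs. Suc (length u)) * card (carrier A) * card \<Omega>"
    by (simp add: P_def card_cartesian_product)
  then have cardP: "card P \<le> m" using m by (simp only: mult.assoc le_trans)
  have PV: "H #>\<^bsub>G\<^esub> cls u \<in> P0" if "u \<in> V" for u
  proof -
    have "\<phi>1 \<one>\<^bsub>A\<^esub> = pres_class X1 R1 []"
      using hom_one[OF \<phi>1(1) A(1) group_presented_group] by (simp add: one_presented_group)
    then have "pres_eq X1 R1 (rep1 \<one>\<^bsub>A\<^esub>) []" using pick_pres_eq[of "[]" X1 R1] by simp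
    then have "pres_eq X R (u @ rep1 \<one>\<^bsub>A\<^esub>) (u @ [])"
      using that V by (intro pres_append pres_refl pres_eq1) auto
    then have "cls (u @ rep1 \<one>\<^bsub>A\<^esub>) = cls u"
      using pres_class_eq_iff[of "u @ rep1 \<one>\<^bsub>A\<^esub>" X R u] pres_eq_words by fastforce
    then show ?thesis unfolding P0_def using that by (auto intro!: image_eqI[of _ _ "(u, \<one>\<^bsub>A\<^esub>)"])
  qed
  define \<alpha> where "\<alpha> = (\<lambda>a. run T (rep1 a))"
  have fr: "free_action A \<alpha> E"
    unfolding \<alpha>_def by (rule free_action_hom[OF A(1) \<phi>1 free(1)])
  have Pinv: "\<alpha> b p \<in> P" if b: "b \<in> carrier A" and p: "p \<in> P" for b p
  proof -
    obtain u a y where u: "u \<in> V" "a \<in> carrier A" "y \<in> \<Omega>"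
      "p = (H #>\<^bsub>G\<^esub> cls (u @ rep1 a), y, 0)" using p by (auto simp: P_def P0_def)
    have w: "u @ rep1 a \<in> words X" using u V rep by auto
    let ?c = "a \<otimes>\<^bsub>A\<^esub> b"
    have "\<phi>1 ?c = pres_class X1 R1 (rep1 a @ rep1 b)"
      using \<phi>1(1) pick[OF \<phi>1_in[OF u(2)]] pick[OF \<phi>1_in[OF b]] u(2) b
      by (simp add: hom_def flip: pres_class_mult)
    then have "pres_eq X1 R1 (rep1 ?c) (rep1 a @ rep1 b)"
      using pick_pres_eq[of "rep1 a @ rep1 b" X1 R1] rep1 u(2) b by simp
    then have "pres_eq X R (u @ rep1 ?c) (u @ (rep1 a @ rep1 b))"
      using u V by (intro pres_append pres_refl pres_eq1) auto
    then have c: "cls (u @ rep1 ?c) = cls ((u @ rep1 a) @ rep1 b)"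
      using pres_class_eq_iff pres_eq_words by fastforce
    have "H #>\<^bsub>G\<^esub> cls (u @ rep1 a) \<subseteq> carrier G"
      using w Hsub by (intro G.r_coset_subset_G pres_class_in_carrier)
    then have "\<alpha> b p = ((H #>\<^bsub>G\<^esub> cls (u @ rep1 a)) #>\<^bsub>G\<^esub> cls (rep1 b), run S (rep1 b) y, 0)"
      using runT run_translate_coset[OF rep[OF b]] by (simp add: \<alpha>_def u)
    also have "\<dots> = (H #>\<^bsub>G\<^esub> cls (u @ rep1 ?c), run S (rep1 b) y, 0)"
      using c w rep[OF b] Hsub pres_class_mult[OF w rep[OF b], of R]
      by (simp add: G.coset_mult_assoc pres_class_in_carrier)
    finally show ?thesis
      using u b run_closed[OF S rep[OF b] u(3)] by (auto simp: P_def P0_def)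
  qed
  let ?g1 = "card (carrier G1)" and ?g2 = "card (carrier G2)"
  have pos: "0 < ?g1" "0 < ?g2"
    using fin1 fin2 pres_class_in_carrier[OF words_Nil] by (auto simp: card_gt_0_iff)
  have le: "card P \<le> m * ?g2" "card P \<le> m * ?g1"
    using mult_le_mono[OF cardP, of 1 ?g2] mult_le_mono[OF cardP, of 1 ?g1] pos by auto
  obtain Z1 where Z1: "P \<subseteq> Z1" "Z1 \<subseteq> E" "finite Z1" "card Z1 = m * ?g2 * ?g1"
    "\<And>u z. u \<in> words X1 \<Longrightarrow> z \<in> Z1 \<Longrightarrow> run T u z \<in> Z1"
    using ex_finite_invariant_superset[OF free(1) fin1 inf PE finP le(1)] by auto
  obtain Z2 where Z2: "P \<subseteq> Z2" "Z2 \<subseteq> E" "finite Z2" "card Z2 = m * ?g1 * ?g2"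
    "\<And>u z. u \<in> words X2 \<Longrightarrow> z \<in> Z2 \<Longrightarrow> run T u z \<in> Z2"
    using ex_finite_invariant_superset[OF free(2) fin2 inf PE finP le(2)] by auto
  have T1: "acts X1 R1 T Z1" and T2: "acts X2 R2 T Z2"
    using acts_subset[OF acts_factors(1)[OF T] Z1(2,5)] acts_subset[OF acts_factors(2)[OF T] Z2(2,5)]
    by auto
  have \<alpha>2: "\<alpha> a z = run T (rep2 a) z" if "a \<in> carrier A" "z \<in> E" for a z
    unfolding \<alpha>_def by (rule run_pres_eq[OF T rep1_eq_rep2[OF that(1)] that(2)])
  have frZ: "free_action A \<alpha> Z1" "free_action A \<alpha> Z2"
  proof -
    show "free_action A \<alpha> Z1"
      by (rule free_action_subset[OF fr Z1(2)]) (use Z1(5) rep1 in \<open>auto simp: \<alpha>_def\<close>)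
    show "free_action A \<alpha> Z2"
      by (rule free_action_subset[OF fr Z2(2)]) (use Z2(2,5) rep2 \<alpha>2 in \<open>auto simp: subset_iff\<close>)
  qed
  have "card (Z1 - P) = card (Z2 - P)"
    using Z1 Z2 finP by (simp add: card_Diff_subset mult.commute mult.left_commute)
  then obtain \<theta>0 where \<theta>0: "bij_betw \<theta>0 (Z1 - P) (Z2 - P)"
    "\<forall>a\<in>carrier A. \<forall>u\<in>Z1 - P. \<theta>0 (\<alpha> a u) = \<alpha> a (\<theta>0 u)"
    using free_action_equivariant_bij[OF A free_action_Diff[OF A(1) frZ(1) Pinv]
        free_action_Diff[OF A(1) frZ(2) Pinv]] Z1(3) Z2(3) by auto
  define \<theta> where "\<theta> = (\<lambda>z. if z \<in> P then z else \<theta>0 z)"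
  have "bij_betw \<theta> (P \<union> (Z1 - P)) (P \<union> (Z2 - P))"
  proof (rule bij_betw_combine)
    show "bij_betw \<theta> P P" by (auto simp: bij_betw_def inj_on_def \<theta>_def)
    show "bij_betw \<theta> (Z1 - P) (Z2 - P)"
      using \<theta>0(1) bij_betw_cong[of "Z1 - P" \<theta> \<theta>0] by (auto simp: \<theta>_def)
  qed auto
  moreover have "P \<union> (Z1 - P) = Z1" "P \<union> (Z2 - P) = Z2" using Z1(1) Z2(1) by auto
  ultimately have \<theta>: "bij_betw \<theta> Z1 Z2" by simp
  have eqv: "\<theta> (run T (rep1 a) z) = run T (rep2 a) (\<theta> z)" if a: "a \<in> carrier A" and z: "z \<in> Z1" for a z
  proof -
    have "\<theta> (\<alpha> a z) = \<alpha> a (\<theta> z)"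
    proof (cases "z \<in> P")
      case True
      then show ?thesis using Pinv[OF a] by (simp add: \<theta>_def)
    next
      case False
      then have "\<alpha> a z \<in> Z1 - P"
        using free_action_Diff[OF A(1) frZ(1) Pinv] a z by (auto simp: free_action_def)
      then show ?thesis using False \<theta>0(2) a z by (simp add: \<theta>_def)
    qed
    moreover have "\<theta> z \<in> E" using bij_betwE[OF \<theta>] z Z2(2) by auto
    ultimately show ?thesis using \<alpha>2[OF a] by (simp add: \<alpha>_def)
  qed
  define T' where "T' = twist T T Z1 \<theta>"
  have T': "acts X R T' Z1" unfolding T'_def by (rule acts_twist[OF T1 T2 \<theta> eqv])
  \<comment> \<open>Inside \<open>P\<close> the new action is the old one, because \<open>\<theta>\<close> is the identity there.\<close>
  have same: "T' l p = T l p" if "l \<in> letters X" "p \<in> P" "T l p \<in> P" for l p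
  proof (cases "fst l \<in> X1")
    case True
    then show ?thesis by (simp add: T'_def twist_def)
  next
    case False
    then have "T' l p = inv_into Z1 \<theta> (\<theta> (T l p))"
      using that by (simp add: T'_def twist_def \<theta>_def)
    also have "\<dots> = T l p"
      using bij_betw_inv_into_left[OF \<theta>] that(3) Z1(1) by blast
    finally show ?thesis .
  qed
  have path: "run T' (take i u) (H, y, 0) = run T (take i u) (H, y, 0) \<and> run T (take i u) (H, y, 0) \<in> P"
    if u: "u \<in> set (w # cs)" and y: "y \<in> \<Omega>" for u y i
  proof -
    have inP: "run T (take i u) (H, y, 0) \<in> P" for i
    proof -
      have "take i u \<in> V" unfolding V_def by (rule take_in_prefixes_of[OF u])
      then show ?thesis using PV[of "take i u"] V cos run_closed[OF S _ y] by (auto simp: P_def)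
    qed
    have uw: "u \<in> words X" using u cs w by auto
    have "run T' (take i u) (H, y, 0) = run T (take i u) (H, y, 0)"
    proof (induction i)
      case (Suc i)
      show ?case
      proof (cases "i < length u")
        case True
        then have l: "u ! i \<in> letters X" using uw by (auto simp: words_def lists_eq_set)
        have t: "take (Suc i) u = take i u @ [u ! i]" using True by (rule take_Suc_conv_app_nth)
        then have "T (u ! i) (run T (take i u) (H, y, 0)) \<in> P" using inP[of "Suc i"] by simp
        then show ?thesis using Suc same[OF l inP] t by simp
      qed (use Suc in simp)
    qed simp
    with inP show ?thesis by blast
  qed
  have HP: "H \<in> P0"
  proof -
    have "[] \<in> V" using take_in_prefixes_of[of w "w # cs" 0] by (simp add: V_def)
    moreover have "H #>\<^bsub>G\<^esub> cls [] = H" using Hsub by (simp flip: one_presented_group)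
    ultimately show ?thesis using PV by metis
  qed
  define B where "B = {H} \<times> \<Omega> \<times> {0 :: nat}"
  have BZ: "B \<subseteq> Z1" using HP Z1(1) by (auto simp: B_def P_def)
  have cardB: "card B = card \<Omega>" by (simp add: B_def card_cartesian_product)
  have full: "run T' u (H, y, 0) = (H #>\<^bsub>G\<^esub> cls u, run S u y, 0)" "run S u y \<in> \<Omega>"
    if "u \<in> set (w # cs)" "y \<in> \<Omega>" for u y
  proof -
    have uw: "u \<in> words X" using that cs w by auto
    show "run T' u (H, y, 0) = (H #>\<^bsub>G\<^esub> cls u, run S u y, 0)"
      using path[OF that, of "length u"] cos[OF uw] by simp
    show "run S u y \<in> \<Omega>" using run_closed[OF S uw that(2)] .
  qed
  obtain f U where U: "acts X R U {..<card Z1}" and f: "bij_betw f Z1 {..<card Z1}"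
    "f ` B = {..<card B}" "\<forall>u\<in>words X. \<forall>z\<in>Z1. run U u (f z) = f (run T' u z)"
    using acts_relabel[OF T' Z1(3) BZ] by auto
  have "card Z1 = m * (?g1 * ?g2)" using Z1(4) by (simp add: mult.commute mult.left_commute)
  moreover have "run U u i < card \<Omega>" if u: "u \<in> set cs" and i: "i < card \<Omega>" for u i
  proof -
    have "i \<in> f ` B" using i f(2) cardB by auto
    then obtain y where y: "y \<in> \<Omega>" "i = f (H, y, 0)" by (auto simp: B_def)
    have uw: "u \<in> words X" using u cs by auto
    have "H #>\<^bsub>G\<^esub> cls u = H"
      using G.coset_join2[OF pres_class_in_carrier[OF uw] H] subgroup_of_words_incl[OF u] by (simp add: H_def)
    then have "run T' u (H, y, 0) \<in> B" using full[of u y] u y by (simp add: B_def)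
    moreover have "(H, y, 0) \<in> B" using y by (simp add: B_def)
    ultimately have "run U u i \<in> f ` B" using f(3) BZ uw y by auto
    then show ?thesis using f(2) cardB by auto
  qed
  moreover obtain y where y: "y \<in> \<Omega>" using \<Omega> by auto
  have "H #>\<^bsub>G\<^esub> cls w \<noteq> H"
    using G.coset_join1[OF _ pres_class_in_carrier[OF w] H] nin by (auto simp: H_def)
  then have ninB: "run T' w (H, y, 0) \<notin> B" using full[of w y] y by (simp add: B_def)
  have yB: "(H, y, 0) \<in> B" using y by (simp add: B_def)
  then have "f (H, y, 0) < card \<Omega>" using f(2) cardB by auto
  moreover have "\<not> run U w (f (H, y, 0)) < card \<Omega>"
  proof
    assume "run U w (f (H, y, 0)) < card \<Omega>"
    then have "f (run T' w (H, y, 0)) \<in> f ` B" using f(2,3) cardB w yB BZ by auto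
    moreover have "run T' w (H, y, 0) \<in> Z1" using run_closed[OF T' w] yB BZ by auto
    ultimately show False
      using ninB bij_betw_imp_inj_on[OF f(1)] BZ by (simp add: inj_on_image_mem_iff)
  qed
  ultimately show ?thesis using U by auto
qed

text \<open>A generator maps the finite set \<open>{..<q}\<close> injectively into itself, hence onto itself, so its inverse
  preserves the set as well.  Therefore the test of the preceding lemma is never failed by a member of the subgroup.\<close>

lemma preserved_by_subgroup:
  assumes T: "acts X' R' T {..<n}" and q: "q \<le> n" and cs: "cs \<in> lists (words X')"
    and pres: "\<And>u i. u \<in> set cs \<Longrightarrow> i < q \<Longrightarrow> run T u i < q"
    and w: "w \<in> words X'" "pres_class X' R' w \<in> subgroup_of_words X' R' cs" and i: "i < q"
  shows "run T w i < (q :: nat)"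
proof -
  have "run T w i < q" if "g \<in> generate (presented_group X' R') (pres_class X' R' ` set cs)"
    "w \<in> words X'" "pres_class X' R' w = g" "i < q" for g w i
    using that
  proof (induction arbitrary: w i rule: generate.induct)
    case one
    then have "pres_eq X' R' w []" by (simp add: one_presented_group pres_class_eq_iff)
    then show ?case using run_pres_eq[OF T, of w "[]" i] one q by simp
  next
    case (incl h)
    then obtain u where u: "u \<in> set cs" "h = pres_class X' R' u" by auto
    then have "pres_eq X' R' w u" using incl by (simp add: pres_class_eq_iff)
    then show ?case using run_pres_eq[OF T, of w u i] incl q pres[OF u(1)] by simp
  next
    case (inv h)
    then obtain u where u: "u \<in> set cs" "h = pres_class X' R' u" by auto
    have uw: "u \<in> words X'" using u cs by auto
    have lt: "j \<in> {..<n}" if "j < q" for j using that q by simp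
    have "inj_on (run T u) {..<q}"
      using run_inj[OF T uw] lt by (auto intro!: inj_onI)
    moreover have "run T u ` {..<q} \<subseteq> {..<q}" using pres[OF u(1)] by auto
    ultimately have "run T u ` {..<q} = {..<q}" by (intro endo_inj_surj) auto
    then obtain j where j: "j < q" "i = run T u j" using inv(4) by (metis imageE lessThan_iff)
    have "pres_eq X' R' w (word_inv u)" using inv u uw by (simp add: inv_pres_class pres_class_eq_iff)
    then have "run T w i = run T (word_inv u) i" using run_pres_eq[OF T] lt[OF inv(4)] by blast
    then show ?case using j run_word_inv(1)[OF T uw lt[OF j(1)]] by simp
  next
    case (eng g h)
    have sub: "generate (presented_group X' R') (pres_class X' R' ` set cs) \<subseteq> carrier (presented_group X' R')"
      using subgroup.subset[OF subgroup_of_words[OF cs]] by (simp add: subgroup_of_words_def)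
    obtain u v where uv: "u \<in> words X'" "v \<in> words X'" "g = pres_class X' R' u" "h = pres_class X' R' v"
      using sub eng(1,2) by (meson in_carrier_pres_class subsetD)
    then have "pres_eq X' R' w (u @ v)" using eng by (simp add: pres_class_mult pres_class_eq_iff)
    then have "run T w i = run T v (run T u i)" using run_pres_eq[OF T, of w "u @ v" i] eng(7) q by simp
    then show ?case using eng uv by simp
  qed
  then show ?thesis using w i by (auto simp: subgroup_of_words_def)
qed

end

section \<open>Far cosets in a group generated by two finite subgroups\<close>

context group
begin

definition product :: "'a list \<Rightarrow> 'a" where
  "product ss = foldr (\<otimes>) ss \<one>"

lemma product_simps [simp]: "product [] = \<one>" "product (s # ss) = s \<otimes> product ss"
  by (simp_all add: product_def)

lemma product_closed: "set ss \<subseteq> carrier G \<Longrightarrow> product ss \<in> carrier G"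
  by (induction ss) auto

lemma product_append:
  "set ss \<subseteq> carrier G \<Longrightarrow> set ts \<subseteq> carrier G \<Longrightarrow> product (ss @ ts) = product ss \<otimes> product ts"
  by (induction ss) (auto simp: m_assoc product_closed)

text \<open>A path from a far coset \<open>v(U1 \<inter> U2)\<close> back to the identity that leaves through \<open>U1\<close> and never
  returns: with \<open>v\<close> the inverse of the product, the points of the path are \<open>v\<close> times the initial products.
  Take a coset outside a suitable finite set and a shortest product \<open>ss\<close> representing it.  Minimality prevents
  the path from returning.  If it starts with a factor from \<open>U2\<close>, put an element \<open>u\<close> of \<open>U1\<close>
  outside \<open>U2\<close> in front; such a \<open>u\<close> exists because \<open>U2\<close> alone would generate a finite group.\<close>

lemma ex_far_coset:
  assumes U1: "subgroup U1 G" "finite U1" and U2: "subgroup U2 G" "finite U2"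
    and gen: "\<And>g. g \<in> carrier G \<Longrightarrow> \<exists>ss. set ss \<subseteq> U1 \<union> U2 \<and> g = product ss"
    and inf: "infinite (carrier G)" and F: "finite F"
  shows "\<exists>ss. ss \<noteq> [] \<and> set ss \<subseteq> U1 \<union> U2 \<and> hd ss \<in> U1 \<and>
    (\<forall>i. 0 < i \<longrightarrow> i \<le> length ss \<longrightarrow> product (take i ss) \<notin> U1 \<inter> U2) \<and>
    (\<forall>c\<in>U1 \<inter> U2. c \<otimes> product ss \<notin> F)"
proof -
  define C where "C = U1 \<inter> U2"
  have C: "subgroup C G" unfolding C_def by (rule subgroups_Inter_pair[OF U1(1) U2(1)])
  note U1s = subgroup.mem_carrier[OF U1(1)] and U2s = subgroup.mem_carrier[OF U2(1)]
    and Cs = subgroup.mem_carrier[OF C]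
  have sub: "set ss \<subseteq> carrier G" if "set ss \<subseteq> U1 \<union> U2" for ss
    using that U1s U2s by auto
  note pc = product_closed[OF sub]
  have "\<not> U1 \<subseteq> U2"
  proof
    assume "U1 \<subseteq> U2"
    then have "product ss \<in> U2" if "set ss \<subseteq> U1 \<union> U2" for ss
      using that U2(1) by (induction ss) (auto simp: subgroup.one_closed subgroup.m_closed)
    then have "carrier G \<subseteq> U2" using gen by blast
    then show False using inf U2(2) finite_subset by blast
  qed
  then obtain u where u: "u \<in> U1" "u \<notin> C" by (auto simp: C_def)
  have uG: "u \<in> carrier G" using u U1s by auto
  \<comment> \<open>Besides \<open>F\<close>, avoid what multiplication by \<open>u\<close> could carry into \<open>F\<close>, and the trivial coset.\<close>
  define Fbad where "Fbad = (F \<inter> carrier G) \<union> (\<lambda>(c, f). inv u \<otimes> c \<otimes> f) ` (C \<times> (F \<inter> carrier G)) \<union> C"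
  have Fbad: "finite Fbad" "Fbad \<subseteq> carrier G"
    using F U1(2) uG Cs by (auto simp: Fbad_def C_def)
  have "finite ((\<lambda>(c, f). c \<otimes> f) ` (C \<times> Fbad))"
    using Fbad(1) U1(2) by (simp add: C_def)
  then obtain g0 where g0: "g0 \<in> carrier G" "g0 \<notin> (\<lambda>(c, f). c \<otimes> f) ` (C \<times> Fbad)"
    using inf by (meson finite_subset subsetI)
  have avoid: "c \<otimes> g0 \<notin> Fbad" if c: "c \<in> C" for c
  proof
    assume bad: "c \<otimes> g0 \<in> Fbad"
    have "g0 = inv c \<otimes> (c \<otimes> g0)" using g0(1) Cs[OF c] by (simp flip: m_assoc)
    then have "g0 = (case (inv c, c \<otimes> g0) of (c, f) \<Rightarrow> c \<otimes> f)" by (simp only: split_conv)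
    moreover have "(inv c, c \<otimes> g0) \<in> C \<times> Fbad" using bad subgroup.m_inv_closed[OF C c] by simp
    ultimately have "g0 \<in> (\<lambda>(c, f). c \<otimes> f) ` (C \<times> Fbad)" by (rule image_eqI)
    then show False using g0(2) by contradiction
  qed
  define Q where "Q = (\<lambda>n. \<exists>c\<in>C. \<exists>ss. length ss = n \<and> set ss \<subseteq> U1 \<union> U2 \<and> product ss = c \<otimes> g0)"
  have "\<exists>n. Q n"
    using gen[OF g0(1)] subgroup.one_closed[OF C] g0(1) unfolding Q_def by (metis l_one)
  then have "Q (LEAST n. Q n)" by (rule LeastI_ex)
  then obtain c0 ss where ss: "c0 \<in> C" "length ss = (LEAST n. Q n)" "set ss \<subseteq> U1 \<union> U2" "product ss = c0 \<otimes> g0"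
    by (auto simp: Q_def)
  have minimal: "length ss \<le> length ts" if "c \<in> C" "set ts \<subseteq> U1 \<union> U2" "product ts = c \<otimes> g0" for c ts
    using Least_le[of Q "length ts"] that ss(2) unfolding Q_def by auto
  have sst: "set (take i ss) \<subseteq> U1 \<union> U2" "set (drop i ss) \<subseteq> U1 \<union> U2" for i
    using ss(3) set_take_subset[of i ss] set_drop_subset[of i ss] by auto
  have split: "product (take i ss) \<otimes> product (drop i ss) = c0 \<otimes> g0" for i
    using product_append[OF sub[OF sst(1)] sub[OF sst(2)], of i i] ss(4) by simp
  have pre: "product (take i ss) \<notin> C" if i: "0 < i" "i \<le> length ss" for i
  proof
    let ?c = "product (take i ss)"
    assume c: "?c \<in> C"
    have "product (drop i ss) = inv ?c \<otimes> (?c \<otimes> product (drop i ss))"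
      using Cs[OF c] pc[OF sst(2)] by (simp flip: m_assoc)
    also have "\<dots> = (inv ?c \<otimes> c0) \<otimes> g0"
      using split Cs[OF c] Cs[OF ss(1)] g0(1) by (simp add: m_assoc)
    finally have "length ss \<le> length (drop i ss)"
      by (rule minimal[OF subgroup.m_closed[OF C subgroup.m_inv_closed[OF C c] ss(1)] sst(2)])
    then show False using i by simp
  qed
  have ne: "ss \<noteq> []"
  proof
    assume "ss = []"
    then have "c0 \<otimes> g0 = \<one>" using ss(4) by simp
    then have "c0 \<otimes> g0 \<in> Fbad" using subgroup.one_closed[OF C] by (simp add: Fbad_def)
    then show False using avoid ss(1) by blast
  qed
  have gG: "product ss \<in> carrier G" using pc ss(3) by blast
  show ?thesis
  proof (cases "hd ss \<in> U1")
    case True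
    have "c \<otimes> product ss \<notin> F" if c: "c \<in> C" for c
    proof -
      have "c \<otimes> product ss = (c \<otimes> c0) \<otimes> g0"
        using Cs[OF c] Cs[OF ss(1)] g0(1) ss(4) by (simp add: m_assoc)
      moreover have "c \<otimes> c0 \<in> C" using C c ss(1) by (simp add: subgroup.m_closed)
      ultimately have "c \<otimes> product ss \<notin> Fbad" using avoid by simp
      then show ?thesis using Cs[OF c] gG by (simp add: Fbad_def)
    qed
    then show ?thesis using ne ss(3) True pre unfolding C_def by blast
  next
    case False
    have "product (take i (u # ss)) \<notin> C" if i: "0 < i" "i \<le> length (u # ss)" for i
    proof
      assume c: "product (take i (u # ss)) \<in> C"
      obtain j where j: "i = Suc j" using i by (cases i) auto
      let ?t = "product (take j ss)"
      have tG: "?t \<in> carrier G" using pc sst(1) by blast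
      have ut: "u \<otimes> ?t \<in> C" using c j by simp
      have "?t = inv u \<otimes> (u \<otimes> ?t)" using tG uG by (simp flip: m_assoc)
      then have t: "?t \<in> U1"
        using ut u(1) U1(1) subgroup.m_closed subgroup.m_inv_closed unfolding C_def by (metis IntD1)
      have "j \<noteq> 0"
      proof
        assume "j = 0"
        then show False using ut uG u(2) by simp
      qed
      have "set (?t # drop j ss) \<subseteq> U1 \<union> U2" using t sst(2) by auto
      then have "length ss \<le> length (?t # drop j ss)"
        using minimal[OF ss(1)] split by (metis product_simps(2))
      then have "j = 1" using \<open>j \<noteq> 0\<close> i j by simp
      then have "?t = hd ss"
        using ne ss(3) U1s U2s by (cases ss) auto
      then show False using t False by simp
    qed
    moreover have "c \<otimes> product (u # ss) \<notin> F" if c: "c \<in> C" for c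
    proof
      let ?f = "c \<otimes> product (u # ss)"
      assume f: "?f \<in> F"
      have fG: "?f \<in> carrier G" using Cs[OF c] uG gG by simp
      have "product ss = inv u \<otimes> inv c \<otimes> ?f"
        using Cs[OF c] uG gG by (simp add: m_assoc[symmetric])
          (simp add: m_assoc)
      then have "c0 \<otimes> g0 \<in> Fbad"
        using f fG subgroup.m_inv_closed[OF C c] ss(4)
        unfolding Fbad_def by (intro UnI1 UnI2 image_eqI[of _ _ "(inv c, ?f)"]) auto
      then show False using avoid ss(1) by blast
    qed
    ultimately show ?thesis
      using u(1) ss(3) unfolding C_def[symmetric] by (intro exI[of _ "u # ss"]) auto
  qed
qed

end

section \<open>Finitely generated normal subgroups of infinite index\<close>

context amalgam
begin

definition U1 :: "'x word set set" where "U1 = cls ` words X1"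
definition U2 :: "'x word set set" where "U2 = cls ` words X2"

lemma U1: "subgroup U1 G" "finite U1" and U2: "subgroup U2 G" "finite U2"
proof -
  interpret G: group G by (rule group_presented_group)
  have 1: "subgroup (cls ` words X') G" if "X' \<subseteq> X" for X'
  proof (rule G.subgroupI)
    note w = words_mono[OF that, THEN subsetD]
    show "cls ` words X' \<subseteq> carrier G" using w by (auto intro: pres_class_in_carrier)
    show "cls ` words X' \<noteq> {}" using words_Nil by blast
    show "inv\<^bsub>G\<^esub> g \<in> cls ` words X'" if "g \<in> cls ` words X'" for g
      using that w word_inv_words[of _ X'] by (auto simp: inv_pres_class)
    show "g \<otimes>\<^bsub>G\<^esub> h \<in> cls ` words X'" if "g \<in> cls ` words X'" "h \<in> cls ` words X'" for g h
      using that w by (auto simp: pres_class_mult)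
  qed
  show "subgroup U1 G" "subgroup U2 G" unfolding U1_def U2_def by (auto intro: 1)
  have "U1 \<subseteq> (\<lambda>g. cls (pick g)) ` carrier G1"
  proof
    fix g assume "g \<in> U1"
    then obtain u where u: "u \<in> words X1" "g = cls u" by (auto simp: U1_def)
    have "pres_eq X R u (pick (pres_class X1 R1 u))"
      using pick_pres_eq[OF u(1)] pres_eq1 pres_sym by blast
    then have "g = cls (pick (pres_class X1 R1 u))"
      using pres_class_eq_iff[OF words1[OF u(1)]] u(2) by blast
    then show "g \<in> (\<lambda>g. cls (pick g)) ` carrier G1" using pres_class_in_carrier[OF u(1)] by blast
  qed
  then show "finite U1" using fin1 finite_subset by blast
  have "U2 \<subseteq> (\<lambda>g. cls (pick g)) ` carrier G2"
  proof
    fix g assume "g \<in> U2"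
    then obtain u where u: "u \<in> words X2" "g = cls u" by (auto simp: U2_def)
    have "pres_eq X R u (pick (pres_class X2 R2 u))"
      using pick_pres_eq[OF u(1)] pres_eq2 pres_sym by blast
    then have "g = cls (pick (pres_class X2 R2 u))"
      using pres_class_eq_iff[OF words2[OF u(1)]] u(2) by blast
    then show "g \<in> (\<lambda>g. cls (pick g)) ` carrier G2" using pres_class_in_carrier[OF u(1)] by blast
  qed
  then show "finite U2" using fin2 finite_subset by blast
qed

lemma product_of_factors:
  assumes "g \<in> carrier G"
  shows "\<exists>ss. set ss \<subseteq> U1 \<union> U2 \<and> g = group.product G ss"
proof -
  interpret G: group G by (rule group_presented_group)
  have "\<exists>ss. set ss \<subseteq> U1 \<union> U2 \<and> cls w = G.product ss" if "w \<in> words X" for w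
    using that
  proof (induction w)
    case Nil
    then show ?case by (intro exI[of _ "[]"]) (simp add: one_presented_group)
  next
    case (Cons l w)
    then obtain ss where ss: "set ss \<subseteq> U1 \<union> U2" "cls w = G.product ss" by auto
    have "cls (l # w) = cls [l] \<otimes>\<^bsub>G\<^esub> cls w" using pres_class_mult[of "[l]" X w R] Cons by simp
    moreover have "cls [l] \<in> U1 \<union> U2" using Cons(2) by (auto simp: letters_Un U1_def U2_def)
    ultimately show ?case using ss by (intro exI[of _ "cls [l] # ss"]) auto
  qed
  moreover obtain w where "w \<in> words X" "g = cls w" using assms by (rule in_carrier_pres_class)
  ultimately show ?thesis by simp
qed

end

context free_model
begin

lemma faithful_on_model:
  assumes u: "u \<in> words X1 \<union> words X2" and y: "y \<in> \<Omega>" "run S u y = y"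
  shows "pres_eq X R u []"
  using assms S1 S2 pres_eq1 pres_eq2 by (auto simp: acts_freely_def)

text \<open>Because \<open>C\<close> acts freely at \<open>x\<close> and at \<open>v\<close>, a point of either orbit determines the element
  that leads to it, so the interchange of the two orbits is well defined.\<close>

lemma ex_swap:
  assumes T: "acts X R T E" and x: "x \<in> E" and v: "v \<in> E"
    and C: "subgroup C G"
    and free: "\<And>c e. c \<in> words X \<Longrightarrow> cls c \<in> C \<Longrightarrow> e \<in> {x, v} \<Longrightarrow> run T c e = e \<Longrightarrow> pres_eq X R c []"
  defines "CW \<equiv> {c \<in> words X. cls c \<in> C}"
  defines "xC \<equiv> (\<lambda>c. run T c x) ` CW" and "vC \<equiv> (\<lambda>c. run T c v) ` CW"
  assumes dis: "xC \<inter> vC = {}"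
  shows "\<exists>\<sigma>. (\<forall>c\<in>CW. \<sigma> (run T c x) = run T c v \<and> \<sigma> (run T c v) = run T c x) \<and>
    (\<forall>z. z \<notin> xC \<union> vC \<longrightarrow> \<sigma> z = z)"
proof -
  have app: "c @ word_inv d \<in> words X" "cls (c @ word_inv d) \<in> C" if "c \<in> CW" "d \<in> CW" for c d
  proof -
    show "c @ word_inv d \<in> words X" using that word_inv_words[of d X] by (simp add: CW_def)
    have "cls (c @ word_inv d) = cls c \<otimes>\<^bsub>G\<^esub> inv\<^bsub>G\<^esub> (cls d)"
      using that pres_class_mult[of c X "word_inv d" R] word_inv_words[of d X] inv_pres_class[of d X R]
      by (simp add: CW_def)
    then show "cls (c @ word_inv d) \<in> C"
      using that C by (simp add: CW_def subgroup.m_closed subgroup.m_inv_closed)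
  qed
  have eq: "pres_eq X R c d" if "c \<in> CW" "d \<in> CW" "e \<in> {x, v}" "run T c e = run T d e" for c d e
  proof -
    have d: "d \<in> words X" "c \<in> words X" using that by (auto simp: CW_def)
    have e: "e \<in> E" using that x v by auto
    have "run T (c @ word_inv d) e = e" using that(4) run_word_inv(1)[OF T d(1) e] by simp
    then have "pres_eq X R (c @ word_inv d) []" using free app[OF that(1,2)] that(3) by blast
    then have "pres_eq X R ((c @ word_inv d) @ d) ([] @ d)"
      using d by (intro pres_append pres_refl)
    moreover have "pres_eq X R (c @ (word_inv d @ d)) (c @ [])"
      using d by (intro pres_append pres_eq_word_inv pres_refl)
    ultimately show ?thesis by simp (meson pres_sym pres_trans)
  qed
  define \<sigma> where "\<sigma> = (\<lambda>z. if z \<in> xC then run T (SOME c. c \<in> CW \<and> z = run T c x) v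
    else if z \<in> vC then run T (SOME c. c \<in> CW \<and> z = run T c v) x else z)"
  have 1: "\<sigma> (run T c x) = run T c v" if c: "c \<in> CW" for c
  proof -
    let ?d = "SOME d. d \<in> CW \<and> run T c x = run T d x"
    have "?d \<in> CW \<and> run T c x = run T ?d x"
      by (rule someI[of "\<lambda>d. d \<in> CW \<and> run T c x = run T d x" c]) (simp add: c)
    then have "pres_eq X R ?d c" using eq[of ?d c x] c by auto
    then have "run T ?d v = run T c v" by (rule run_pres_eq[OF T _ v])
    then show ?thesis using c by (simp add: \<sigma>_def xC_def)
  qed
  have 2: "\<sigma> (run T c v) = run T c x" if c: "c \<in> CW" for c
  proof -
    let ?d = "SOME d. d \<in> CW \<and> run T c v = run T d v"
    have "?d \<in> CW \<and> run T c v = run T ?d v"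
      by (rule someI[of "\<lambda>d. d \<in> CW \<and> run T c v = run T d v" c]) (simp add: c)
    then have "pres_eq X R ?d c" using eq[of ?d c v] c by auto
    then have "run T ?d x = run T c x" by (rule run_pres_eq[OF T _ x])
    moreover have "run T c v \<in> vC" "run T c v \<notin> xC" using c dis by (auto simp: vC_def)
    ultimately show ?thesis by (simp add: \<sigma>_def)
  qed
  show ?thesis using 1 2 by (intro exI[of _ \<sigma>]) (auto simp: \<sigma>_def)
qed

text \<open>Surgery on \<open>(G/H \<times> \<Omega>) + G\<close>: just outside the finite part of \<open>G/H\<close> visited by the generators there
  is a point \<open>x\<close> because the index is infinite, and in \<open>G\<close> there is a far point \<open>v\<close>.  Twisting the action of the second
  factor by the interchange of \<open>xC\<close> and \<open>vC\<close>, where \<open>C\<close> is the intersection of the images of the factors,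
  does not change how \<open>H\<close> moves the base points \<open>{H} \<times> \<Omega>\<close>, but connects them with the identity of \<open>G\<close>.
  By normality every conjugate of \<open>n0\<close> lies in \<open>H\<close> and acts trivially on \<open>\<Omega>\<close>, so it fixes a base point;
  hence \<open>n0\<close> fixes the identity of \<open>G\<close> in the new action.  Since \<open>v\<close> is too far away to be met when \<open>n0\<close>
  is read there, \<open>n0\<close> moves the identity to the element represented by \<open>n0\<close>, which is therefore trivial.\<close>

lemma normal_infinite_index_trivial:
  assumes hs: "hs \<in> lists (words X)" and N: "subgroup_of_words X R hs \<lhd> G"
    and infG: "infinite (carrier G)" and index: "infinite (rcosets\<^bsub>G\<^esub> (subgroup_of_words X R hs))"
    and n0: "n0 \<in> words X" "cls n0 \<in> subgroup_of_words X R hs" "\<And>y. y \<in> \<Omega> \<Longrightarrow> run S n0 y = y"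
  shows "pres_eq X R n0 []"
proof -
  interpret G: group G by (rule group_presented_group)
  define H where "H = subgroup_of_words X R hs"
  have H: "subgroup H G" unfolding H_def by (rule subgroup_of_words[OF hs])
  note Hsub = subgroup.subset[OF H]
  define C where "C = U1 \<inter> U2"
  have C: "subgroup C G" unfolding C_def by (rule G.subgroups_Inter_pair[OF U1(1) U2(1)])
  note Cs = subgroup.mem_carrier[OF C]
  have finC: "finite C" using U1 by (simp add: C_def)
  note cc = pres_class_in_carrier[of _ X R]
  have cw: "\<exists>u\<in>words X. cls u = g" if "g \<in> carrier G" for g
    using that by (metis in_carrier_pres_class)
  define E where "E = Inl ` ((rcosets\<^bsub>G\<^esub> H) \<times> \<Omega>) \<union> Inr ` carrier G"
  define T where "T = (\<lambda>l. map_sum (map_prod (translate_coset X R l) (S l)) (translate X R l))"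
  have runL: "run T u (Inl (K, y)) = Inl (run (translate_coset X R) u K, run S u y)" for u K y
    by (induction u arbitrary: K y) (auto simp: T_def)
  have runR: "run T u (Inr g) = Inr (run (translate X R) u g)" for u g
    by (induction u arbitrary: g) (auto simp: T_def)
  have trans: "acts X R (translate X R) (carrier G)"
    using acts_freely_translate[of X R] unfolding acts_freely_def by blast
  have T: "acts X R T E"
    using acts_translate_coset[OF H] S trans unfolding acts_def E_def
    by (auto simp: runL runR) (auto simp: T_def)
  have rR: "run T u (Inr g) = Inr (g \<otimes>\<^bsub>G\<^esub> cls u)" if "u \<in> words X" "g \<in> carrier G" for u g
    using runR run_translate[OF that] by simp
  have rL: "run T u (Inl (H, y)) = Inl (H #>\<^bsub>G\<^esub> cls u, run S u y)" if "u \<in> words X" for u y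
    using runL run_translate_coset[OF that Hsub] by simp
  have HE: "H \<in> rcosets\<^bsub>G\<^esub> H" using subgroup.subgroup_in_rcosets[OF H G.is_group] .
  \<comment> \<open>The finite piece of the coset graph in which the generators are read.\<close>
  define V where "V = insert [] (prefixes_of hs)"
  have V: "finite V" "V \<subseteq> words X"
    using finite_prefixes_of prefixes_of_words[OF hs] by (auto simp: V_def)
  define P0 where "P0 = (\<lambda>(u, d). H #>\<^bsub>G\<^esub> (cls u \<otimes>\<^bsub>G\<^esub> d)) ` (V \<times> C)"
  have finP0: "finite P0" using V finC by (simp add: P0_def)
  have VP: "H #>\<^bsub>G\<^esub> cls u \<in> P0" if "u \<in> V" for u
  proof -
    have "cls u \<in> carrier G" using that V cc by auto
    then have "H #>\<^bsub>G\<^esub> cls u = (case (u, \<one>\<^bsub>G\<^esub>) of (u, d) \<Rightarrow> H #>\<^bsub>G\<^esub> (cls u \<otimes>\<^bsub>G\<^esub> d))" by simp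
    then show ?thesis unfolding P0_def using that subgroup.one_closed[OF C] by blast
  qed
  have PC: "K \<in> P0" if K: "K \<subseteq> carrier G" and d: "d \<in> C" "K #>\<^bsub>G\<^esub> d \<in> P0" for K d
  proof -
    obtain u e where u: "u \<in> V" "e \<in> C" "K #>\<^bsub>G\<^esub> d = H #>\<^bsub>G\<^esub> (cls u \<otimes>\<^bsub>G\<^esub> e)"
      using d(2) by (auto simp: P0_def)
    have uG: "cls u \<in> carrier G" using u V cc by auto
    have "K = (K #>\<^bsub>G\<^esub> d) #>\<^bsub>G\<^esub> inv\<^bsub>G\<^esub> d"
      using K Cs[OF d(1)] by (simp add: G.coset_mult_assoc)
    also have "\<dots> = H #>\<^bsub>G\<^esub> (cls u \<otimes>\<^bsub>G\<^esub> (e \<otimes>\<^bsub>G\<^esub> inv\<^bsub>G\<^esub> d))"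
      using u uG Hsub Cs[OF d(1)] Cs[OF u(2)] by (simp add: G.coset_mult_assoc G.m_assoc)
    finally show ?thesis
      unfolding P0_def using u(1) subgroup.m_closed[OF C u(2) subgroup.m_inv_closed[OF C d(1)]] by blast
  qed
  \<comment> \<open>The first edge of some path that leaves the piece; it is labelled \<open>l\<close> and ends in \<open>x\<close>.\<close>
  have "\<not> rcosets\<^bsub>G\<^esub> H \<subseteq> P0" using index finP0 finite_subset by (auto simp: H_def)
  then obtain y where y: "y \<in> words X" "H #>\<^bsub>G\<^esub> cls y \<notin> P0"
    using cw unfolding RCOSETS_def by fastforce
  define i where "i = (LEAST i. H #>\<^bsub>G\<^esub> cls (take i y) \<notin> P0)"
  have i: "H #>\<^bsub>G\<^esub> cls (take i y) \<notin> P0"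
    unfolding i_def by (rule LeastI[of _ "length y"]) (use y in simp)
  have before: "H #>\<^bsub>G\<^esub> cls (take j y) \<in> P0" if "j < i" for j
    using not_less_Least[of j "\<lambda>i. H #>\<^bsub>G\<^esub> cls (take i y) \<notin> P0"] that by (simp add: i_def)
  have "i \<noteq> 0"
  proof
    assume "i = 0"
    then show False using i VP[of "[]"] by (simp add: V_def)
  qed
  then obtain j where j: "i = Suc j" by (cases i) auto
  have "j < length y"
  proof (rule ccontr)
    assume "\<not> j < length y"
    then have "take i y = take j y" using j by simp
    then show False using i before[of j] j by simp
  qed
  define y1 where "y1 = take j y"
  define l where "l = y ! j"
  have y1: "y1 \<in> words X" using y words_take by (simp add: y1_def)
  have l: "l \<in> letters X" using y(1) \<open>j < length y\<close> by (auto simp: l_def words_def lists_eq_set)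
  have yi: "take i y = y1 @ [l]" using \<open>j < length y\<close> j by (simp add: y1_def l_def take_Suc_conv_app_nth)
  define K1 where "K1 = H #>\<^bsub>G\<^esub> cls (y1 @ [l])"
  have K1: "K1 \<notin> P0" using i yi by (simp add: K1_def)
  have y1l: "y1 @ [l] \<in> words X" using y1 l by simp
  have K1G: "K1 \<subseteq> carrier G"
    unfolding K1_def by (rule G.r_coset_subset_G[OF Hsub cc[OF y1l]])
  obtain o0 where o0: "o0 \<in> \<Omega>" using \<Omega> by auto
  define x where "x = run T (y1 @ [l]) (Inl (H, o0))"
  define o1 where "o1 = run S (y1 @ [l]) o0"
  have o1: "o1 \<in> \<Omega>" unfolding o1_def by (rule run_closed[OF S y1l o0])
  have b0E: "Inl (H, z) \<in> E" if "z \<in> \<Omega>" for z using HE that by (auto simp: E_def)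
  have x: "x = Inl (K1, o1)" using rL[OF y1l] by (simp add: x_def K1_def o1_def)
  have xE: "x \<in> E" unfolding x_def by (rule run_closed[OF T y1l b0E[OF o0]])
  \<comment> \<open>Only the second factor is twisted.  If \<open>l\<close> belongs to the first factor, the edge still ends in \<open>x\<close>, and
    the second factor continues from there as from \<open>v\<close>; if \<open>l\<close> belongs to the second factor, the edge now ends in
    \<open>v\<close>, and the first factor continues.  The first step of the way back from \<open>v\<close> is chosen accordingly.\<close>
  define F where "F = (\<lambda>i. inv\<^bsub>G\<^esub> (cls (take i n0))) ` {..length n0}"
  have finF: "finite F" by (simp add: F_def)
  have "\<exists>ss. ss \<noteq> [] \<and> set ss \<subseteq> U1 \<union> U2 \<and> (if fst l \<in> X1 then hd ss \<in> U2 else hd ss \<in> U1) \<and>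
    (\<forall>i. 0 < i \<longrightarrow> i \<le> length ss \<longrightarrow> G.product (take i ss) \<notin> C) \<and> (\<forall>c\<in>C. c \<otimes>\<^bsub>G\<^esub> G.product ss \<notin> F)"
  proof (cases "fst l \<in> X1")
    case True
    have gen: "\<exists>ss. set ss \<subseteq> U2 \<union> U1 \<and> g = G.product ss" if "g \<in> carrier G" for g
      using product_of_factors[OF that] by (simp add: Un_commute)
    show ?thesis
      using G.ex_far_coset[OF U2 U1 gen infG finF] True unfolding C_def by (simp add: Un_commute Int_commute)
  next
    case False
    then show ?thesis
      using G.ex_far_coset[OF U1 U2 product_of_factors infG finF] unfolding C_def by simp
  qed
  then obtain ss where ss: "ss \<noteq> []" "set ss \<subseteq> U1 \<union> U2" "if fst l \<in> X1 then hd ss \<in> U2 else hd ss \<in> U1"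
    "\<And>i. 0 < i \<Longrightarrow> i \<le> length ss \<Longrightarrow> G.product (take i ss) \<notin> C"
    "\<And>c. c \<in> C \<Longrightarrow> c \<otimes>\<^bsub>G\<^esub> G.product ss \<notin> F"
    by blast
  have ssG: "set ss \<subseteq> carrier G" using ss(2) U1(1) U2(1) subgroup.subset by blast
  have pG: "G.product (take i ss) \<in> carrier G" for i
    using G.product_closed set_take_subset[of i ss] ssG by blast
  have pG': "G.product ss \<in> carrier G" using G.product_closed ssG by blast
  define v where "v = inv\<^bsub>G\<^esub> (G.product ss)"
  have vG: "v \<in> carrier G" using pG' by (simp add: v_def)
  have vE: "Inr v \<in> E" using vG by (simp add: E_def)
  define CW where "CW = {c \<in> words X. cls c \<in> C}"
  define xC where "xC = (\<lambda>c. run T c x) ` CW"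
  define vC where "vC = (\<lambda>c. run T c (Inr v)) ` CW"
  have xCL: "\<exists>d\<in>C. \<exists>z. e = Inl (K1 #>\<^bsub>G\<^esub> d, z)" if "e \<in> xC" for e
    using that runL run_translate_coset[OF _ K1G] unfolding xC_def x CW_def by auto
  have vCR: "\<exists>d\<in>C. e = Inr (v \<otimes>\<^bsub>G\<^esub> d)" if "e \<in> vC" for e
    using that rR[OF _ vG] unfolding vC_def CW_def by auto
  have dis: "xC \<inter> vC = {}" using xCL vCR by fastforce
  have free: "pres_eq X R c []"
    if c: "c \<in> words X" "cls c \<in> C" and e: "e \<in> {x, Inr v}" "run T c e = e" for c e
    using e(1)
  proof (elim insertE emptyE)
    assume "e = x"
    obtain u where u: "u \<in> words X1" "cls u = cls c" using c(2) by (auto simp: C_def U1_def)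
    then have uc: "pres_eq X R u c" using pres_class_eq_iff[OF words1[OF u(1)]] by blast
    have "run S c o1 = o1" using e(2) \<open>e = x\<close> x runL by simp
    then have "run S u o1 = o1" using run_pres_eq[OF S uc o1] by simp
    then have "pres_eq X R u []" using faithful_on_model[OF _ o1] u(1) by blast
    then show ?thesis using uc by (meson pres_sym pres_trans)
  next
    assume "e = Inr v"
    then have "v \<otimes>\<^bsub>G\<^esub> cls c = v" using e(2) rR[OF c(1) vG] by simp
    then have "cls c = \<one>\<^bsub>G\<^esub>" using G.l_cancel_one'[OF vG cc[OF c(1)]] by simp
    then show ?thesis using c(1) by (simp add: one_presented_group pres_class_eq_iff)
  qed
  have "\<exists>\<sigma>. (\<forall>c\<in>CW. \<sigma> (run T c x) = run T c (Inr v) \<and> \<sigma> (run T c (Inr v)) = run T c x) \<and>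
    (\<forall>z. z \<notin> xC \<union> vC \<longrightarrow> \<sigma> z = z)"
    unfolding xC_def vC_def CW_def
    by (rule ex_swap[OF T xE vE C]) (use free dis in \<open>auto simp: xC_def vC_def CW_def\<close>)
  then obtain \<sigma> where \<sigma>: "\<And>c. c \<in> CW \<Longrightarrow> \<sigma> (run T c x) = run T c (Inr v)"
    "\<And>c. c \<in> CW \<Longrightarrow> \<sigma> (run T c (Inr v)) = run T c x" "\<And>z. z \<notin> xC \<union> vC \<Longrightarrow> \<sigma> z = z"
    by blast
  have CWw: "c \<in> words X" if "c \<in> CW" for c using that by (simp add: CW_def)
  have CWapp: "c @ d \<in> CW" if "c \<in> CW" "d \<in> CW" for c d
    using that C by (auto simp: CW_def subgroup.m_closed simp flip: pres_class_mult)
  have CWinv: "word_inv c \<in> CW" if "c \<in> CW" for c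
    using that C word_inv_words[of c X] inv_pres_class[of c X R]
    by (auto simp: CW_def subgroup.m_inv_closed simp flip: inv_pres_class)
  have NilCW: "[] \<in> CW" using subgroup.one_closed[OF C] by (simp add: CW_def one_presented_group)
  have xxC: "x \<in> xC" "Inr v \<in> vC" unfolding xC_def vC_def using NilCW by (auto intro: image_eqI[of _ _ "[]"])
  have supE: "xC \<union> vC \<subseteq> E"
    unfolding xC_def vC_def using run_closed[OF T CWw] xE vE by auto
  have \<sigma>\<sigma>: "\<sigma> (\<sigma> z) = z" for z
    using \<sigma> by (cases "z \<in> xC \<union> vC") (auto simp: xC_def vC_def)
  have \<sigma>E: "\<sigma> z \<in> E" if "z \<in> E" for z
    using \<sigma> that supE run_closed[OF T CWw] xE vE by (cases "z \<in> xC \<union> vC") (auto simp: xC_def vC_def)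
  have \<sigma>bij: "bij_betw \<sigma> E E"
    by (rule bij_betw_byWitness[where f' = \<sigma>]) (use \<sigma>\<sigma> \<sigma>E in auto)
  have \<sigma>c: "\<sigma> (run T c z) = run T c (\<sigma> z)" if c: "c \<in> CW" and z: "z \<in> E" for c z
  proof (cases "z \<in> xC \<union> vC")
    case True
    then obtain d where d: "d \<in> CW" "z = run T d x \<or> z = run T d (Inr v)" by (auto simp: xC_def vC_def)
    then show ?thesis using \<sigma>(1,2)[OF d(1)] \<sigma>(1,2)[OF CWapp[OF d(1) c]] by auto
  next
    case False
    have "run T c z \<notin> xC \<union> vC"
    proof
      assume "run T c z \<in> xC \<union> vC"
      then obtain d where d: "d \<in> CW" "run T c z = run T d x \<or> run T c z = run T d (Inr v)"
        by (auto simp: xC_def vC_def)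
      have "z = run T (word_inv c) (run T c z)" using run_word_inv(1)[OF T CWw[OF c] z] by simp
      then have "z = run T (d @ word_inv c) x \<or> z = run T (d @ word_inv c) (Inr v)" using d(2) by auto
      then show False using False CWapp[OF d(1) CWinv[OF c]] unfolding xC_def vC_def by blast
    qed
    then show ?thesis using \<sigma>(3) False by simp
  qed
  define T' where "T' = twist T T E \<sigma>"
  have eqv: "\<sigma> (run T (rep1 a) z) = run T (rep2 a) (\<sigma> z)" if a: "a \<in> carrier A" and z: "z \<in> E" for a z
  proof -
    note r = rep1_eq_rep2[OF a]
    have "cls (rep1 a) = cls (rep2 a)" using r pres_class_eq_iff[OF words1[OF rep1[OF a]]] by blast
    then have "cls (rep1 a) \<in> C" using rep1[OF a] rep2[OF a] unfolding C_def U1_def U2_def by auto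
    then have "rep1 a \<in> CW" using words1[OF rep1[OF a]] by (simp add: CW_def)
    then show ?thesis using \<sigma>c[OF _ z] run_pres_eq[OF T r \<sigma>E[OF z]] by simp
  qed
  have T': "acts X R T' E"
    unfolding T'_def by (rule acts_twist[OF acts_factors[OF T] \<sigma>bij eqv])
  have T'1: "run T' u z = run T u z" if "u \<in> words X1" for u z
    unfolding T'_def by (rule twist1[OF that])
  have T'2: "run T' u z = \<sigma> (run T u (\<sigma> z))" if "u \<in> words X2" "z \<in> E" for u z
    using twist2[OF acts_factors(2)[OF T] \<sigma>bij that, of T] \<sigma>\<sigma> unfolding T'_def by metis
  have step: "run T' u z = run T u z"
    if "u \<in> words X1 \<union> words X2" "z \<in> E" "z \<notin> xC \<union> vC" "run T u z \<notin> xC \<union> vC" for u z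
    using that T'1 T'2 \<sigma>(3) by auto
  have path: "run T' u z = run T u z"
    if u: "u \<in> words X" and z: "z \<in> E" and off: "\<And>i. i \<le> length u \<Longrightarrow> run T (take i u) z \<notin> xC \<union> vC" for u z
  proof -
    have "run T' (take i u) z = run T (take i u) z" if "i \<le> length u" for i
      using that
    proof (induction i)
      case (Suc i)
      have "set u \<subseteq> letters X" using u by (simp add: words_def lists_eq_set)
      then have "u ! i \<in> letters X" using Suc(2) nth_mem[of i u] by (meson Suc_le_lessD subsetD)
      then have l: "[u ! i] \<in> words X1 \<union> words X2" by (simp add: letters_Un)
      have t: "take (Suc i) u = take i u @ [u ! i]" using Suc(2) by (simp add: take_Suc_conv_app_nth)
      have "run T' [u ! i] (run T (take i u) z) = run T [u ! i] (run T (take i u) z)"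
        using step[OF l run_closed[OF T words_take[OF u] z] off[of i]] off[of "Suc i"] Suc(2) t by simp
      then show ?case using Suc t by simp
    qed simp
    from this[of "length u"] show ?thesis by simp
  qed
  have offP: "Inl (K, z) \<notin> xC \<union> vC" if "K \<in> P0" for K z
  proof
    assume "Inl (K, z) \<in> xC \<union> vC"
    then obtain d where "d \<in> C" "K = K1 #>\<^bsub>G\<^esub> d" using xCL vCR by blast
    then show False using PC[OF K1G] that K1 by simp
  qed
  have stay: "run T' u (Inl (H, z)) = run T u (Inl (H, z))"
    if u: "u \<in> set hs" and z: "z \<in> \<Omega>" for u z
  proof (rule path[OF _ b0E[OF z]])
    show uw: "u \<in> words X" using u hs by auto
    fix i
    have "take i u \<in> V" using take_in_prefixes_of[OF u] by (simp add: V_def)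
    then show "run T (take i u) (Inl (H, z)) \<notin> xC \<union> vC"
      using rL[OF words_take[OF uw]] offP[OF VP] by simp
  qed
  \<comment> \<open>For inverses: \<open>H\<close> permutes the base points in the old action, so an inverse image is a base point too.\<close>
  have fixH: "H #>\<^bsub>G\<^esub> g = H" if "g \<in> H" for g
    using G.coset_join2[OF subgroup.mem_carrier[OF H that] H that] .
  have base: "run T u (Inl (H, z)) = Inl (H, run S u z)" "run S u z \<in> \<Omega>"
    if "u \<in> words X" "cls u \<in> H" "z \<in> \<Omega>" for u z
    using rL[OF that(1)] fixH[OF that(2)] run_closed[OF S that(1,3)] by auto
  have same: "run T' u (Inl (H, z)) = run T u (Inl (H, z))"
    if "g \<in> generate G (cls ` set hs)" "u \<in> words X" "cls u = g" "z \<in> \<Omega>" for g u z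
    using that
  proof (induction arbitrary: u z rule: generate.induct)
    case one
    then have "pres_eq X R u []" by (simp add: one_presented_group pres_class_eq_iff)
    then show ?case using run_pres_eq[OF T _ b0E[OF one(3)], of u "[]"]
        run_pres_eq[OF T' _ b0E[OF one(3)], of u "[]"] by simp
  next
    case (incl h)
    then obtain w where w: "w \<in> set hs" "h = cls w" by auto
    then have "pres_eq X R u w" using incl by (simp add: pres_class_eq_iff)
    then show ?case using run_pres_eq[OF T _ b0E[OF incl(4)], of u w]
        run_pres_eq[OF T' _ b0E[OF incl(4)], of u w] stay[OF w(1) incl(4)] by simp
  next
    case (inv h)
    then obtain w where w: "w \<in> set hs" "h = cls w" by auto
    have ww: "w \<in> words X" using w hs by auto
    have "pres_eq X R u (word_inv w)" using inv w ww by (simp add: inv_pres_class pres_class_eq_iff)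
    then have e: "run T u (Inl (H, z)) = run T (word_inv w) (Inl (H, z))"
      "run T' u (Inl (H, z)) = run T' (word_inv w) (Inl (H, z))"
      using run_pres_eq[OF T _ b0E[OF inv(4)]] run_pres_eq[OF T' _ b0E[OF inv(4)]] by auto
    have "cls w \<in> H" using subgroup_of_words_incl[OF w(1)] by (simp add: H_def)
    then have iH: "cls (word_inv w) \<in> H"
      using subgroup.m_inv_closed[OF H] inv_pres_class[OF ww, of R] by metis
    obtain z' where z': "run T (word_inv w) (Inl (H, z)) = Inl (H, z')" "z' \<in> \<Omega>"
      using base[OF word_inv_words[OF ww] iH inv(4)] by auto
    have "Inl (H, z) = run T w (Inl (H, z'))" using run_word_inv(2)[OF T ww b0E[OF inv(4)]] z' by simp
    also have "\<dots> = run T' w (Inl (H, z'))" using stay[OF w(1) z'(2)] by simp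
    finally have "run T' (word_inv w) (Inl (H, z)) = Inl (H, z')"
      using run_word_inv(1)[OF T' ww b0E[OF z'(2)]] by simp
    then show ?case using e z' by simp
  next
    case (eng g h)
    have gh: "g \<in> H" "h \<in> H" using eng(1,2) by (simp_all add: H_def subgroup_of_words_def)
    obtain s t where st: "s \<in> words X" "t \<in> words X" "cls s = g" "cls t = h"
      using cw[OF subgroup.mem_carrier[OF H gh(1)]] cw[OF subgroup.mem_carrier[OF H gh(2)]] by blast
    then have "cls u = cls (s @ t)" using eng(6) pres_class_mult[OF st(1,2), of R] by simp
    then have "pres_eq X R u (s @ t)" using pres_class_eq_iff[OF eng(5)] by blast
    then have e: "run T u (Inl (H, z)) = run T (s @ t) (Inl (H, z))"
      "run T' u (Inl (H, z)) = run T' (s @ t) (Inl (H, z))"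
      using run_pres_eq[OF T _ b0E[OF eng(7)]] run_pres_eq[OF T' _ b0E[OF eng(7)]] by blast+
    show ?case
      using e eng(3)[OF st(1,3) eng(7)] base[OF st(1) _ eng(7)] st gh eng(4)[OF st(2,4)] by simp
  qed
  have "run T' y1 (Inl (H, o0)) = run T y1 (Inl (H, o0))"
  proof (rule path[OF y1 b0E[OF o0]])
    fix k
    have "H #>\<^bsub>G\<^esub> cls (take k y1) \<in> P0"
      using before[of "min k j"] j by (simp add: y1_def)
    then show "run T (take k y1) (Inl (H, o0)) \<notin> xC \<union> vC"
      using rL[OF words_take[OF y1]] offP by simp
  qed
  moreover have pE: "run T y1 (Inl (H, o0)) \<in> E" by (rule run_closed[OF T y1 b0E[OF o0]])
  moreover have poff: "run T y1 (Inl (H, o0)) \<notin> xC \<union> vC"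
    using rL[OF y1] offP before[of j] j by (simp add: y1_def)
  moreover have "run T [l] (run T y1 (Inl (H, o0))) = x" by (simp add: x_def)
  ultimately have reach0: "run T' (y1 @ [l]) (Inl (H, o0)) = (if fst l \<in> X1 then x else Inr v)"
    using T'1[of "[l]"] T'2[of "[l]", OF _ pE] \<sigma>(3)[OF poff] \<sigma>(1)[OF NilCW] l
    by (auto simp: letters_def)
  have offv: "Inr (v \<otimes>\<^bsub>G\<^esub> g) \<notin> xC \<union> vC" if "g \<in> carrier G" "g \<notin> C" for g
  proof
    assume "Inr (v \<otimes>\<^bsub>G\<^esub> g) \<in> xC \<union> vC"
    then obtain d where "d \<in> C" "v \<otimes>\<^bsub>G\<^esub> g = v \<otimes>\<^bsub>G\<^esub> d" using xCL vCR by blast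
    then show False using that Cs vG by simp
  qed
  have syl: "\<exists>u\<in>words X1 \<union> words X2. cls u = s" if "s \<in> set ss" for s
    using that ss(2) unfolding U1_def U2_def by auto
  have reach: "\<exists>t\<in>words X. run T' t (Inl (H, o0)) = Inr (v \<otimes>\<^bsub>G\<^esub> G.product (take (Suc k) ss))"
    if "k < length ss" for k
    using that
  proof (induction k)
    case 0
    define s where "s = hd ss"
    have t: "take (Suc 0) ss = [s]" using ss(1) by (cases ss) (auto simp: s_def)
    have sG: "s \<in> carrier G" using ssG ss(1) by (auto simp: s_def)
    have "s \<notin> C" using ss(4)[of 1] 0 t sG by simp
    then have off: "Inr (v \<otimes>\<^bsub>G\<^esub> s) \<notin> xC \<union> vC" using offv sG by blast
    show ?case
    proof (cases "fst l \<in> X1")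
      case True
      then obtain u where u: "u \<in> words X2" "cls u = s" using ss(3) by (auto simp: s_def U2_def)
      have "run T' u x = \<sigma> (run T u (Inr v))" using T'2[OF u(1) xE] \<sigma>(1)[OF NilCW] by simp
      also have "\<dots> = Inr (v \<otimes>\<^bsub>G\<^esub> s)" using rR[OF words2[OF u(1)] vG] u(2) \<sigma>(3)[OF off] by simp
      finally show ?thesis using reach0 True t sG y1l words2[OF u(1)]
        by (intro bexI[of _ "(y1 @ [l]) @ u"]) auto
    next
      case False
      then obtain u where u: "u \<in> words X1" "cls u = s" using ss(3) by (auto simp: s_def U1_def)
      have "run T' u (Inr v) = Inr (v \<otimes>\<^bsub>G\<^esub> s)"
        using T'1[OF u(1)] rR[OF words1[OF u(1)] vG] u(2) by simp
      then show ?thesis using reach0 False t sG y1l words1[OF u(1)]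
        by (intro bexI[of _ "(y1 @ [l]) @ u"]) auto
    qed
  next
    case (Suc k)
    then obtain t where t: "t \<in> words X" "run T' t (Inl (H, o0)) = Inr (v \<otimes>\<^bsub>G\<^esub> G.product (take (Suc k) ss))"
      by auto
    let ?p = "G.product (take (Suc k) ss)" and ?q = "G.product (take (Suc (Suc k)) ss)"
    define s where "s = ss ! Suc k"
    have s: "s \<in> set ss" "s \<in> carrier G" using Suc(2) ssG by (auto simp: s_def)
    have q: "?q = ?p \<otimes>\<^bsub>G\<^esub> s"
      using Suc(2) s G.product_append[of "take (Suc k) ss" "[s]"] set_take_subset[of "Suc k" ss] ssG
      by (simp add: s_def take_Suc_conv_app_nth subset_iff)
    obtain u where u: "u \<in> words X1 \<union> words X2" "cls u = s" using syl[OF s(1)] by auto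
    then have uX: "u \<in> words X" using words1 words2 by auto
    have r: "run T u (Inr (v \<otimes>\<^bsub>G\<^esub> ?p)) = Inr (v \<otimes>\<^bsub>G\<^esub> ?q)"
      using rR[OF uX] vG pG u(2) s q by (simp add: G.m_assoc)
    have "run T' u (Inr (v \<otimes>\<^bsub>G\<^esub> ?p)) = Inr (v \<otimes>\<^bsub>G\<^esub> ?q)"
      using step[OF u(1), of "Inr (v \<otimes>\<^bsub>G\<^esub> ?p)"] r offv[OF pG ss(4)] Suc(2) vG pG by (simp add: E_def)
    then show ?case using t uX by (intro bexI[of _ "t @ u"]) auto
  qed
  have "v \<otimes>\<^bsub>G\<^esub> G.product ss = \<one>\<^bsub>G\<^esub>" using pG' by (simp add: v_def)
  moreover have "length ss - 1 < length ss" "take (Suc (length ss - 1)) ss = ss" using ss(1) by auto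
  ultimately obtain t where t: "t \<in> words X" "run T' t (Inl (H, o0)) = Inr \<one>\<^bsub>G\<^esub>"
    using reach by metis
  define n1 where "n1 = t @ n0 @ word_inv t"
  have ti: "word_inv t \<in> words X" using t(1) word_inv_words by blast
  have n1: "n1 \<in> words X" using t n0 ti by (simp add: n1_def)
  have "cls n1 = cls t \<otimes>\<^bsub>G\<^esub> cls n0 \<otimes>\<^bsub>G\<^esub> inv\<^bsub>G\<^esub> (cls t)"
    using t(1) n0(1) ti by (simp add: n1_def inv_pres_class pres_class_mult)
  then have n1H: "cls n1 \<in> H"
    using normal.inv_op_closed2[OF N cc[OF t(1)] n0(2)] by (simp add: H_def)
  have "run S n1 o0 = o0"
    using n0(3)[OF run_closed[OF S t(1) o0]] run_word_inv(1)[OF S t(1) o0] by (simp add: n1_def)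
  then have "run T' n1 (Inl (H, o0)) = Inl (H, o0)"
    using same[OF _ n1 refl o0] base(1)[OF n1 n1H o0] n1H by (simp add: H_def subgroup_of_words_def)
  then have "run T' (word_inv t) (run T' n0 (Inr \<one>\<^bsub>G\<^esub>)) = Inl (H, o0)" using t(2) by (simp add: n1_def)
  moreover have oneE: "Inr \<one>\<^bsub>G\<^esub> \<in> E" by (simp add: E_def)
  ultimately have "run T' n0 (Inr \<one>\<^bsub>G\<^esub>) = Inr \<one>\<^bsub>G\<^esub>"
    using run_word_inv(2)[OF T' t(1) run_closed[OF T' n0(1) oneE]] t(2) by simp
  moreover have "run T' n0 (Inr \<one>\<^bsub>G\<^esub>) = run T n0 (Inr \<one>\<^bsub>G\<^esub>)"
  proof (rule path[OF n0(1) oneE])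
    fix i assume i: "i \<le> length n0"
    let ?u = "take i n0"
    have uG: "cls ?u \<in> carrier G" using cc words_take n0(1) by blast
    show "run T ?u (Inr \<one>\<^bsub>G\<^esub>) \<notin> xC \<union> vC"
    proof
      assume "run T ?u (Inr \<one>\<^bsub>G\<^esub>) \<in> xC \<union> vC"
      then obtain d where d: "d \<in> C" "cls ?u = v \<otimes>\<^bsub>G\<^esub> d"
        using xCL vCR rR[OF words_take[OF n0(1)]] uG by fastforce
      have dG: "d \<in> carrier G" using Cs d(1) .
      have "inv\<^bsub>G\<^esub> d \<otimes>\<^bsub>G\<^esub> G.product ss = inv\<^bsub>G\<^esub> (cls ?u)"
        using d(2) dG pG' by (simp add: v_def G.inv_mult_group)
      moreover have "inv\<^bsub>G\<^esub> (cls ?u) \<in> F" using i by (auto simp: F_def)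
      ultimately show False using ss(5)[OF subgroup.m_inv_closed[OF C d(1)]] by simp
    qed
  qed
  ultimately have "cls n0 = \<one>\<^bsub>G\<^esub>" using rR[OF n0(1) G.one_closed] cc[OF n0(1)] by simp
  then show ?thesis using n0(1) by (simp add: one_presented_group pres_class_eq_iff)
qed

text \<open>By the preceding lemma such a subgroup acts faithfully on \<open>\<Omega>\<close>.\<close>

lemma normal_infinite_index_finite:
  assumes hs: "hs \<in> lists (words X)" and N: "subgroup_of_words X R hs \<lhd> G"
    and infG: "infinite (carrier G)" and index: "infinite (rcosets\<^bsub>G\<^esub> (subgroup_of_words X R hs))"
  shows "finite (subgroup_of_words X R hs)" "card (subgroup_of_words X R hs) \<le> card (\<Omega> \<rightarrow>\<^sub>E \<Omega>)"
proof -
  interpret G: group G by (rule group_presented_group)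
  define H where "H = subgroup_of_words X R hs"
  have H: "subgroup H G" unfolding H_def by (rule subgroup_of_words[OF hs])
  note HG = subgroup.mem_carrier[OF H]
  define f where "f = (\<lambda>g. restrict (run S (pick g)) \<Omega>)"
  have fin: "finite (\<Omega> \<rightarrow>\<^sub>E \<Omega>)" using \<Omega>(1) by (simp add: finite_PiE)
  have sub: "f ` H \<subseteq> \<Omega> \<rightarrow>\<^sub>E \<Omega>"
    using run_closed[OF S pick(1)[OF HG]] by (auto simp: f_def)
  have inj: "inj_on f H"
  proof (rule inj_onI)
    fix g h assume gh: "g \<in> H" "h \<in> H" "f g = f h"
    note pg = pick[OF HG[OF gh(1)]] and ph = pick[OF HG[OF gh(2)]]
    let ?n = "pick g @ word_inv (pick h)"
    have n: "?n \<in> words X" using pg ph word_inv_words by simp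
    have cl: "cls ?n = g \<otimes>\<^bsub>G\<^esub> inv\<^bsub>G\<^esub> h"
      using pg ph inv_pres_class[OF ph(1), of R] word_inv_words[OF ph(1)] pres_class_mult[OF pg(1), of "word_inv (pick h)" R]
      by simp
    then have "cls ?n \<in> H" using gh H by (simp add: subgroup.m_closed subgroup.m_inv_closed)
    moreover have "run S ?n y = y" if y: "y \<in> \<Omega>" for y
    proof -
      have "f g y = f h y" using gh(3) by simp
      then have "run S (pick g) y = run S (pick h) y" using y by (simp add: f_def)
      then show ?thesis using run_word_inv(1)[OF S ph(1) y] by simp
    qed
    ultimately have "pres_eq X R ?n []"
      using normal_infinite_index_trivial[OF hs N infG index n] by (simp add: H_def)
    then have "cls ?n = cls []" using pres_class_eq_iff[OF n] by blast
    then have "g \<otimes>\<^bsub>G\<^esub> inv\<^bsub>G\<^esub> h = \<one>\<^bsub>G\<^esub>"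
      unfolding cl one_presented_group .
    then show "g = h" using HG[OF gh(1)] HG[OF gh(2)] by (metis G.inv_closed G.inv_equality G.inv_inv)
  qed
  show "finite (subgroup_of_words X R hs)"
    using inj_on_finite[OF inj sub fin] by (simp add: H_def)
  show "card (subgroup_of_words X R hs) \<le> card (\<Omega> \<rightarrow>\<^sub>E \<Omega>)"
    using card_inj_on_le[OF inj sub fin] by (simp add: H_def)
qed

lemma finite_subgroup_of_words:
  assumes D: "subgroup D G" "finite D"
  shows "\<exists>ds\<in>lists (words X). D = subgroup_of_words X R ds"
proof -
  interpret G: group G by (rule group_presented_group)
  obtain gs where gs: "set gs = D" using finite_list[OF D(2)] by auto
  note DG = subgroup.mem_carrier[OF D(1)]
  let ?ds = "map pick gs"
  have "cls ` set ?ds = D" using gs pick(2)[OF DG] by (force simp: image_iff)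
  moreover have "generate G D = D"
    using G.generate_subgroup_incl[OF subset_refl D(1)] generate.incl[of _ D G] by blast
  ultimately have "D = subgroup_of_words X R ?ds" by (simp add: subgroup_of_words_def)
  moreover have "?ds \<in> lists (words X)" using gs pick(1)[OF DG] by auto
  ultimately show ?thesis by blast
qed

lemma infinite_index_of_finite_subgroup:
  assumes infG: "infinite (carrier G)" and D: "subgroup D G" "finite D"
  shows "infinite (rcosets\<^bsub>G\<^esub> D)"
proof
  interpret G: group G by (rule group_presented_group)
  assume fin: "finite (rcosets\<^bsub>G\<^esub> D)"
  have "finite K" if "K \<in> rcosets\<^bsub>G\<^esub> D" for K
    using that D(2) by (auto simp: RCOSETS_def r_coset_def)
  then have "finite (\<Union>(rcosets\<^bsub>G\<^esub> D))" using fin by blast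
  then show False using G.rcosets_part_G[OF D(1)] infG by simp
qed

text \<open>Finite normal subgroups of the infinite group \<open>G\<close> have infinite index, so their orders are
  bounded by the preceding lemmas.  The product of two of them is again one, hence one of maximal order
  contains all the others; \<open>ds\<close> generates it.  A finitely generated normal subgroup has infinite index exactly if it is
  finite, that is, if it is contained in that largest one.\<close>

lemma ex_largest_finite_normal:
  assumes infG: "infinite (carrier G)"
  shows "\<exists>ds\<in>lists (words X). \<forall>hs\<in>lists (words X). subgroup_of_words X R hs \<lhd> G \<longrightarrow>
    (finite (rcosets\<^bsub>G\<^esub> (subgroup_of_words X R hs)) \<longleftrightarrow>
     \<not> (\<forall>u\<in>set hs. cls u \<in> subgroup_of_words X R ds))"
proof -
  interpret G: group G by (rule group_presented_group)
  define P where "P = (\<lambda>D. D \<lhd> G \<and> finite D)"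
  have bound: "card D \<le> card (\<Omega> \<rightarrow>\<^sub>E \<Omega>)" if "P D" for D
  proof -
    have D: "subgroup D G" "finite D" using that by (auto simp: P_def normal_imp_subgroup)
    obtain ds where "ds \<in> lists (words X)" "D = subgroup_of_words X R ds"
      using finite_subgroup_of_words[OF D] by blast
    then show ?thesis
      using normal_infinite_index_finite(2) infG infinite_index_of_finite_subgroup[OF infG D] that by (simp add: P_def)
  qed
  have "P {\<one>\<^bsub>G\<^esub>}" by (simp add: P_def G.one_is_normal)
  then obtain D where D: "P D" "\<And>D'. P D' \<Longrightarrow> card D' \<le> card D"
    using ex_has_greatest_nat[of P _ card "Suc (card (\<Omega> \<rightarrow>\<^sub>E \<Omega>))"] bound by (metis less_Suc_eq_le)
  have Dsub: "subgroup D G" "finite D" using D(1) by (auto simp: P_def normal_imp_subgroup)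
  have largest: "D' \<subseteq> D" if "P D'" for D'
  proof -
    have D': "subgroup D' G" "finite D'" using that by (auto simp: P_def normal_imp_subgroup)
    let ?M = "D <#>\<^bsub>G\<^esub> D'"
    have "?M = (\<lambda>(g, h). g \<otimes>\<^bsub>G\<^esub> h) ` (D \<times> D')" by (auto simp: set_mult_def)
    then have fM: "finite ?M" using Dsub(2) D'(2) by simp
    moreover have "?M \<lhd> G" using G.normal_subgroup_set_mult_closed D(1) that by (simp add: P_def)
    ultimately have le: "card ?M \<le> card D" using D(2) by (simp add: P_def)
    have "g \<in> ?M" if "g \<in> D" for g
    proof -
      have "g \<otimes>\<^bsub>G\<^esub> \<one>\<^bsub>G\<^esub> \<in> ?M"
        using subgroup.one_closed[OF D'(1)] that unfolding set_mult_def by blast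
      then show ?thesis using subgroup.mem_carrier[OF Dsub(1) that] by simp
    qed
    then have "D = ?M" using card_seteq[OF fM _ le] by blast
    moreover have "h \<in> ?M" if "h \<in> D'" for h
    proof -
      have "\<one>\<^bsub>G\<^esub> \<otimes>\<^bsub>G\<^esub> h \<in> ?M"
        using subgroup.one_closed[OF Dsub(1)] that unfolding set_mult_def by blast
      then show ?thesis using subgroup.mem_carrier[OF D'(1) that] by simp
    qed
    ultimately show ?thesis by blast
  qed
  obtain ds where ds: "ds \<in> lists (words X)" "D = subgroup_of_words X R ds"
    using finite_subgroup_of_words[OF Dsub] by blast
  have "finite (rcosets\<^bsub>G\<^esub> (subgroup_of_words X R hs)) \<longleftrightarrow> \<not> (\<forall>u\<in>set hs. cls u \<in> D)"
    if hs: "hs \<in> lists (words X)" and N: "subgroup_of_words X R hs \<lhd> G" for hs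
  proof
    assume fin: "finite (rcosets\<^bsub>G\<^esub> (subgroup_of_words X R hs))"
    show "\<not> (\<forall>u\<in>set hs. cls u \<in> D)"
    proof
      assume "\<forall>u\<in>set hs. cls u \<in> D"
      then have "subgroup_of_words X R hs \<subseteq> D"
        unfolding subgroup_of_words_def using G.generate_subgroup_incl[OF _ Dsub(1)] by blast
      then have "finite (subgroup_of_words X R hs)" using Dsub(2) finite_subset by blast
      then show False using infinite_index_of_finite_subgroup[OF infG subgroup_of_words[OF hs]] fin by blast
    qed
  next
    assume nD: "\<not> (\<forall>u\<in>set hs. cls u \<in> D)"
    show "finite (rcosets\<^bsub>G\<^esub> (subgroup_of_words X R hs))"
    proof (rule ccontr)
      assume "infinite (rcosets\<^bsub>G\<^esub> (subgroup_of_words X R hs))"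
      then have "P (subgroup_of_words X R hs)"
        using normal_infinite_index_finite(1)[OF hs N infG] N by (simp add: P_def)
      then show False using largest subgroup_of_words_incl nD by blast
    qed
  qed
  then show ?thesis using ds by blast
qed

text \<open>Both letters of a generator occur among the conjugating letters, and conjugation by a word is a
  composition of conjugations by letters.\<close>

lemma normal_iff:
  assumes hs: "hs \<in> lists (words X)"
  shows "subgroup_of_words X R hs \<lhd> G \<longleftrightarrow>
    (\<forall>l\<in>letters X. \<forall>u\<in>set hs. cls ([l] @ u @ word_inv [l]) \<in> subgroup_of_words X R hs)"
proof -
  interpret G: group G by (rule group_presented_group)
  define H where "H = subgroup_of_words X R hs"
  have H: "subgroup H G" unfolding H_def by (rule subgroup_of_words[OF hs])
  note HG = subgroup.mem_carrier[OF H]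
  have cl: "cls (p @ u @ word_inv p) = cls p \<otimes>\<^bsub>G\<^esub> cls u \<otimes>\<^bsub>G\<^esub> inv\<^bsub>G\<^esub> (cls p)"
    if "p \<in> words X" "u \<in> words X" for p u
    using that word_inv_words[OF that(1)] pres_class_mult[of "p" X "u" R] pres_class_mult[of "p @ u" X "word_inv p" R]
    by (simp add: inv_pres_class)
  show ?thesis
    unfolding H_def[symmetric]
  proof
    assume N: "H \<lhd> G"
    show "\<forall>l\<in>letters X. \<forall>u\<in>set hs. cls ([l] @ u @ word_inv [l]) \<in> H"
    proof (intro ballI)
      fix l u assume lu: "l \<in> letters X" "u \<in> set hs"
      then have w: "[l] \<in> words X" "u \<in> words X" using hs by auto
      show "cls ([l] @ u @ word_inv [l]) \<in> H"
        unfolding cl[OF w]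
        by (rule normal.inv_op_closed2[OF N pres_class_in_carrier[OF w(1)]])
          (use subgroup_of_words_incl[OF lu(2)] in \<open>simp add: H_def\<close>)
    qed
  next
    assume a: "\<forall>l\<in>letters X. \<forall>u\<in>set hs. cls ([l] @ u @ word_inv [l]) \<in> H"
    have letter: "cls [l] \<otimes>\<^bsub>G\<^esub> h \<otimes>\<^bsub>G\<^esub> inv\<^bsub>G\<^esub> (cls [l]) \<in> H"
      if l: "l \<in> letters X" and h: "h \<in> generate G (cls ` set hs)" for l h
    proof -
      have lw: "[l] \<in> words X" using l by simp
      note lG = pres_class_in_carrier[OF lw, of R]
      have inH: "g \<in> H" if "g \<in> generate G (cls ` set hs)" for g
        using that by (simp add: H_def subgroup_of_words_def)
      show ?thesis
        using h
      proof induction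
        case one
        show ?case using lG subgroup.one_closed[OF H] by simp
      next
        case (incl g)
        then obtain u where u: "u \<in> set hs" "g = cls u" by auto
        then have uw: "u \<in> words X" using hs by auto
        have "cls ([l] @ u @ word_inv [l]) \<in> H" using a l u by blast
        then show ?case unfolding cl[OF lw uw] u(2) .
      next
        case (inv g)
        then obtain u where u: "u \<in> set hs" "g = cls u" by auto
        then have uw: "u \<in> words X" using hs by auto
        have "cls ([l] @ u @ word_inv [l]) \<in> H" using a l u by blast
        then have "cls [l] \<otimes>\<^bsub>G\<^esub> g \<otimes>\<^bsub>G\<^esub> inv\<^bsub>G\<^esub> (cls [l]) \<in> H" unfolding cl[OF lw uw] u(2) .
        then have "inv\<^bsub>G\<^esub> (cls [l] \<otimes>\<^bsub>G\<^esub> g \<otimes>\<^bsub>G\<^esub> inv\<^bsub>G\<^esub> (cls [l])) \<in> H"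
          by (rule subgroup.m_inv_closed[OF H])
        moreover have "g \<in> carrier G" using u uw pres_class_in_carrier by blast
        ultimately show ?case using lG by (simp add: G.inv_mult_group G.m_assoc)
      next
        case (eng g h)
        have gh: "g \<in> carrier G" "h \<in> carrier G" using eng(1,2) inH HG by auto
        have "cls [l] \<otimes>\<^bsub>G\<^esub> (g \<otimes>\<^bsub>G\<^esub> h) \<otimes>\<^bsub>G\<^esub> inv\<^bsub>G\<^esub> (cls [l]) =
          (cls [l] \<otimes>\<^bsub>G\<^esub> g \<otimes>\<^bsub>G\<^esub> inv\<^bsub>G\<^esub> (cls [l])) \<otimes>\<^bsub>G\<^esub> (cls [l] \<otimes>\<^bsub>G\<^esub> h \<otimes>\<^bsub>G\<^esub> inv\<^bsub>G\<^esub> (cls [l]))"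
          using gh lG by (simp add: G.m_assoc G.inv_solve_left')
            (simp flip: G.m_assoc)
        then show ?case using eng(3,4) subgroup.m_closed[OF H] by simp
      qed
    qed
    have word: "cls w \<otimes>\<^bsub>G\<^esub> h \<otimes>\<^bsub>G\<^esub> inv\<^bsub>G\<^esub> (cls w) \<in> H" if "w \<in> words X" "h \<in> H" for w h
      using that
    proof (induction w)
      case Nil
      then show ?case using HG[OF Nil(2)] by (simp flip: one_presented_group)
    next
      case (Cons l w)
      then have lw: "[l] \<in> words X" "w \<in> words X" by auto
      have e: "cls (l # w) = cls [l] \<otimes>\<^bsub>G\<^esub> cls w" using pres_class_mult[OF lw, of R] by simp
      have "cls w \<otimes>\<^bsub>G\<^esub> h \<otimes>\<^bsub>G\<^esub> inv\<^bsub>G\<^esub> (cls w) \<in> H" using Cons by simp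
      then have "cls [l] \<otimes>\<^bsub>G\<^esub> (cls w \<otimes>\<^bsub>G\<^esub> h \<otimes>\<^bsub>G\<^esub> inv\<^bsub>G\<^esub> (cls w)) \<otimes>\<^bsub>G\<^esub> inv\<^bsub>G\<^esub> (cls [l]) \<in> H"
        using letter Cons(2) by (simp add: H_def subgroup_of_words_def)
      then show ?case
        using e HG[OF Cons(3)] pres_class_in_carrier[OF lw(1), of R] pres_class_in_carrier[OF lw(2), of R]
        by (simp add: G.inv_mult_group G.m_assoc)
    qed
    show "H \<lhd> G"
    proof (rule G.normal_invI[OF H])
      fix x h assume "x \<in> carrier G" "h \<in> H"
      then show "x \<otimes>\<^bsub>G\<^esub> h \<otimes>\<^bsub>G\<^esub> inv\<^bsub>G\<^esub> x \<in> H" using word by (metis in_carrier_pres_class)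
    qed
  qed
qed

end

section \<open>Computable functions\<close>

text \<open>The inputs \<open>x\<close> are of any type; the program is given the numbers \<open>v x\<close> for \<open>v\<close> in \<open>vs\<close> as its
  arguments.  The entries of \<open>vs\<close> play the part of variables: a bound variable is a further component of
  the input that is added in front, and inputs may be words or lists known to the program through their codes only.\<close>

definition computable_on :: "'e set \<Rightarrow> ('e \<Rightarrow> nat) list \<Rightarrow> ('e \<Rightarrow> nat) \<Rightarrow> bool" where
  "computable_on D vs F \<longleftrightarrow> (\<exists>f. \<forall>x\<in>D. rec_eval f (map (\<lambda>v. v x) vs) (F x))"

lemma computable_on_cong:
  assumes "computable_on D vs F" "\<And>x. x \<in> D \<Longrightarrow> F x = G x"
  shows "computable_on D vs G"
  using assms unfolding computable_on_def by metis

lemma computable_const: "computable_on D vs (\<lambda>_. n)"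
proof (induction n)
  case 0
  then show ?case unfolding computable_on_def by (blast intro: eval_Zero)
next
  case (Suc n)
  then obtain f where f: "\<forall>x\<in>D. rec_eval f (map (\<lambda>v. v x) vs) n"
    by (auto simp: computable_on_def)
  have "\<forall>x\<in>D. rec_eval (Comp Succ [f]) (map (\<lambda>v. v x) vs) (Suc n)"
    using f by (auto intro!: eval_Comp[where ys="[n]"] eval_Succ)
  then show ?case unfolding computable_on_def by blast
qed

lemma computable_var:
  assumes "v \<in> set vs"
  shows "computable_on D vs v"
proof -
  obtain i where i: "i < length vs" "vs ! i = v"
    using assms by (auto simp: in_set_conv_nth)
  then have "rec_eval (Proj i) (map (\<lambda>v. v x) vs) (v x)" for x
    using eval_Proj[of i "map (\<lambda>v. v x) vs"] by simp
  then show ?thesis unfolding computable_on_def by blast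
qed

text \<open>Substitution: the entries of \<open>us\<close> are the formal parameters, \<open>k\<close> assembles the actual ones.\<close>

lemma computable_comp:
  assumes G: "computable_on D' us G"
    and us: "\<And>u. u \<in> set us \<Longrightarrow> computable_on D vs (\<lambda>x. u (k x))"
    and k: "\<And>x. x \<in> D \<Longrightarrow> k x \<in> D'"
  shows "computable_on D vs (\<lambda>x. G (k x))"
proof -
  obtain g where g: "\<forall>y\<in>D'. rec_eval g (map (\<lambda>v. v y) us) (G y)"
    using G by (auto simp: computable_on_def)
  have "\<forall>u\<in>set us. \<exists>f. \<forall>x\<in>D. rec_eval f (map (\<lambda>v. v x) vs) (u (k x))"
    using us unfolding computable_on_def by blast
  then obtain F where F: "\<forall>u\<in>set us. \<forall>x\<in>D. rec_eval (F u) (map (\<lambda>v. v x) vs) (u (k x))"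
    by metis
  have "rec_eval (Comp g (map F us)) (map (\<lambda>v. v x) vs) (G (k x))" if "x \<in> D" for x
  proof (rule eval_Comp)
    show "list_all2 (\<lambda>g y. rec_eval g (map (\<lambda>v. v x) vs) y) (map F us) (map (\<lambda>v. v (k x)) us)"
      using F that by (auto simp: list_all2_conv_all_nth)
    show "rec_eval g (map (\<lambda>v. v (k x)) us) (G (k x))"
      using g k that by blast
  qed
  then show ?thesis unfolding computable_on_def by blast
qed

lemma computable_unary:
  assumes "computable_on UNIV [\<lambda>a. a] g" "computable_on D vs F"
  shows "computable_on D vs (\<lambda>x. g (F x))"
  by (rule computable_comp[OF assms(1)]) (use assms(2) in auto)

lemma computable_binary:
  assumes "computable_on UNIV [fst, snd] (\<lambda>p. g (fst p) (snd p))"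
    and "computable_on D vs F" "computable_on D vs G"
  shows "computable_on D vs (\<lambda>x. g (F x) (G x))"
proof -
  have "computable_on D vs (\<lambda>x. g (fst (F x, G x)) (snd (F x, G x)))"
    by (rule computable_comp[OF assms(1)]) (use assms(2,3) in auto)
  then show ?thesis by simp
qed

text \<open>Weakening under one binder.\<close>

lemma computable_lift:
  assumes "computable_on D vs F" "D' \<subseteq> UNIV \<times> D"
  shows "computable_on D' (u # map (\<lambda>v y. v (snd y)) vs) (\<lambda>y. F (snd y))"
  by (rule computable_comp[OF assms(1)]) (use assms(2) in \<open>auto intro: computable_var\<close>)

lemma computable_Suc:
  assumes "computable_on D vs F"
  shows "computable_on D vs (\<lambda>x. Suc (F x))"
proof (rule computable_unary[OF _ assms])
  show "computable_on UNIV [\<lambda>a. a] Suc"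
    unfolding computable_on_def by (intro exI[of _ Succ]) (auto intro: eval_Succ)
qed

text \<open>The step needs to be computable below \<open>N\<close> only; this matters for list access, which is
  unspecified beyond the length.\<close>

lemma computable_rec:
  assumes N: "computable_on D vs N" and I: "computable_on D vs I"
    and S: "computable_on {(i, r, x). x \<in> D \<and> i < N x}
      (fst # (\<lambda>y. fst (snd y)) # map (\<lambda>v y. v (snd (snd y))) vs)
      (\<lambda>y. S (fst y) (fst (snd y)) (snd (snd y)))"
  shows "computable_on D vs (\<lambda>x. rec_nat (I x) (\<lambda>i r. S i r x) (N x))"
proof -
  let ?xs = "\<lambda>x. map (\<lambda>v. v x) vs"
  obtain f where f: "\<forall>x\<in>D. rec_eval f (?xs x) (I x)"
    using I by (auto simp: computable_on_def)
  obtain g where g: "\<And>x i r. x \<in> D \<Longrightarrow> i < N x \<Longrightarrow> rec_eval g (i # r # ?xs x) (S i r x)"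
    using S by (auto simp: computable_on_def o_def)
  have run: "rec_eval (Prim f g) (n # ?xs x) (rec_nat (I x) (\<lambda>i r. S i r x) n)"
    if "x \<in> D" "n \<le> N x" for x n
    using that(2)
  proof (induction n)
    case 0
    then show ?case using f that by (auto intro: eval_Prim_0)
  next
    case (Suc n)
    then show ?case using g that by (auto intro!: eval_Prim_Suc)
  qed
  let ?D = "{(n, x). x \<in> D \<and> n \<le> N x}"
  have "computable_on ?D (fst # map (\<lambda>v y. v (snd y)) vs)
      (\<lambda>y. rec_nat (I (snd y)) (\<lambda>i r. S i r (snd y)) (fst y))"
    unfolding computable_on_def
    by (intro exI[of _ "Prim f g"]) (auto simp: o_def intro!: run)
  then have "computable_on D vs (\<lambda>x. (\<lambda>y. rec_nat (I (snd y)) (\<lambda>i r. S i r (snd y)) (fst y)) (N x, x))"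
    by (rule computable_comp) (auto intro: N computable_var)
  then show ?thesis by simp
qed

lemma computable_add:
  assumes "computable_on D vs F" "computable_on D vs G"
  shows "computable_on D vs (\<lambda>x. F x + G x)"
proof -
  have "computable_on D vs (\<lambda>x. rec_nat (G x) (\<lambda>i r. Suc r) (F x))"
    by (rule computable_rec[OF assms]) (intro computable_Suc computable_var, simp)
  moreover have "rec_nat b (\<lambda>i r. Suc r) a = a + b" for a b by (induction a) auto
  ultimately show ?thesis by simp
qed

lemma computable_mult:
  assumes "computable_on D vs F" "computable_on D vs G"
  shows "computable_on D vs (\<lambda>x. F x * G x)"
proof -
  have 1: "computable_on UNIV [fst, snd] (\<lambda>p. rec_nat 0 (\<lambda>i r. r + snd p) (fst p))"
    by (rule computable_rec) (intro computable_add computable_const computable_var; simp)+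
  have 2: "rec_nat 0 (\<lambda>i r. r + b) a = a * b" for a b :: nat by (induction a) auto
  show ?thesis
    by (rule computable_binary[OF _ assms]) (use 1 in \<open>simp add: 2\<close>)
qed

lemma computable_power:
  assumes "computable_on D vs F" "computable_on D vs G"
  shows "computable_on D vs (\<lambda>x. F x ^ G x)"
proof -
  have 1: "computable_on UNIV [fst, snd] (\<lambda>p. rec_nat 1 (\<lambda>i r. r * fst p) (snd p))"
    by (rule computable_rec) (intro computable_mult computable_const computable_var; simp)+
  have 2: "rec_nat 1 (\<lambda>i r. r * a) b = a ^ b" for a b :: nat by (induction b) auto
  show ?thesis
    by (rule computable_binary[OF _ assms]) (use 1 in \<open>simp only: 2\<close>)
qed

lemma computable_pred:
  assumes "computable_on D vs F"
  shows "computable_on D vs (\<lambda>x. F x - 1)"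
proof -
  have 1: "computable_on UNIV [\<lambda>a. a] (\<lambda>a. rec_nat 0 (\<lambda>i r. i) a)"
    by (rule computable_rec) (intro computable_const computable_var; simp)+
  have 2: "rec_nat 0 (\<lambda>i r. i) a = a - 1" for a :: nat by (induction a) auto
  show ?thesis
    by (rule computable_unary[OF _ assms]) (use 1 in \<open>simp only: 2\<close>)
qed

lemma computable_diff:
  assumes "computable_on D vs F" "computable_on D vs G"
  shows "computable_on D vs (\<lambda>x. F x - G x)"
proof -
  have 1: "computable_on UNIV [fst, snd] (\<lambda>p. rec_nat (fst p) (\<lambda>i r. r - 1) (snd p))"
    by (rule computable_rec) (intro computable_pred computable_const computable_var; simp)+
  have 2: "rec_nat a (\<lambda>i r. r - 1) b = a - b" for a b :: nat by (induction b) auto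
  show ?thesis
    by (rule computable_binary[OF _ assms]) (use 1 in \<open>simp only: 2\<close>)
qed

lemma computable_le:
  assumes "computable_on D vs F" "computable_on D vs G"
  shows "computable_on D vs (\<lambda>x. of_bool (F x \<le> G x))"
  by (rule computable_on_cong[where F = "\<lambda>x. 1 - (F x - G x)"])
    (intro computable_diff computable_const assms, auto)

lemma computable_not:
  assumes "computable_on D vs (\<lambda>x. of_bool (P x))"
  shows "computable_on D vs (\<lambda>x. of_bool (\<not> P x))"
  by (rule computable_on_cong[where F = "\<lambda>x. 1 - of_bool (P x)"])
    (intro computable_diff computable_const assms, auto)

lemma computable_conj:
  assumes "computable_on D vs (\<lambda>x. of_bool (P x))" "computable_on D vs (\<lambda>x. of_bool (Q x))"
  shows "computable_on D vs (\<lambda>x. of_bool (P x \<and> Q x))"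
  by (rule computable_on_cong[where F = "\<lambda>x. of_bool (P x) * of_bool (Q x)"])
    (intro computable_mult assms, auto)

lemma computable_imp:
  assumes "computable_on D vs (\<lambda>x. of_bool (P x))" "computable_on D vs (\<lambda>x. of_bool (Q x))"
  shows "computable_on D vs (\<lambda>x. of_bool (P x \<longrightarrow> Q x))"
  by (rule computable_on_cong[where F = "\<lambda>x. of_bool (\<not> (P x \<and> \<not> Q x))"])
    (intro computable_not computable_conj assms, auto)

lemma computable_less:
  assumes "computable_on D vs F" "computable_on D vs G"
  shows "computable_on D vs (\<lambda>x. of_bool (F x < G x))"
  by (rule computable_on_cong[where F = "\<lambda>x. of_bool (Suc (F x) \<le> G x)"])
    (intro computable_le computable_Suc assms, auto)

lemma computable_eq:
  assumes "computable_on D vs F" "computable_on D vs G"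
  shows "computable_on D vs (\<lambda>x. of_bool (F x = G x))"
  by (rule computable_on_cong[where F = "\<lambda>x. of_bool (F x \<le> G x \<and> G x \<le> F x)"])
    (intro computable_le computable_conj assms, auto)

lemma computable_if:
  assumes "computable_on D vs (\<lambda>x. of_bool (P x))" "computable_on D vs F" "computable_on D vs G"
  shows "computable_on D vs (\<lambda>x. if P x then F x else G x)"
  by (rule computable_on_cong[where F = "\<lambda>x. of_bool (P x) * F x + of_bool (\<not> P x) * G x"])
    (intro computable_add computable_mult computable_not assms, auto)

lemma computable_mod:
  assumes "computable_on D vs F" "computable_on D vs G"
  shows "computable_on D vs (\<lambda>x. F x mod G x)"
proof -
  have 1: "computable_on UNIV [fst, snd]
      (\<lambda>p. rec_nat 0 (\<lambda>i r. if Suc r = snd p then 0 else Suc r) (fst p))"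
    by (rule computable_rec)
      (intro computable_if computable_eq computable_Suc computable_const computable_var; simp)+
  have 2: "rec_nat 0 (\<lambda>i r. if Suc r = b then 0 else Suc r) a = a mod b" for a b :: nat
    by (induction a) (auto simp: mod_Suc)
  show ?thesis
    by (rule computable_binary[OF _ assms]) (use 1 in \<open>simp only: 2\<close>)
qed

lemma computable_div:
  assumes "computable_on D vs F" "computable_on D vs G"
  shows "computable_on D vs (\<lambda>x. F x div G x)"
proof -
  have 1: "computable_on UNIV [fst, snd]
      (\<lambda>p. rec_nat 0 (\<lambda>i r. if Suc i mod snd p = 0 then Suc r else r) (fst p))"
    by (rule computable_rec)
      (intro computable_if computable_eq computable_mod computable_Suc computable_const
        computable_var; simp)+
  have 2: "rec_nat 0 (\<lambda>i r. if Suc i mod b = 0 then Suc r else r) a = a div b" for a b :: nat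
    by (induction a) (auto simp: div_Suc)
  show ?thesis
    by (rule computable_binary[OF _ assms]) (use 1 in \<open>simp only: 2\<close>)
qed

lemma computable_sum:
  assumes N: "computable_on D vs N"
    and F: "computable_on {(i, x). x \<in> D \<and> i < N x} (fst # map (\<lambda>v y. v (snd y)) vs)
      (\<lambda>y. F (fst y) (snd y))"
  shows "computable_on D vs (\<lambda>x. \<Sum>i<N x. F i x)"
proof -
  let ?us = "fst # (\<lambda>y. fst (snd y)) # map (\<lambda>v y. v (snd (snd y))) vs"
  let ?E = "{(i, r :: nat, x). x \<in> D \<and> i < N x}"
  have "computable_on ?E ?us
      (\<lambda>y. F (fst (fst y, snd (snd y))) (snd (fst y, snd (snd y))))"
    by (rule computable_comp[OF F]) (auto intro: computable_var)
  then have "computable_on ?E ?us (\<lambda>y. fst (snd y) + F (fst y) (snd (snd y)))"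
    by (intro computable_add) (auto intro: computable_var)
  then have "computable_on D vs (\<lambda>x. rec_nat 0 (\<lambda>i r. r + F i x) (N x))"
    by (intro computable_rec N computable_const)
  moreover have "rec_nat 0 (\<lambda>i r. r + f i) n = sum f {..<n}" for f :: "nat \<Rightarrow> nat" and n
    by (induction n) auto
  ultimately show ?thesis by simp
qed

lemma computable_all_less:
  assumes N: "computable_on D vs N"
    and P: "computable_on {(i, x). x \<in> D \<and> i < N x} (fst # map (\<lambda>v y. v (snd y)) vs)
      (\<lambda>y. of_bool (P (fst y) (snd y)))"
  shows "computable_on D vs (\<lambda>x. of_bool (\<forall>i<N x. P i x))"
proof -
  have "computable_on D vs (\<lambda>x. of_bool ((\<Sum>i<N x. of_bool (\<not> P i x) :: nat) = 0))"
    by (intro computable_eq computable_sum N computable_const computable_not P)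
  then show ?thesis
    by (rule computable_on_cong) (auto simp: Bex_def)
qed

section \<open>Computing with codes of lists\<close>

lemma computable_prod_encode:
  assumes "computable_on D vs F" "computable_on D vs G"
  shows "computable_on D vs (\<lambda>x. prod_encode (F x, G x))"
proof (rule computable_binary[OF _ assms])
  show "computable_on UNIV [fst, snd] (\<lambda>p. prod_encode (fst p, snd p))"
    unfolding prod_encode_def triangle_def split_conv
    by (intro computable_add computable_div computable_mult computable_Suc computable_const
        computable_var) simp_all
qed

lemma le_prod_encode: "a + b \<le> prod_encode (a, b)"
proof -
  have "n \<le> triangle n" for n by (induction n) auto
  from this[of "a + b"] show ?thesis by (simp add: prod_encode_def)
qed

lemma sum_prod_encode:
  assumes "prod_encode (a, b) < m"
  shows "(\<Sum>i<m. \<Sum>j<m. f i j * of_bool (prod_encode (i, j) = prod_encode (a, b))) = (f a b :: nat)"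
proof -
  have lt: "a < m" "b < m" using assms le_prod_encode[of a b] by auto
  have "(\<Sum>i<m. \<Sum>j<m. f i j * of_bool (prod_encode (i, j) = prod_encode (a, b)))
      = (\<Sum>i<m. \<Sum>j<m. if j = b then (if i = a then f i b else 0) else 0)"
    by (intro sum.cong) auto
  also have "\<dots> = f a b" using lt by simp
  finally show ?thesis .
qed

text \<open>Decoding by exhaustive search: among all pairs up to \<open>m\<close> exactly one contributes to the sum.\<close>

lemma computable_prod_decode:
  assumes F: "computable_on UNIV [fst, snd] (\<lambda>p. f (fst p) (snd p))" 
    and M: "computable_on D vs M"
  shows "computable_on D vs (\<lambda>x. f (fst (prod_decode (M x))) (snd (prod_decode (M x))))"
proof (rule computable_unary[where F = M, OF _ M])
  have "computable_on UNIV [\<lambda>a. a]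
      (\<lambda>m. \<Sum>i<Suc m. \<Sum>j<Suc m. f i j * of_bool (prod_encode (i, j) = m))"
    by (intro computable_sum computable_mult computable_eq computable_prod_encode computable_Suc
        computable_binary[OF F] computable_var) simp_all
  then show "computable_on UNIV [\<lambda>a. a] (\<lambda>m. f (fst (prod_decode m)) (snd (prod_decode m)))"
  proof (rule computable_on_cong)
    fix m :: nat
    show "(\<Sum>i<Suc m. \<Sum>j<Suc m. f i j * of_bool (prod_encode (i, j) = m))
        = f (fst (prod_decode m)) (snd (prod_decode m))"
      using sum_prod_encode[of "fst (prod_decode m)" "snd (prod_decode m)" "Suc m" f]
      by (simp del: sum.lessThan_Suc)
  qed
qed

lemma computable_drop_code:
  assumes L: "computable_on D vs (\<lambda>x. list_encode (L x))" and N: "computable_on D vs N"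
  shows "computable_on D vs (\<lambda>x. list_encode (drop (N x) (L x)))"
proof (rule computable_on_cong[where
      F = "\<lambda>x. rec_nat (list_encode (L x)) (\<lambda>i r. (\<lambda>a b. b) (fst (prod_decode (r - 1))) (snd (prod_decode (r - 1)))) (N x)"])
  show "computable_on D vs (\<lambda>x. rec_nat (list_encode (L x)) (\<lambda>i r. (\<lambda>a b. b) (fst (prod_decode (r - 1))) (snd (prod_decode (r - 1)))) (N x))"
    by (intro computable_rec N L computable_prod_decode computable_pred computable_var) simp_all
  have 1: "snd (prod_decode (list_encode l - 1)) = list_encode (drop 1 l)" for l
  proof (cases l)
    case Nil
    moreover have "snd (prod_decode 0) = 0"
      using prod_decode_inverse[of 0] le_prod_encode[of "fst (prod_decode 0)" "snd (prod_decode 0)"]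
      by simp
    ultimately show ?thesis by simp
  qed simp
  have "rec_nat (list_encode l) (\<lambda>i r. snd (prod_decode (r - 1))) n = list_encode (drop n l)" for n l
    by (induction n) (auto simp: 1[unfolded One_nat_def])
  then show "rec_nat (list_encode (L x)) (\<lambda>i r. (\<lambda>a b. b) (fst (prod_decode (r - 1))) (snd (prod_decode (r - 1)))) (N x) =
         list_encode (drop (N x) (L x))" for x by simp
qed

lemma computable_nth_code:
  assumes L: "computable_on D vs (\<lambda>x. list_encode (L x))" and N: "computable_on D vs N"
    and lt: "\<And>x. x \<in> D \<Longrightarrow> N x < length (L x)"
  shows "computable_on D vs (\<lambda>x. L x ! N x)"
proof (rule computable_on_cong[where F = "\<lambda>x. (\<lambda>a b. a)
    (fst (prod_decode (list_encode (drop (N x) (L x)) - 1)))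
    (snd (prod_decode (list_encode (drop (N x) (L x)) - 1)))"])
  show "computable_on D vs (\<lambda>x. (\<lambda>a b. a)
    (fst (prod_decode (list_encode (drop (N x) (L x)) - 1)))
    (snd (prod_decode (list_encode (drop (N x) (L x)) - 1))))"
    by (intro computable_prod_decode computable_pred computable_drop_code L N computable_var) simp
  show "(\<lambda>a b. a)
    (fst (prod_decode (list_encode (drop (N x) (L x)) - 1)))
    (snd (prod_decode (list_encode (drop (N x) (L x)) - 1))) = L x ! N x" if "x \<in> D" for x
    using lt[OF that] by (simp add: Cons_nth_drop_Suc[symmetric])
qed

lemma length_le_list_encode: "length l \<le> list_encode l"
proof (induction l)
  case (Cons a l)
  then show ?case using le_prod_encode[of a "list_encode l"] by simp
qed simp

lemma list_encode_eq_0_iff: "list_encode l = 0 \<longleftrightarrow> l = []"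
  by (cases l) auto

text \<open>The length is the number of tails that are not empty; there are at most as many as the code says.\<close>

lemma computable_length:
  assumes L: "computable_on D vs (\<lambda>x. list_encode (L x))"
  shows "computable_on D vs (\<lambda>x. length (L x))"
proof (rule computable_on_cong[where
      F = "\<lambda>x. \<Sum>i<list_encode (L x). of_bool (\<not> list_encode (drop i (L x)) = 0)"])
  show "computable_on D vs (\<lambda>x. \<Sum>i<list_encode (L x). of_bool (\<not> list_encode (drop i (L x)) = 0))"
    by (intro computable_sum L computable_not computable_eq computable_drop_code computable_const
        computable_lift[OF L])
      (auto intro: computable_var)
  show "(\<Sum>i<list_encode (L x). of_bool (\<not> list_encode (drop i (L x)) = 0)) = length (L x)" for x
  proof -
    have "{..<list_encode (L x)} \<inter> {i. i < length (L x)} = {..<length (L x)}"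
      using length_le_list_encode[of "L x"] by auto
    then show ?thesis by (simp add: list_encode_eq_0_iff sum.If_cases of_bool_def not_le)
  qed
qed

lemma computable_all_list:
  assumes L: "computable_on D vs (\<lambda>x. list_encode (map cd (L x)))"
    and P: "computable_on {(a, x). x \<in> D \<and> a \<in> set (L x)}
      ((\<lambda>y. cd (fst y)) # map (\<lambda>v y. v (snd y)) vs) (\<lambda>y. of_bool (P (fst y) (snd y)))"
  shows "computable_on D vs (\<lambda>x. of_bool (\<forall>a\<in>set (L x). P a x))"
proof -
  let ?E = "{(i, x). x \<in> D \<and> i < length (L x)}"
  let ?us = "fst # map (\<lambda>v y. v (snd y)) vs"
  have len: "computable_on D vs (\<lambda>x. length (L x))"
    using computable_length[OF L] by simp
  have "computable_on ?E ?us (\<lambda>y. map cd (L (snd y)) ! fst y)"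
    by (intro computable_nth_code computable_lift[OF L]) (auto intro: computable_var)
  then have nth: "computable_on ?E ?us (\<lambda>y. cd (L (snd y) ! fst y))"
    by (rule computable_on_cong) auto
  have "computable_on ?E ?us
      (\<lambda>y. (\<lambda>y. of_bool (P (fst y) (snd y))) (L (snd y) ! fst y, snd y))"
    by (rule computable_comp[OF P, where k = "\<lambda>y. (L (snd y) ! fst y, snd y)"]) (use nth in \<open>auto intro: computable_var\<close>)
  then have "computable_on D vs (\<lambda>x. of_bool (\<forall>i<length (L x). P (L x ! i) x))"
    by (intro computable_all_less len) simp
  then show ?thesis by (simp add: all_set_conv_all_nth)
qed

lemma computable_foldl:
  assumes L: "computable_on D vs (\<lambda>x. list_encode (map cd (L x)))" and I: "computable_on D vs I"
    and S: "computable_on {(r, a, x). x \<in> D \<and> a \<in> set (L x)}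
      (fst # (\<lambda>y. cd (fst (snd y))) # map (\<lambda>v y. v (snd (snd y))) vs)
      (\<lambda>y. S (fst y) (fst (snd y)) (snd (snd y)))"
  shows "computable_on D vs (\<lambda>x. foldl (\<lambda>r a. S r a x) (I x) (L x))"
proof -
  let ?E = "{(i, r :: nat, x). x \<in> D \<and> i < length (L x)}"
  let ?us = "fst # (\<lambda>y. fst (snd y)) # map (\<lambda>v y. v (snd (snd y))) vs"
  have len: "computable_on D vs (\<lambda>x. length (L x))"
    using computable_length[OF L] by simp
  have "computable_on ?E ?us (\<lambda>y. (\<lambda>x. list_encode (map cd (L x))) (snd (snd y)))"
    by (rule computable_comp[OF L, where k = "\<lambda>y. snd (snd y)"]) (auto intro: computable_var)
  then have "computable_on ?E ?us (\<lambda>y. map cd (L (snd (snd y))) ! fst y)"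
    by (intro computable_nth_code) (auto intro: computable_var)
  then have nth: "computable_on ?E ?us (\<lambda>y. cd (L (snd (snd y)) ! fst y))"
    by (rule computable_on_cong) auto
  have "computable_on ?E ?us
      (\<lambda>y. (\<lambda>y. S (fst y) (fst (snd y)) (snd (snd y))) (fst (snd y), L (snd (snd y)) ! fst y, snd (snd y)))"
    by (rule computable_comp[OF S, where k = "\<lambda>y. (fst (snd y), L (snd (snd y)) ! fst y, snd (snd y))"]) (use nth in \<open>auto intro: computable_var\<close>)
  then have "computable_on D vs (\<lambda>x. rec_nat (I x) (\<lambda>i r. S r (L x ! i) x) (length (L x)))"
    by (intro computable_rec len I) simp
  moreover have "rec_nat i (\<lambda>n r. s r (l ! n)) n = foldl s i (take n l)"
    if "n \<le> length l" for i s n and l :: "'b list"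
    using that by (induction n) (auto simp: take_Suc_conv_app_nth)
  from this[of "length l" l _ "\<lambda>r a. S r a x" for l x] 
  have "rec_nat (I x) (\<lambda>i r. S r (L x ! i) x) (length (L x)) = foldl (\<lambda>r a. S r a x) (I x) (L x)" for x
    by simp
  ultimately show ?thesis by simp
qed

section \<open>Decision procedures\<close>

lemma ex_digits:
  assumes "0 < n" "\<And>j. j < m \<Longrightarrow> f j < n"
  shows "\<exists>s<n ^ m. \<forall>j<m. s div n ^ j mod n = (f j :: nat)"
  using assms(2)
proof (induction m arbitrary: f)
  case 0
  then show ?case by simp
next
  case (Suc m)
  obtain s where s: "s < n ^ m" "\<forall>j<m. s div n ^ j mod n = f (Suc j)"
    using Suc.IH[of "\<lambda>j. f (Suc j)"] Suc.prems by auto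
  let ?s = "f 0 + n * s"
  have f0: "f 0 < n" using Suc.prems by simp
  have "?s < n * Suc s" using f0 by simp
  also have "\<dots> \<le> n * n ^ m" using s(1) by (intro mult_le_mono2) simp
  finally have "?s < n ^ Suc m" by simp
  moreover have "?s div n ^ j mod n = f j" if "j < Suc m" for j
  proof (cases j)
    case (Suc k)
    have "?s div n ^ j = s div n ^ k" using f0 Suc by (simp add: div_mult2_eq)
    then show ?thesis using s(2) that Suc by simp
  qed (use f0 in simp)
  ultimately show ?case by blast
qed

text \<open>The base-\<open>n\<close> digits of \<open>s\<close> tabulate the maps of the letters on \<open>{..<n}\<close>, the images under \<open>l\<close>
  forming the block of digits with number \<open>letter_code c l\<close>.\<close>

definition decode_action :: "('x \<Rightarrow> nat) \<Rightarrow> nat \<Rightarrow> nat \<Rightarrow> 'x letter \<Rightarrow> nat \<Rightarrow> nat" where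
  "decode_action c n s l i = s div n ^ (letter_code c l * n + i) mod n"

lemma inj_on_letter_code:
  assumes "inj_on c X"
  shows "inj_on (letter_code c) (letters X)"
proof (rule inj_onI)
  fix l k assume "l \<in> letters X" "k \<in> letters X" "letter_code c l = letter_code c k"
  then show "l = k"
    using inj_onD[OF assms, of "fst l" "fst k"]
    by (cases l; cases k) (auto simp: letters_def letter_code_def of_bool_def split: if_splits)
qed

lemma ex_decode_action:
  assumes c: "inj_on c X" and k: "\<And>l. l \<in> letters X \<Longrightarrow> letter_code c l < k"
    and T: "acts X R T {..<n}" and n: "0 < n"
  shows "\<exists>s<n ^ (k * n). \<forall>u\<in>words X. \<forall>i<n. run (decode_action c n s) u i = run T u i"
proof -
  let ?d = "inv_into (letters X) (letter_code c)"
  define f where "f = (\<lambda>j. if j div n \<in> letter_code c ` letters X then T (?d (j div n)) (j mod n) else 0)"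
  have "f j < n" for j
    using T n by (auto simp: f_def acts_def inv_into_f_f[OF inj_on_letter_code[OF c]])
  then obtain s where s: "s < n ^ (k * n)" "\<forall>j<k * n. s div n ^ j mod n = f j"
    using ex_digits[OF n, of "k * n" f] by blast
  have letter: "decode_action c n s l i = T l i" if "l \<in> letters X" "i < n" for l i
  proof -
    let ?j = "letter_code c l * n + i"
    have "?j < Suc (letter_code c l) * n" using that by simp
    also have "\<dots> \<le> k * n" using k[OF that(1)] by (intro mult_le_mono1) simp
    finally have "decode_action c n s l i = f ?j" using s(2) by (simp add: decode_action_def)
    also have "\<dots> = T l i"
      using that by (simp add: f_def inv_into_f_f[OF inj_on_letter_code[OF c]])
    finally show ?thesis .
  qed
  have "run (decode_action c n s) u i = run T u i" if "u \<in> words X" "i < n" for u i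
    using that
  proof (induction u arbitrary: i)
    case (Cons l u)
    then have "T l i < n" using T by (auto simp: acts_def)
    then show ?case using Cons letter by simp
  qed simp
  then show ?thesis using s(1) by blast
qed

lemma decode_action_less: "0 < n \<Longrightarrow> decode_action c n s l i < n"
  by (simp add: decode_action_def)

text \<open>For \<open>rs\<close> consisting of the relators and the cancelling pairs of letters this says that \<open>s\<close> codes
  an action of the presented group.\<close>

definition satisfies :: "('x \<Rightarrow> nat) \<Rightarrow> nat \<Rightarrow> nat \<Rightarrow> 'x word list \<Rightarrow> bool" where
  "satisfies c n s rs \<longleftrightarrow> (\<forall>r\<in>set rs. \<forall>i<n. run (decode_action c n s) r i = i)"

text \<open>The conjugating word \<open>p\<close> is a letter in the test of normality and empty in that of inclusion.\<close>

definition preserves :: "('x \<Rightarrow> nat) \<Rightarrow> nat \<Rightarrow> nat \<Rightarrow> nat \<Rightarrow> 'x word \<Rightarrow> 'x word list \<Rightarrow> bool" where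
  "preserves c q n s p us \<longleftrightarrow> (\<forall>u\<in>set us. \<forall>i<q. run (decode_action c n s) (p @ u @ word_inv p) i < q)"

lemma satisfies_iff_acts:
  assumes "0 < n" and rs: "set rs = (R \<inter> words X) \<union> (\<lambda>(x, b). [(x, b), (x, \<not> b)]) ` (X \<times> UNIV)"
  shows "satisfies c n s rs \<longleftrightarrow> acts X R (decode_action c n s) {..<n}"
proof
  assume s: "satisfies c n s rs"
  have "decode_action c n s (x, \<not> b) (decode_action c n s (x, b) i) = i" if "x \<in> X" "i < n" for x b i
  proof -
    have "[(x, b), (x, \<not> b)] \<in> set rs" unfolding rs using that by force
    then have "run (decode_action c n s) [(x, b), (x, \<not> b)] i = i"
      using s that by (simp only: satisfies_def)
    then show ?thesis by simp
  qed
  then show "acts X R (decode_action c n s) {..<n}"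
    using s decode_action_less[OF assms(1)] unfolding acts_def satisfies_def rs by auto
next
  assume "acts X R (decode_action c n s) {..<n}"
  then show "satisfies c n s rs" unfolding acts_def satisfies_def rs by auto
qed

lemma computable_lift2:
  assumes "computable_on D vs F" "D' \<subseteq> {(a, b, x). x \<in> D}"
  shows "computable_on D' (u1 # u2 # map (\<lambda>v y. v (snd (snd y))) vs) (\<lambda>y. F (snd (snd y)))"
  by (rule computable_comp[OF assms(1)]) (use assms(2) in \<open>auto intro: computable_var\<close>)

lemma computable_run:
  assumes N: "computable_on D vs N" and S: "computable_on D vs S" and I: "computable_on D vs I"
    and W: "computable_on D vs (\<lambda>x. word_code c (W x))"
  shows "computable_on D vs (\<lambda>x. run (decode_action c (N x) (S x)) (W x) (I x))"
  unfolding run_def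
proof (rule computable_foldl[where cd = "letter_code c"])
  show "computable_on D vs (\<lambda>x. list_encode (map (letter_code c) (W x)))"
    using W by (simp add: word_code_def)
  let ?D = "{(r, a, x). x \<in> D \<and> a \<in> set (W x)}"
  let ?vs = "fst # (\<lambda>y. letter_code c (fst (snd y))) # map (\<lambda>v y. v (snd (snd y))) vs"
  have sub: "?D \<subseteq> {(a, b, x). x \<in> D}" by auto
  show "computable_on ?D ?vs (\<lambda>y. decode_action c (N (snd (snd y))) (S (snd (snd y))) (fst (snd y)) (fst y))"
    unfolding decode_action_def
    by (intro computable_mod computable_div computable_power computable_add computable_mult
        computable_lift2[OF N sub] computable_lift2[OF S sub] computable_var) simp_all
qed (rule I)

lemma computable_satisfies:
  assumes N: "computable_on D vs N" and S: "computable_on D vs S"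
  shows "computable_on D vs (\<lambda>x. of_bool (satisfies c (N x) (S x) rs))"
  unfolding satisfies_def
proof (rule computable_all_list[where cd = "word_code c"])
  let ?D = "{(r, x). x \<in> D \<and> r \<in> set rs}"
  let ?vs = "(\<lambda>y. word_code c (fst y)) # map (\<lambda>v y. v (snd y)) vs"
  have sub: "?D \<subseteq> UNIV \<times> D" by auto
  note N1 = computable_lift[OF N sub] and S1 = computable_lift[OF S sub]
  let ?D2 = "{(i, y). y \<in> ?D \<and> i < N (snd y)}"
  have sub2: "?D2 \<subseteq> UNIV \<times> ?D" by auto
  have W: "computable_on ?D ?vs (\<lambda>y. word_code c (fst y))" by (rule computable_var) simp
  show "computable_on ?D ?vs
      (\<lambda>y. of_bool (\<forall>i<N (snd y). run (decode_action c (N (snd y)) (S (snd y))) (fst y) i = i))"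
    by (intro computable_all_less computable_eq computable_run N1
        computable_lift[OF N1 sub2] computable_lift[OF S1 sub2] computable_lift[OF W sub2] computable_var)
      simp_all
qed (rule computable_const)

lemma computable_preserves:
  assumes N: "computable_on D vs N" and S: "computable_on D vs S"
    and U: "computable_on D vs (\<lambda>x. tuple_code c (U x))"
  shows "computable_on D vs (\<lambda>x. of_bool (preserves c q (N x) (S x) p (U x)))"
  unfolding preserves_def
proof (rule computable_all_list[where cd = "word_code c"])
  show "computable_on D vs (\<lambda>x. list_encode (map (word_code c) (U x)))"
    using U by (simp add: tuple_code_def)
  let ?D = "{(u, x). x \<in> D \<and> u \<in> set (U x)}"
  let ?vs = "(\<lambda>y. word_code c (fst y)) # map (\<lambda>v y. v (snd y)) vs"
  have sub: "?D \<subseteq> UNIV \<times> D" by auto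
  note N1 = computable_lift[OF N sub] and S1 = computable_lift[OF S sub]
  let ?D2 = "{(i, y). y \<in> ?D \<and> i < q}"
  have sub2: "?D2 \<subseteq> UNIV \<times> ?D" by auto
  have W: "computable_on ?D ?vs (\<lambda>y. word_code c (fst y))" by (rule computable_var) simp
  show "computable_on ?D ?vs
      (\<lambda>y. of_bool (\<forall>i<q. run (decode_action c (N (snd y)) (S (snd y))) (p @ fst y @ word_inv p) i < q))"
    unfolding run_append
    by (intro computable_all_less computable_less computable_run computable_const
        computable_lift[OF N1 sub2] computable_lift[OF S1 sub2] computable_lift[OF W sub2] computable_var)
      simp_all
qed

lemma computable_all_const:
  assumes "\<And>l. l \<in> set ls \<Longrightarrow> computable_on D vs (\<lambda>x. of_bool (P l x))"
  shows "computable_on D vs (\<lambda>x. of_bool (\<forall>l\<in>set ls. P l x))"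
  using assms
proof (induction ls)
  case Nil
  then show ?case using computable_const[of D vs 1] by simp
next
  case (Cons l ls)
  then have "computable_on D vs (\<lambda>x. of_bool (P l x \<and> (\<forall>l\<in>set ls. P l x)))"
    by (intro computable_conj) auto
  then show ?case by simp
qed

lemma sum_lengths_le_tuple_code: "(\<Sum>u\<leftarrow>us. Suc (length u)) \<le> tuple_code c us"
proof (induction us)
  case (Cons u us)
  have "length u \<le> word_code c u"
    using length_le_list_encode[of "map (letter_code c) u"] by (simp add: word_code_def)
  then show ?case
    using Cons le_prod_encode[of "word_code c u" "tuple_code c us"] by (simp add: tuple_code_def)
qed (simp add: tuple_code_def)

context free_model
begin

text \<open>Separation with an explicit bound on the size of the action turns membership into a bounded
  quantification.  Any \<open>m\<close> above the bound will do, so it may be computed crudely from codes.\<close>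

lemma mem_subgroup_iff:
  assumes c: "inj_on c X" and k: "\<forall>l\<in>letters X. letter_code c l < k"
    and rs: "set rs = (R \<inter> words X) \<union> (\<lambda>(x, b). [(x, b), (x, \<not> b)]) ` (X \<times> UNIV)"
    and cs: "cs \<in> lists (words X)" and w: "w \<in> words X"
    and m: "(\<Sum>u\<leftarrow>w # cs. Suc (length u)) * (card (carrier A) * card \<Omega>) \<le> m"
  defines "n \<equiv> m * (card (carrier G1) * card (carrier G2))"
  shows "cls w \<in> subgroup_of_words X R cs \<longleftrightarrow>
    (\<forall>s<n ^ (k * n). satisfies c n s rs \<and> preserves c (card \<Omega>) n s [] cs \<longrightarrow>
      (\<forall>i<card \<Omega>. run (decode_action c n s) w i < card \<Omega>))"
proof -
  have pos: "0 < card (carrier G1)" "0 < card (carrier G2)"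
    using fin1 fin2 pres_class_in_carrier[OF words_Nil] by (auto simp: card_gt_0_iff)
  have A0: "0 < card (carrier A)" using A group.is_monoid monoid.one_closed by (fastforce simp: card_gt_0_iff)
  have \<Omega>0: "0 < card \<Omega>" using \<Omega> by (simp add: card_gt_0_iff)
  have "card \<Omega> \<le> 1 * (card (carrier A) * card \<Omega>)" using A0 by simp
  also have "\<dots> \<le> (\<Sum>u\<leftarrow>w # cs. Suc (length u)) * (card (carrier A) * card \<Omega>)"
    by (intro mult_le_mono1) simp
  also have "\<dots> \<le> m" by (rule m)
  also have "\<dots> \<le> n" using pos by (simp add: n_def)
  finally have qn: "card \<Omega> \<le> n" .
  then have n: "0 < n" using \<Omega>0 by simp
  show ?thesis
  proof
    assume mem: "cls w \<in> subgroup_of_words X R cs"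
    show "\<forall>s<n ^ (k * n). satisfies c n s rs \<and> preserves c (card \<Omega>) n s [] cs \<longrightarrow>
      (\<forall>i<card \<Omega>. run (decode_action c n s) w i < card \<Omega>)"
    proof (intro allI impI)
      fix s i assume s: "satisfies c n s rs \<and> preserves c (card \<Omega>) n s [] cs" and i: "i < card \<Omega>"
      have T: "acts X R (decode_action c n s) {..<n}" using s satisfies_iff_acts[OF n rs] by blast
      show "run (decode_action c n s) w i < card \<Omega>"
        using s by (intro preserved_by_subgroup[OF T qn cs _ w mem i])
          (simp add: preserves_def word_inv_def)
    qed
  next
    assume a: "\<forall>s<n ^ (k * n). satisfies c n s rs \<and> preserves c (card \<Omega>) n s [] cs \<longrightarrow>
      (\<forall>i<card \<Omega>. run (decode_action c n s) w i < card \<Omega>)"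
    show "cls w \<in> subgroup_of_words X R cs"
    proof (rule ccontr)
      assume "cls w \<notin> subgroup_of_words X R cs"
      then obtain T where T: "acts X R T {..<n}"
        "\<forall>u\<in>set cs. \<forall>i<card \<Omega>. run T u i < card \<Omega>" "\<exists>i<card \<Omega>. \<not> run T w i < card \<Omega>"
        using separation[OF cs w _ m] unfolding n_def by blast
      obtain s where s: "s < n ^ (k * n)" "\<forall>u\<in>words X. \<forall>i<n. run (decode_action c n s) u i = run T u i"
        using ex_decode_action[OF c bspec[OF k] T(1) n] by blast
      have "satisfies c n s rs"
        unfolding satisfies_def
      proof (intro ballI allI impI)
        fix r i assume r: "r \<in> set rs" and i: "i < n"
        have "r \<in> words X \<and> run T r i = i"
          using r T(1) i unfolding rs by (auto simp: acts_def letters_def)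
        then show "run (decode_action c n s) r i = i" using s(2) i by simp
      qed
      moreover have "preserves c (card \<Omega>) n s [] cs"
        using s(2) T(2) cs qn by (auto simp: preserves_def word_inv_def)
      ultimately show False using a s w T(3) qn by fastforce
    qed
  qed
qed

text \<open>Normality is the membership of the conjugates of the generators by letters; the constant 3 accounts for the two
  additional letters and the successor.  For an infinite group, finite index is in addition that some generator is not
  in the largest finite normal subgroup, whose generators are built into the program.\<close>

lemma decidable_normal_and_finite_index:
  assumes finX: "finite X1" "finite X2" and finR: "finite R" and c: "inj_on c X"
  shows "decidable_on (tuple_code c) (lists (words X)) (\<lambda>hs. subgroup_of_words X R hs \<lhd> G)"
    and "decidable_on (tuple_code c) (lists (words X))
      (\<lambda>hs. subgroup_of_words X R hs \<lhd> G \<and> finite (rcosets\<^bsub>G\<^esub> (subgroup_of_words X R hs)))"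
proof -
  let ?D = "lists (words X)" and ?vs = "[tuple_code c]"
  have dec: "decidable_on (tuple_code c) ?D P \<longleftrightarrow> computable_on ?D ?vs (\<lambda>hs. of_bool (P hs))" for P
    by (simp add: decidable_on_def computable_on_def of_bool_def)
  have finL: "finite (letters X)" using finX by (simp add: letters_def)
  obtain ls where ls: "set ls = letters X" using finite_list[OF finL] by auto
  define k where "k = Suc (\<Sum>l\<in>letters X. letter_code c l)"
  have k: "\<forall>l\<in>letters X. letter_code c l < k"
  proof
    fix l assume "l \<in> letters X"
    then show "letter_code c l < k"
      using member_le_sum[of l "letters X" "letter_code c"] finL by (simp add: k_def)
  qed
  have "finite ((R \<inter> words X) \<union> (\<lambda>(x, b). [(x, b), (x, \<not> b)]) ` (X \<times> (UNIV :: bool set)))"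
    using finX finR by simp
  from finite_list[OF this] obtain rs where rs: "set rs = (R \<inter> words X) \<union> (\<lambda>(x, b). [(x, b), (x, \<not> b)]) ` (X \<times> UNIV)"
    by (rule exE)
  define q where "q = card \<Omega>"
  define bound where "bound = (\<lambda>b. b * (card (carrier A) * q) * (card (carrier G1) * card (carrier G2)))"
  note mem = mem_subgroup_iff[OF c k rs, folded q_def]
  have test: "computable_on ?D ?vs (\<lambda>hs. of_bool (\<forall>s<N hs ^ (k * N hs).
      satisfies c (N hs) s rs \<and> preserves c q (N hs) s [] (U hs) \<longrightarrow> preserves c q (N hs) s p hs))"
    if N: "computable_on ?D ?vs N" and U: "computable_on ?D ?vs (\<lambda>hs. tuple_code c (U hs))" for N U p
  proof -
    let ?E = "{(s, hs). hs \<in> ?D \<and> s < N hs ^ (k * N hs)}"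
    have sub: "?E \<subseteq> UNIV \<times> ?D" by auto
    have hs: "computable_on ?D ?vs (\<lambda>hs. tuple_code c hs)" by (rule computable_var) simp
    show ?thesis
      by (intro computable_all_less computable_imp computable_conj computable_satisfies computable_preserves
          computable_power computable_mult computable_const N computable_lift[OF N sub] computable_lift[OF U sub]
          computable_lift[OF hs sub] computable_var) simp_all
  qed
  have code: "computable_on ?D ?vs (tuple_code c)" by (rule computable_var) simp
  define N1 where "N1 = (\<lambda>hs. bound (2 * tuple_code c hs + 3))"
  have cN1: "computable_on ?D ?vs N1"
    unfolding N1_def bound_def by (intro computable_mult computable_add computable_const code)
  have conj_iff: "(\<forall>u\<in>set hs. cls ([l] @ u @ word_inv [l]) \<in> subgroup_of_words X R hs) \<longleftrightarrow>
      (\<forall>s<N1 hs ^ (k * N1 hs). satisfies c (N1 hs) s rs \<and> preserves c q (N1 hs) s [] hs \<longrightarrow>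
        preserves c q (N1 hs) s [l] hs)"
    if hs: "hs \<in> ?D" and l: "l \<in> letters X" for hs l
  proof -
    have len: "length u \<le> tuple_code c hs" if "u \<in> set hs" for u
    proof -
      have "Suc (length u) \<le> (\<Sum>u\<leftarrow>hs. Suc (length u))"
        using that by (intro member_le_sum_list) auto
      then show ?thesis using sum_lengths_le_tuple_code[of hs c] by simp
    qed
    have "cls ([l] @ u @ word_inv [l]) \<in> subgroup_of_words X R hs \<longleftrightarrow>
      (\<forall>s<N1 hs ^ (k * N1 hs). satisfies c (N1 hs) s rs \<and> preserves c q (N1 hs) s [] hs \<longrightarrow>
        (\<forall>i<q. run (decode_action c (N1 hs) s) ([l] @ u @ word_inv [l]) i < q))"
      if u: "u \<in> set hs" for u
      unfolding N1_def bound_def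
    proof (rule mem[OF hs])
      have "[l] \<in> words X" using l by simp
      then show "[l] @ u @ word_inv [l] \<in> words X" using word_inv_words u hs by auto
      have "length (word_inv [l]) = 1" by (simp add: word_inv_def)
      then show "(\<Sum>u\<leftarrow>([l] @ u @ word_inv [l]) # hs. Suc (length u)) * (card (carrier A) * q)
          \<le> (2 * tuple_code c hs + 3) * (card (carrier A) * q)"
        using len[OF u] sum_lengths_le_tuple_code[of hs c] by (intro mult_le_mono1) simp
    qed
    then show ?thesis unfolding preserves_def by blast
  qed
  have normal: "computable_on ?D ?vs (\<lambda>hs. of_bool (subgroup_of_words X R hs \<lhd> G))"
  proof (rule computable_on_cong)
    show "computable_on ?D ?vs (\<lambda>hs. of_bool (\<forall>l\<in>set ls. \<forall>s<N1 hs ^ (k * N1 hs).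
        satisfies c (N1 hs) s rs \<and> preserves c q (N1 hs) s [] hs \<longrightarrow> preserves c q (N1 hs) s [l] hs))"
      by (intro computable_all_const test cN1 code)
    show "of_bool (\<forall>l\<in>set ls. \<forall>s<N1 hs ^ (k * N1 hs).
        satisfies c (N1 hs) s rs \<and> preserves c q (N1 hs) s [] hs \<longrightarrow> preserves c q (N1 hs) s [l] hs)
        = of_bool (subgroup_of_words X R hs \<lhd> G)" if "hs \<in> ?D" for hs
      unfolding normal_iff[OF that] ls using conj_iff[OF that] by simp
  qed
  then show "decidable_on (tuple_code c) ?D (\<lambda>hs. subgroup_of_words X R hs \<lhd> G)"
    by (simp add: dec)
  show "decidable_on (tuple_code c) ?D
      (\<lambda>hs. subgroup_of_words X R hs \<lhd> G \<and> finite (rcosets\<^bsub>G\<^esub> (subgroup_of_words X R hs)))"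
  proof (cases "finite (carrier G)")
    case True
    then have "finite (rcosets\<^bsub>G\<^esub> H)" for H by (simp add: RCOSETS_def)
    then show ?thesis using normal by (simp add: dec)
  next
    case False
    then obtain ds where ds: "ds \<in> ?D" "\<And>hs. hs \<in> ?D \<Longrightarrow> subgroup_of_words X R hs \<lhd> G \<Longrightarrow>
      finite (rcosets\<^bsub>G\<^esub> (subgroup_of_words X R hs)) \<longleftrightarrow>
        \<not> (\<forall>u\<in>set hs. cls u \<in> subgroup_of_words X R ds)"
      using ex_largest_finite_normal by blast
    define N2 where "N2 = (\<lambda>hs. bound (tuple_code c hs + (1 + tuple_code c ds)))"
    have cN2: "computable_on ?D ?vs N2"
      unfolding N2_def bound_def by (intro computable_mult computable_add computable_const code)
    have sub_iff: "(\<forall>u\<in>set hs. cls u \<in> subgroup_of_words X R ds) \<longleftrightarrow>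
      (\<forall>s<N2 hs ^ (k * N2 hs). satisfies c (N2 hs) s rs \<and> preserves c q (N2 hs) s [] ds \<longrightarrow>
        preserves c q (N2 hs) s [] hs)"
      if hs: "hs \<in> ?D" for hs
    proof -
      have "cls u \<in> subgroup_of_words X R ds \<longleftrightarrow>
        (\<forall>s<N2 hs ^ (k * N2 hs). satisfies c (N2 hs) s rs \<and> preserves c q (N2 hs) s [] ds \<longrightarrow>
          (\<forall>i<q. run (decode_action c (N2 hs) s) u i < q))"
        if u: "u \<in> set hs" for u
        unfolding N2_def bound_def
      proof (rule mem[OF ds(1)])
        show "u \<in> words X" using u hs by auto
        have "Suc (length u) \<le> (\<Sum>u\<leftarrow>hs. Suc (length u))"
          using u by (intro member_le_sum_list) auto
        then show "(\<Sum>u\<leftarrow>u # ds. Suc (length u)) * (card (carrier A) * q)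
            \<le> (tuple_code c hs + (1 + tuple_code c ds)) * (card (carrier A) * q)"
          using sum_lengths_le_tuple_code[of hs c] sum_lengths_le_tuple_code[of ds c]
          by (intro mult_le_mono1) simp
      qed
      then show ?thesis unfolding preserves_def by (auto simp: word_inv_def)
    qed
    have "computable_on ?D ?vs (\<lambda>hs. of_bool (subgroup_of_words X R hs \<lhd> G \<and>
      \<not> (\<forall>s<N2 hs ^ (k * N2 hs). satisfies c (N2 hs) s rs \<and> preserves c q (N2 hs) s [] ds \<longrightarrow>
        preserves c q (N2 hs) s [] hs)))"
      by (intro computable_conj computable_not normal test cN2 computable_const)
    then have "computable_on ?D ?vs (\<lambda>hs. of_bool (subgroup_of_words X R hs \<lhd> G \<and>
      finite (rcosets\<^bsub>G\<^esub> (subgroup_of_words X R hs))))"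
      by (rule computable_on_cong) (use sub_iff ds(2) in auto)
    then show ?thesis by (simp add: dec)
  qed
qed

end

theorem corollary6p6:
  fixes X1 X2 :: "'x set" and R1 R2 :: "'x word set"
    and A :: "('a, 'm) monoid_scheme" and Y :: "'a set"
    and \<phi>1 \<phi>2 :: "'a \<Rightarrow> 'x word set" and w1 w2 :: "'a \<Rightarrow> 'x word"
    and c :: "'x \<Rightarrow> nat"
  defines "X \<equiv> X1 \<union> X2"
    and "R \<equiv> amalgam_relators R1 R2 Y w1 w2"
  defines "G \<equiv> presented_group X R"
  assumes "finite X1" "finite R1" "R1 \<subseteq> words X1" "finite (carrier (presented_group X1 R1))"
    and "finite X2" "finite R2" "R2 \<subseteq> words X2" "finite (carrier (presented_group X2 R2))"
    and "letters X1 \<inter> letters X2 = {}"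
    and "group A" "finite (carrier A)" "Y \<subseteq> carrier A" "generate A Y = carrier A"
    and "\<phi>1 \<in> hom A (presented_group X1 R1)" "inj_on \<phi>1 (carrier A)"
    and "\<phi>2 \<in> hom A (presented_group X2 R2)" "inj_on \<phi>2 (carrier A)"
    and "\<And>a. a \<in> Y \<Longrightarrow> w1 a \<in> \<phi>1 a" "\<And>a. a \<in> Y \<Longrightarrow> w2 a \<in> \<phi>2 a"
    and "inj_on c X"
  shows "decidable_on (tuple_code c) (lists (words X))
           (\<lambda>hs. subgroup_of_words X R hs \<lhd> G)
       \<and> decidable_on (tuple_code c) (lists (words X))
           (\<lambda>hs. subgroup_of_words X R hs \<lhd> G
              \<and> finite (rcosets\<^bsub>G\<^esub> (subgroup_of_words X R hs)))"
proof -
  have disj: "X1 \<inter> X2 = {}"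
    using \<open>letters X1 \<inter> letters X2 = {}\<close> by (auto simp: letters_def)
  interpret amalgam X1 X2 R1 R2 A Y \<phi>1 \<phi>2 w1 w2
    by (rule amalgam.intro) (fact disj assms)+
  let ?\<Omega> = "carrier (presented_group X1 R1) \<times> carrier (presented_group X2 R2)"
  obtain S where S: "acts (X1 \<union> X2) (amalgam_relators R1 R2 Y w1 w2) S ?\<Omega>"
    "acts_freely X1 R1 S ?\<Omega>" "acts_freely X2 R2 S ?\<Omega>"
    using ex_free_model by blast
  have fin: "finite ?\<Omega>" using fin1 fin2 by simp
  have ne: "?\<Omega> \<noteq> {}"
    using pres_class_in_carrier[OF words_Nil, of X1 R1] pres_class_in_carrier[OF words_Nil, of X2 R2] by blast
  interpret free_model X1 X2 R1 R2 A Y \<phi>1 \<phi>2 w1 w2 S ?\<Omega>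
    by unfold_locales (fact S fin ne)+
  have "finite Y" using assms finite_subset by blast
  then have "finite (amalgam_relators R1 R2 Y w1 w2)"
    using assms by (simp add: amalgam_relators_def)
  then show ?thesis
    using decidable_normal_and_finite_index[of c] assms unfolding X_def R_def G_def by blast
qed

end
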